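(* Let $N\ge2$, $\gamma\in(0,2]$, and let $B(z,\sigma)=|z|^\gamma b\left(\frac{z}{|z|}\cdot\sigma\right)$, where $b:[-1,1]\to[0,\infty)$ is a Borel function satisfying $|\mathbb S^{N-2}|\int_0^\pi b(\cos\theta)\sin^{N-2}\theta\,d\theta=1$. Let $\rho>0$, $u\in\mathbb R^N$, $T>0$ and let $M\in\mathcal B^+_{\rho,u,T}(\mathbb R^N)$ be the Maxwellian. Then for any conservative measure strong solution $F_t$ of the spatially homogeneous Boltzmann equation with kernel $B$ and initial datum $F_0\in\mathcal B^+_{\rho,u,T}(\mathbb R^N)$: (i) If $0<\gamma<2$, then $$\forall\,t\ge0,\qquad \|F_t-M\|_0\ge(4\rho)^{1-\alpha}\,\|F_0-M\|_0^{\alpha}\,\exp\left(-\beta\,t^{\frac{2}{2-\gamma}}\right),$$ where $$\alpha=\left(\frac2\gamma\right)^{\frac{\gamma}{2-\gamma}},\qquad \beta=\left(1-\frac\gamma2\right)\left(2^6(N+1)^2\rho T^{\gamma/2}\right)^{\frac2{2-\gamma}}.$$ (ii) If $\gamma=2$, then $$\forall\,t\ge0,\qquad \|F_t-M\|_0\ge4\rho\left(\frac{\|F_0-M\|_0}{4\rho}\right)^{e^{\kappa t}}$$ with $\kappa=2^6(N+1)^2\rho T$.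
   Context: Notation: $\langle v\rangle=\sqrt{1+|v|^2}$; $|\mathbb S^{N-2}|$ is the Lebesgue measure of the $(N-2)$-dimensional unit sphere ($\mathbb S^0=\{-1,1\}$, $|\mathbb S^0|=2$). Measure spaces: for $s\ge0$, $\mathcal B_s(\mathbb R^N)$ is the Banach space of real (signed) Borel measures $F$ on $\mathbb R^N$ with $\|F\|_s:=\int\langle v\rangle^s\,d|F|(v)<\infty$, where $|F|$ is the total variation; $\mathcal B_s^+(\mathbb R^N)=\{F\in\mathcal B_s(\mathbb R^N): F\ge0\}$. For $\rho>0,u\in\mathbb R^N,T>0$, $\mathcal B^+_{\rho,u,T}(\mathbb R^N)$ is the set of $F\in\mathcal B_2^+(\mathbb R^N)$ with $\int dF=\rho$, $\frac1\rho\int v\,dF(v)=u$, $\frac1{N\rho}\int|v-u|^2\,dF(v)=T$. The Maxwellian $M\in\mathcal B^+_{\rho,u,T}(\mathbb R^N)$ is the measure with density $M(v)=\frac{\rho}{(2\pi T)^{N/2}}\exp\left(-\frac{|v-u|^2}{2T}\right)$. Collision operator: let $A_0=|\mathbb S^{N-2}|\int_0^\pi b(\cos\theta)\sin^{N-2}\theta\,d\theta$. For $F,G\in\mathcal B_{\gamma}(\mathbb R^N)$ the measures $Q^\pm(F,G)$ and $Q=Q^+-Q^-$ are defined by $$\int\psi\,dQ^+(F,G)=\iint L_B[\psi](v,v_* )\,dF(v)\,dG(v_* ),\qquad \int\psi\,dQ^-(F,G)=A_0\iint|v-v_*|^\gamma\psi(v)\,dF(v)\,dG(v_* )$$ for all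 bounded Borel $\psi$, where $L_B[\psi](v,v_* )=|v-v_*|^\gamma\int_{\mathbb S^{N-1}}b(\mathbf n\cdot\sigma)\psi(v')\,d\sigma$, $\mathbf n=\frac{v-v_*}{|v-v_*|}$ (a fixed unit vector if $v=v_*$), $v'=\frac{v+v_*}2+\frac{|v-v_*|}2\sigma$. Solutions: a family $\{F_t\}_{t\ge0}\subset\mathcal B_2^+(\mathbb R^N)$ is a measure strong solution of the spatially homogeneous Boltzmann equation if $\sup_{t\ge0}\|F_t\|_2<\infty$, $t\mapsto F_t\in C([0,\infty);\mathcal B_2(\mathbb R^N))\cap C^1([0,\infty);\mathcal B_0(\mathbb R^N))$ and $\frac{d}{dt}F_t=Q(F_t,F_t)$ for all $t\ge0$. It is conservative if $\int(1,v,|v|^2)\,dF_t=\int(1,v,|v|^2)\,dF_0$ for all $t\ge0$. *)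

theory Defs
  imports "HOL-Analysis.Analysis"
begin

section \<open>Real Borel measures\<close>

text \<open>Real (hence finite) signed Borel measures are countably additive set functions. The value 0
  off the Borel sets makes equality of signed measures agree with equality on Borel sets;
  \<open>F {} = 0\<close> follows from the convergence of the constant series.\<close>

typedef (overloaded) ('a::topological_space) signed_measure =
  "{F :: 'a set \<Rightarrow> real.
      (\<forall>A. A \<notin> sets borel \<longrightarrow> F A = 0) \<and>
      (\<forall>A :: nat \<Rightarrow> 'a set. range A \<subseteq> sets borel \<longrightarrow> disjoint_family A \<longrightarrow>
          (\<lambda>i. F (A i)) sums F (\<Union>i. A i))}"
  morphisms smeas Abs_signed_measure
  by (rule exI[of _ "\<lambda>_. 0"]) auto

setup_lifting type_definition_signed_measure

instantiation signed_measure :: (topological_space) real_vector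
begin

lift_definition zero_signed_measure :: "'a signed_measure" is "\<lambda>_. 0"
  by auto

lift_definition plus_signed_measure ::
    "'a signed_measure \<Rightarrow> 'a signed_measure \<Rightarrow> 'a signed_measure"
  is "\<lambda>F G A. F A + G A"
  by (auto intro: sums_add)

lift_definition minus_signed_measure ::
    "'a signed_measure \<Rightarrow> 'a signed_measure \<Rightarrow> 'a signed_measure"
  is "\<lambda>F G A. F A - G A"
  by (auto intro: sums_diff)

lift_definition uminus_signed_measure :: "'a signed_measure \<Rightarrow> 'a signed_measure"
  is "\<lambda>F A. - F A"
  by (auto intro: sums_minus)

lift_definition scaleR_signed_measure :: "real \<Rightarrow> 'a signed_measure \<Rightarrow> 'a signed_measure"
  is "\<lambda>c F A. c * F A"
  by (auto intro: sums_mult)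

instance
  by standard (transfer, auto simp: algebra_simps)+

end

text \<open>Positive, negative and total variation. The upper variation of \<open>F\<close> is
  \<open>F\<^sup>+(A) = sup {F(B) | B \<subseteq> A Borel}\<close>, the lower one is \<open>F\<^sup>- = (-F)\<^sup>+\<close>, and
  \<open>|F| = F\<^sup>+ + F\<^sup>-\<close>. In the supremum below \<open>ennreal\<close> truncates negative values to 0, which is
  harmless because \<open>B = {}\<close> contributes 0.\<close>

definition pos_variation :: "('a::topological_space) signed_measure \<Rightarrow> 'a measure" where
  "pos_variation F = measure_of UNIV (sets borel)
     (\<lambda>A. SUP B\<in>{B \<in> sets borel. B \<subseteq> A}. ennreal (smeas F B))"

definition neg_variation :: "('a::topological_space) signed_measure \<Rightarrow> 'a measure" where
  "neg_variation F = pos_variation (- F)"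

definition total_variation :: "('a::topological_space) signed_measure \<Rightarrow> 'a measure" where
  "total_variation F = measure_of UNIV (sets borel)
     (\<lambda>A. emeasure (pos_variation F) A + emeasure (neg_variation F) A)"

definition sint :: "('a::topological_space) signed_measure \<Rightarrow>
    ('a \<Rightarrow> 'b::{banach, second_countable_topology}) \<Rightarrow> 'b" where
  "sint F f = integral\<^sup>L (pos_variation F) f - integral\<^sup>L (neg_variation F) f"

definition of_measure :: "('a::topological_space) measure \<Rightarrow> 'a signed_measure" where
  "of_measure \<mu> = Abs_signed_measure (measure \<mu>)"

lemma smeas_of_measure:
  fixes \<mu> :: "('a::topological_space) measure"
  assumes "finite_measure \<mu>" "sets \<mu> = sets borel"
  shows "smeas (of_measure \<mu>) A = measure \<mu> A"
proof -
  interpret finite_measure \<mu> by fact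
  have "measure \<mu> A = 0" if "A \<notin> sets borel" for A
    using that assms(2) by (simp add: measure_notin_sets)
  moreover have "(\<lambda>i. measure \<mu> (A i)) sums measure \<mu> (\<Union>i. A i)"
    if "range A \<subseteq> sets borel" "disjoint_family A" for A :: "nat \<Rightarrow> 'a set"
    using that assms(2) by (intro finite_measure_UNION) auto
  ultimately show ?thesis
    unfolding of_measure_def by (subst Abs_signed_measure_inverse) auto
qed

section \<open>The spaces \<open>B\<^sub>s\<close>\<close>

definition bracket :: "'a::real_normed_vector \<Rightarrow> real" where
  "bracket v = sqrt (1 + (norm v)\<^sup>2)"

definition mnorm :: "real \<Rightarrow> ('a::euclidean_space) signed_measure \<Rightarrow> real" where
  "mnorm s F = (\<integral>v. bracket v powr s \<partial>total_variation F)"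

definition Bs :: "real \<Rightarrow> ('a::euclidean_space) signed_measure set" where
  "Bs s = {F. integrable (total_variation F) (\<lambda>v. bracket v powr s)}"

definition Bs_pos :: "real \<Rightarrow> ('a::euclidean_space) signed_measure set" where
  "Bs_pos s = {F \<in> Bs s. \<forall>A\<in>sets borel. 0 \<le> smeas F A}"

definition B_moments :: "real \<Rightarrow> 'a \<Rightarrow> real \<Rightarrow> ('a::euclidean_space) signed_measure set" where
  "B_moments \<rho> u T = {F \<in> Bs_pos 2.
      sint F (\<lambda>v. 1::real) = \<rho> \<and>
      (1 / \<rho>) *\<^sub>R sint F (\<lambda>v. v) = u \<and>
      1 / (real DIM('a) * \<rho>) * sint F (\<lambda>v. (norm (v - u))\<^sup>2) = T}"

definition maxwellian :: "real \<Rightarrow> 'a \<Rightarrow> real \<Rightarrow> ('a::euclidean_space) signed_measure" where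
  "maxwellian \<rho> u T = of_measure (density lborel (\<lambda>v. ennreal
     (\<rho> / (2 * pi * T) powr (real DIM('a) / 2) * exp (- (norm (v - u))\<^sup>2 / (2 * T)))))"

section \<open>The collision operator\<close>

text \<open>Surface measure on the unit sphere as cone measure: the measure of \<open>S\<close> is \<open>N\<close> times the
  Lebesgue measure of \<open>{r \<sigma> | 0 < r < 1, \<sigma> \<in> S}\<close>. Its underlying space is the sphere itself, so that
  an angular function that is Borel only on \<open>[-1,1]\<close> can be integrated.\<close>

definition sphere_measure :: "('a::euclidean_space) measure" where
  "sphere_measure = scale_measure (of_nat DIM('a))
     (distr (restrict_space lborel (ball 0 1 - {0})) (restrict_space borel (sphere 0 1)) sgn)"

text \<open>\<open>|S\<^sup>n|\<close>, the total surface measure of the unit sphere of \<open>\<real>\<^sup>n\<^sup>+\<^sup>1\<close> (so \<open>|S\<^sup>0| = 2\<close>).\<close>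

definition sphere_area :: "nat \<Rightarrow> real" where
  "sphere_area n = real (n + 1) * unit_ball_vol (real (n + 1))"

lemma sphere_area_0: "sphere_area 0 = 2"
  by (simp add: sphere_area_def)

lemma emeasure_sphere_measure:
  "emeasure (sphere_measure :: ('a::euclidean_space) measure) (sphere 0 1)
     = ennreal (sphere_area (DIM('a) - 1))"
proof -
  have m: "sgn \<in> measurable (restrict_space lborel (ball 0 1 - {0}))
                  (restrict_space borel (sphere (0::'a) 1))"
  proof (rule measurable_restrict_space2)
    show "sgn \<in> borel_measurable (restrict_space lborel (ball (0::'a) 1 - {0}))"
      unfolding sgn_div_norm by (rule measurable_restrict_space1) measurable
  qed (auto simp: space_restrict_space norm_sgn)
  have v: "sgn -` sphere 0 1 \<inter> (ball 0 1 - {0}) = ball (0::'a) 1 - {0}"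
    by (auto simp: norm_sgn)
  have s: "sphere (0::'a) 1 \<in> sets (restrict_space borel (sphere 0 1))"
    by (metis sets.top space_restrict_space2 space_borel borel_closed closed_sphere)
  have "emeasure (sphere_measure :: 'a measure) (sphere 0 1)
      = of_nat DIM('a) * emeasure lborel (ball (0::'a) 1 - {0})"
    unfolding sphere_measure_def
    by (simp add: emeasure_distr[OF m s] space_restrict_space v emeasure_restrict_space)
  also have "emeasure lborel (ball (0::'a) 1 - {0}) = emeasure lborel (ball (0::'a) 1)"
    by (intro emeasure_Diff_null_set) (auto simp: null_sets_def)
  also have "\<dots> = ennreal (unit_ball_vol (real DIM('a)))"
    by (simp add: emeasure_ball)
  finally show ?thesis
    by (simp add: sphere_area_def ennreal_mult ennreal_of_nat_eq_real_of_nat Suc_leI)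
qed

text \<open>\<open>A\<^sub>0\<close> for the angular function \<open>b\<close> in dimension \<open>N\<close>.\<close>

definition A0 :: "nat \<Rightarrow> (real \<Rightarrow> real) \<Rightarrow> real" where
  "A0 N b = sphere_area (N - 2) * (LBINT \<theta>:{0..pi}. b (cos \<theta>) * sin \<theta> ^ (N - 2))"

definition ndir :: "'a \<Rightarrow> 'a \<Rightarrow> 'a::euclidean_space" where
  "ndir v w = (if v = w then (SOME e. norm e = 1) else (1 / norm (v - w)) *\<^sub>R (v - w))"

definition vprime :: "'a \<Rightarrow> 'a \<Rightarrow> 'a \<Rightarrow> 'a::euclidean_space" where
  "vprime v w \<sigma> = (1 / 2) *\<^sub>R (v + w) + (norm (v - w) / 2) *\<^sub>R \<sigma>"

definition LB ::
    "(real \<Rightarrow> real) \<Rightarrow> real \<Rightarrow> ('a \<Rightarrow> real) \<Rightarrow> 'a \<Rightarrow> 'a::euclidean_space \<Rightarrow> real" where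
  "LB b \<gamma> \<psi> v w =
     norm (v - w) powr \<gamma> * (\<integral>\<sigma>. b (ndir v w \<bullet> \<sigma>) * \<psi> (vprime v w \<sigma>) \<partial>sphere_measure)"

text \<open>\<open>Q\<^sup>\<plusminus>(F,G)\<close> is the signed measure given by duality with bounded Borel functions; it is determined
  by this because indicator functions are admissible.\<close>

definition Qplus :: "(real \<Rightarrow> real) \<Rightarrow> real \<Rightarrow>
    'a signed_measure \<Rightarrow> 'a signed_measure \<Rightarrow> ('a::euclidean_space) signed_measure" where
  "Qplus b \<gamma> F G = (THE H. \<forall>\<psi> \<in> borel_measurable borel. bounded (range \<psi>) \<longrightarrow>
     sint H \<psi> = sint G (\<lambda>w. sint F (\<lambda>v. LB b \<gamma> \<psi> v w)))"

definition Qminus :: "(real \<Rightarrow> real) \<Rightarrow> real \<Rightarrow>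
    'a signed_measure \<Rightarrow> 'a signed_measure \<Rightarrow> ('a::euclidean_space) signed_measure" where
  "Qminus b \<gamma> F G = (THE H. \<forall>\<psi> \<in> borel_measurable borel. bounded (range \<psi>) \<longrightarrow>
     sint H \<psi> = A0 DIM('a) b * sint G (\<lambda>w. sint F (\<lambda>v. norm (v - w) powr \<gamma> * \<psi> v)))"

definition Qcoll :: "(real \<Rightarrow> real) \<Rightarrow> real \<Rightarrow>
    'a signed_measure \<Rightarrow> 'a signed_measure \<Rightarrow> ('a::euclidean_space) signed_measure" where
  "Qcoll b \<gamma> F G = Qplus b \<gamma> F G - Qminus b \<gamma> F G"

section \<open>Measure strong solutions\<close>

definition Bs_continuous :: "real \<Rightarrow> (real \<Rightarrow> ('a::euclidean_space) signed_measure) \<Rightarrow> bool" where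
  "Bs_continuous s F \<longleftrightarrow> (\<forall>t\<ge>0. F t \<in> Bs s) \<and>
     (\<forall>t\<ge>0. ((\<lambda>r. mnorm s (F r - F t)) \<longlongrightarrow> 0) (at t within {0..}))"

definition Bs_has_derivative :: "real \<Rightarrow> (real \<Rightarrow> ('a::euclidean_space) signed_measure) \<Rightarrow>
    (real \<Rightarrow> 'a signed_measure) \<Rightarrow> bool" where
  "Bs_has_derivative s F D \<longleftrightarrow> (\<forall>t\<ge>0. F t \<in> Bs s \<and> D t \<in> Bs s) \<and>
     (\<forall>t\<ge>0. ((\<lambda>r. mnorm s ((1 / (r - t)) *\<^sub>R (F r - F t) - D t)) \<longlongrightarrow> 0) (at t within {0..}))"

definition measure_strong_solution ::
    "(real \<Rightarrow> real) \<Rightarrow> real \<Rightarrow> (real \<Rightarrow> ('a::euclidean_space) signed_measure) \<Rightarrow> bool" where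
  "measure_strong_solution b \<gamma> F \<longleftrightarrow>
     (\<forall>t\<ge>0. F t \<in> Bs_pos 2) \<and>
     bdd_above ((\<lambda>t. mnorm 2 (F t)) ` {0..}) \<and>
     Bs_continuous 2 F \<and>
     (\<exists>D. Bs_has_derivative 0 F D \<and> Bs_continuous 0 D \<and>
          (\<forall>t\<ge>0. D t = Qcoll b \<gamma> (F t) (F t)))"

definition conservative :: "(real \<Rightarrow> ('a::euclidean_space) signed_measure) \<Rightarrow> bool" where
  "conservative F \<longleftrightarrow> (\<forall>t\<ge>0.
     sint (F t) (\<lambda>v. 1::real) = sint (F 0) (\<lambda>v. 1::real) \<and>
     sint (F t) (\<lambda>v. v) = sint (F 0) (\<lambda>v. v) \<and>
     sint (F t) (\<lambda>v. (norm v)\<^sup>2) = sint (F 0) (\<lambda>v. (norm v)\<^sup>2))"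

end

theory Submission
  imports Defs "HOL-Probability.Distributions"
begin

text \<open>
  Write \<open>H\<^sub>t = F\<^sub>t - M\<close> and \<open>y(t) = \<parallel>H\<^sub>t\<parallel>\<^sub>0\<close>. The Maxwellian is an
  equilibrium, \<open>Q(M,M) = 0\<close>, so the time derivative of \<open>F\<^sub>t\<close> is \<open>Q(F\<^sub>t,F\<^sub>t) - Q(M,M)\<close>. Every term of
  this difference has a factor \<open>H\<^sub>t\<close>, and its norm is at most a multiple of
  \<open>\<rho> \<integral> (|v-u|\<^sup>2 + N T) powr (\<gamma>/2) d|H\<^sub>t|\<close> (\<open>kern_integral_diff_le\<close>). The weight is unbounded, and
  controlling it through the energy of \<open>F\<^sub>t + M\<close> would give a power of \<open>y\<close> below one, which permits
  \<open>y\<close> to vanish in finite time. The better bound comes from conservation and positivity: mass and energy of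
  \<open>H\<^sub>t\<close> are zero, so mass and energy of \<open>|H\<^sub>t|\<close> are twice those of the negative part, and \<open>F\<^sub>t \<ge> 0\<close> puts
  the negative part below \<open>M\<close>. A measure of mass \<open>y/2\<close> below a Gaussian has energy of order
  \<open>y log(4\<rho>/y)\<close> at most, by Jensen's inequality for the exponential function. Jensen's inequality
  for the concave power \<open>\<gamma>/2\<close> then bounds the derivative of \<open>F\<^sub>t\<close> by \<open>C y log(4\<rho>/y) powr (\<gamma>/2)\<close>
  with \<open>C = 2\<^sup>6 (N+1)\<^sup>2 \<rho> T powr (\<gamma>/2)\<close> (\<open>collision_norm_bound\<close>).

  For \<open>z = log(4\<rho>/y)\<close> this says \<open>z' \<le> C z powr (\<gamma>/2)\<close>. If \<open>\<gamma> = 2\<close>, then \<open>z\<close> grows at most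
  exponentially. If \<open>\<gamma> < 2\<close>, then \<open>z powr (1 - \<gamma>/2)\<close> grows at most linearly, and convexity separates
  the initial value from the time, with the factors \<open>\<alpha>\<close> and \<open>\<beta>\<close> (\<open>comparison_power\<close>,
  \<open>comparison_exponential\<close>). Being a norm, \<open>y\<close> need not be differentiable, and the differential
  inequality is read as a bound on its one-sided difference quotients.

  The operators \<open>Q\<^sup>+\<close> and \<open>Q\<^sup>-\<close> are characterised among all signed measures, so
  identifying them takes the Jordan decomposition of an arbitrary signed measure. The
  normalisation \<open>A\<^sub>0 = 1\<close> is an integral over the polar angle, and it reaches the sphere through the
  formula for zonal functions (\<open>nn_integral_zonal\<close>). Finally, \<open>Q(M,M) = 0\<close> holds because, for given
  centre of mass and relative speed, the directions before and after a collision are both uniformly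
  distributed (\<open>maxwell_gain_eq_loss\<close>).
\<close>

section \<open>Jordan decomposition of signed measures\<close>

lemma smeas_notin: "A \<notin> sets borel \<Longrightarrow> smeas F A = 0"
  using smeas[of F] by auto

lemma smeas_sums:
  "range A \<subseteq> sets borel \<Longrightarrow> disjoint_family A \<Longrightarrow> (\<lambda>i. smeas F (A i)) sums smeas F (\<Union>i. A i)"
  using smeas[of F] by auto

lemma smeas_empty [simp]: "smeas F {} = 0"
proof -
  have "(\<lambda>i::nat. smeas F {}) sums smeas F (\<Union>i::nat. {})"
    by (rule smeas_sums) (auto simp: disjoint_family_on_def)
  then have "(\<lambda>i::nat. smeas F {}) \<longlonglongrightarrow> 0"
    by (intro summable_LIMSEQ_zero) (auto dest: sums_summable)
  then show ?thesis
    by (simp add: LIMSEQ_const_iff)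
qed

lemma smeas_Un:
  assumes "A \<in> sets borel" "B \<in> sets borel" "A \<inter> B = {}"
  shows "smeas F (A \<union> B) = smeas F A + smeas F B"
proof -
  have "(\<lambda>i. smeas F (binaryset A B i)) sums smeas F (\<Union>i. binaryset A B i)"
    using assms by (intro smeas_sums) (auto simp: binaryset_def disjoint_family_on_def)
  moreover have "(\<lambda>i. smeas F (binaryset A B i)) sums (\<Sum>i<2. smeas F (binaryset A B i))"
    by (rule sums_finite) (auto simp: binaryset_def)
  ultimately show ?thesis
    by (auto simp: UN_binaryset_eq binaryset_def eval_nat_numeral dest: sums_unique2)
qed

lemma smeas_Diff:
  assumes "A \<in> sets borel" "B \<in> sets borel" "B \<subseteq> A"
  shows "smeas F (A - B) = smeas F A - smeas F B"
proof -
  have "(A - B) \<inter> B = {}" "(A - B) \<union> B = A" using assms by auto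
  then show ?thesis using smeas_Un[of "A - B" B F] assms by simp
qed

lemma smeas_simps [simp]:
  "smeas (F + G) A = smeas F A + smeas G A"
  "smeas (F - G) A = smeas F A - smeas G A"
  "smeas (- F) A = - smeas F A"
  "smeas (c *\<^sub>R F) A = c * smeas F A"
  "smeas 0 A = 0"
  by (transfer, simp)+

lemma signed_measure_eqI:
  "(\<And>A. A \<in> sets borel \<Longrightarrow> smeas F A = smeas G A) \<Longrightarrow> F = G"
  by (metis smeas_inject smeas_notin ext)

text \<open>The set function behind \<open>pos_variation\<close>. It is a separate constant because \<open>measure_of\<close> turns it
  into a measure only once it is known to be countably additive.\<close>

definition upper :: "('a::topological_space) signed_measure \<Rightarrow> 'a set \<Rightarrow> ennreal" where
  "upper F A = (SUP B\<in>{B \<in> sets borel. B \<subseteq> A}. ennreal (smeas F B))"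

lemma upper_ge: "B \<in> sets borel \<Longrightarrow> B \<subseteq> A \<Longrightarrow> ennreal (smeas F B) \<le> upper F A"
  unfolding upper_def by (rule SUP_upper) auto

lemma upper_le: "(\<And>B. B \<in> sets borel \<Longrightarrow> B \<subseteq> A \<Longrightarrow> ennreal (smeas F B) \<le> c) \<Longrightarrow> upper F A \<le> c"
  unfolding upper_def by (rule SUP_least) auto

lemma upper_mono: "A \<subseteq> B \<Longrightarrow> upper F A \<le> upper F B"
  by (rule upper_le) (auto intro: upper_ge)

lemma upper_empty [simp]: "upper F {} = 0"
proof -
  have "upper F {} \<le> 0" by (rule upper_le) auto
  then show ?thesis by simp
qed

lemma upper_Un_ge:
  assumes "A \<in> sets borel" "B \<in> sets borel" "A \<inter> B = {}"
  shows "upper F A + upper F B \<le> upper F (A \<union> B)"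
proof -
  have 1: "ennreal (smeas F C) + ennreal (smeas F D) \<le> upper F (A \<union> B)"
    if "C \<in> sets borel" "C \<subseteq> A" "D \<in> sets borel" "D \<subseteq> B" for C D
  proof -
    consider "smeas F C \<le> 0" | "smeas F D \<le> 0" | "smeas F C \<ge> 0" "smeas F D \<ge> 0" by linarith
    then show ?thesis
    proof cases
      case 1
      then have "ennreal (smeas F C) = 0" by (simp add: ennreal_neg)
      then show ?thesis using upper_ge[of D "A \<union> B" F] that by auto
    next
      case 2
      then have "ennreal (smeas F D) = 0" by (simp add: ennreal_neg)
      then show ?thesis using upper_ge[of C "A \<union> B" F] that by auto
    next
      case 3
      then have "ennreal (smeas F C) + ennreal (smeas F D) = ennreal (smeas F (C \<union> D))"
        using that assms(3) by (subst smeas_Un) auto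
      also have "\<dots> \<le> upper F (A \<union> B)" using that by (intro upper_ge) auto
      finally show ?thesis .
    qed
  qed
  have 2: "upper F A + ennreal (smeas F D) \<le> upper F (A \<union> B)" if "D \<in> sets borel" "D \<subseteq> B" for D
    unfolding upper_def[of F A]
    by (subst ennreal_SUP_add_left[symmetric]) (auto intro!: SUP_least 1 that)
  show ?thesis
    unfolding upper_def[of F B]
    by (subst ennreal_SUP_add_right) (auto intro!: SUP_least 2)
qed

text \<open>A Borel subset of a disjoint union splits along the pieces, and \<open>F\<close> of it is at most the sum
  of the suprema. Conversely, subsets of finitely many pieces can be joined, which gives
  superadditivity, and monotonicity takes it to the limit.\<close>

lemma upper_countably_additive: "countably_additive (sets borel) (upper F)"
proof (rule countably_additiveI)
  fix A :: "nat \<Rightarrow> 'a set"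
  assume A: "range A \<subseteq> sets borel" "disjoint_family A" and U: "(\<Union>i. A i) \<in> sets borel"
  show "(\<Sum>i. upper F (A i)) = upper F (\<Union>i. A i)"
  proof (rule antisym)
    have *: "(\<Sum>i<n. upper F (A i)) \<le> upper F (\<Union>i<n. A i)" for n
    proof (induction n)
      case (Suc n)
      have "(\<Union>i<n. A i) \<inter> A n = {}"
        using A(2) unfolding disjoint_family_on_def by (auto dest: less_imp_neq)
      then have "upper F (\<Union>i<n. A i) + upper F (A n) \<le> upper F ((\<Union>i<n. A i) \<union> A n)"
        using A(1) by (intro upper_Un_ge) auto
      moreover have "(\<Union>i<n. A i) \<union> A n = (\<Union>i<Suc n. A i)"
        by (auto simp: lessThan_Suc)
      ultimately have "upper F (\<Union>i<n. A i) + upper F (A n) \<le> upper F (\<Union>i<Suc n. A i)"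
        by simp
      then show ?case
        unfolding sum.lessThan_Suc using add_right_mono[OF Suc, of "upper F (A n)"] by (rule order_trans[rotated])
    qed simp
    show "(\<Sum>i. upper F (A i)) \<le> upper F (\<Union>i. A i)"
    proof (rule suminf_le_const)
      show "(\<Sum>i<n. upper F (A i)) \<le> upper F (\<Union>i. A i)" for n
        by (rule order_trans[OF *]) (rule upper_mono, blast)
    qed simp
    show "upper F (\<Union>i. A i) \<le> (\<Sum>i. upper F (A i))"
    proof (rule upper_le)
      fix B assume B: "B \<in> sets borel" "B \<subseteq> (\<Union>i. A i)"
      have "(\<lambda>i. smeas F (B \<inter> A i)) sums smeas F (\<Union>i. B \<inter> A i)"
        using A B by (intro smeas_sums) (auto simp: disjoint_family_on_def)
      moreover have "(\<Union>i. B \<inter> A i) = B" using B(2) by blast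
      ultimately have "(\<lambda>i. smeas F (B \<inter> A i)) sums smeas F B" by simp
      then have lim: "(\<lambda>n. \<Sum>i<n. smeas F (B \<inter> A i)) \<longlonglongrightarrow> smeas F B"
        by (simp add: sums_def)
      have le: "ennreal (\<Sum>i<n. smeas F (B \<inter> A i)) \<le> (\<Sum>i. upper F (A i))" for n
      proof -
        have "ennreal (\<Sum>i<n. smeas F (B \<inter> A i)) \<le> ennreal (\<Sum>i<n. max 0 (smeas F (B \<inter> A i)))"
          by (intro ennreal_leI sum_mono) auto
        also have "\<dots> = (\<Sum>i<n. ennreal (max 0 (smeas F (B \<inter> A i))))"
          by (rule sum_ennreal[symmetric]) simp
        also have "\<dots> = (\<Sum>i<n. ennreal (smeas F (B \<inter> A i)))"
          by (intro sum.cong refl ennreal_max_0)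
        also have "\<dots> \<le> (\<Sum>i<n. upper F (A i))"
          using A B by (intro sum_mono upper_ge) auto
        also have "\<dots> \<le> (\<Sum>i. upper F (A i))"
          by (rule sum_le_suminf) auto
        finally show ?thesis .
      qed
      show "ennreal (smeas F B) \<le> (\<Sum>i. upper F (A i))"
        using tendsto_ennrealI[OF lim] by (rule LIMSEQ_le_const2) (use le in blast)
    qed
  qed
qed

lemma sets_pos_variation [simp, measurable_cong]: "sets (pos_variation F) = sets borel"
  unfolding pos_variation_def using sets.sigma_sets_eq[of borel] by (simp add: sets_measure_of_conv)

lemma space_pos_variation [simp]: "space (pos_variation F) = UNIV"
  unfolding pos_variation_def by (simp add: space_measure_of_conv)

lemma emeasure_pos_variation:
  assumes "A \<in> sets borel"
  shows "emeasure (pos_variation F) A = upper F A"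
proof -
  have eq: "pos_variation F = measure_of UNIV (sets borel) (upper F)"
    unfolding pos_variation_def upper_def[abs_def] ..
  have "sigma_algebra UNIV (sets (borel :: 'a measure))"
    using sets.sigma_algebra_axioms[of "borel :: 'a measure"] by simp
  then show ?thesis
    unfolding eq
    by (rule emeasure_measure_of_sigma)
       (auto simp: positive_def upper_countably_additive assms)
qed

text \<open>If \<open>C \<subseteq> A\<close> has charge above \<open>|F A| + 1\<close>, then \<open>C\<close> and \<open>A - C\<close> both have charge at least 1 in
  absolute value, and one of the two inherits the infinite supremum.\<close>

lemma upper_notfinite_split:
  assumes A: "A \<in> sets borel" and inf: "upper F A = top"
  shows "\<exists>B\<in>sets borel. B \<subseteq> A \<and> upper F B = top \<and> \<bar>smeas F (A - B)\<bar> \<ge> 1"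
proof -
  \<comment> \<open>Beyond this threshold \<open>F (A - C) = F A - F C\<close> is below \<open>-1\<close>.\<close>
  define c where "c = \<bar>smeas F A\<bar> + 1"
  have "\<exists>C\<in>sets borel. C \<subseteq> A \<and> smeas F C > c"
  proof (rule ccontr)
    assume "\<not> ?thesis"
    then have "upper F A \<le> ennreal c"
      by (intro upper_le) (auto intro!: ennreal_leI simp: not_less)
    then show False using inf by (simp add: top_unique)
  qed
  then obtain C where C: "C \<in> sets borel" "C \<subseteq> A" "smeas F C > c" by auto
  have fC: "\<bar>smeas F C\<bar> \<ge> 1" using C(3) unfolding c_def by linarith
  have fD: "\<bar>smeas F (A - C)\<bar> \<ge> 1" using C A unfolding c_def
    by (subst smeas_Diff) auto
  have "upper F A = upper F C + upper F (A - C)"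
  proof -
    have "emeasure (pos_variation F) C + emeasure (pos_variation F) (A - C)
        = emeasure (pos_variation F) (C \<union> (A - C))"
      using A C by (intro plus_emeasure) auto
    then show ?thesis using A C by (simp add: emeasure_pos_variation Un_absorb1)
  qed
  with inf have "upper F C + upper F (A - C) = top" by metis
  then have "upper F C = top \<or> upper F (A - C) = top" by (simp only: ennreal_add_eq_top)
  then show ?thesis
  proof
    assume "upper F C = top"
    then show ?thesis using C fD by blast
  next
    assume "upper F (A - C) = top"
    moreover have "A - (A - C) = C" using C by auto
    ultimately show ?thesis using C A fC by (intro bexI[of _ "A - C"]) auto
  qed
qed

text \<open>Repeated splitting would produce disjoint sets whose charges stay away from 0, against the
  convergence of the series of their charges.\<close>

lemma upper_finite: "upper F UNIV \<noteq> top"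
proof
  assume inf: "upper F UNIV = top"
  define P where "P A \<longleftrightarrow> A \<in> sets borel \<and> upper F A = top" for A
  have "\<exists>A. \<forall>n::nat. P (A n) \<and> (A (Suc n) \<subseteq> A n \<and> \<bar>smeas F (A n - A (Suc n))\<bar> \<ge> 1)"
  proof (rule dependent_nat_choice)
    show "\<exists>A. P A" using inf by (auto simp: P_def)
    show "\<exists>B. P B \<and> B \<subseteq> A \<and> \<bar>smeas F (A - B)\<bar> \<ge> 1" if "P A" for A and n :: nat
      using upper_notfinite_split[of A F] that unfolding P_def by blast
  qed
  then obtain A where A: "\<And>n::nat. A n \<in> sets borel" "\<And>n. A (Suc n) \<subseteq> A n"
      "\<And>n. \<bar>smeas F (A n - A (Suc n))\<bar> \<ge> 1"
    unfolding P_def by blast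
  have dec: "A m \<subseteq> A n" if "n \<le> m" for n m
    using A(2) that by (rule lift_Suc_antimono_le)
  have "disjoint_family (\<lambda>n. A n - A (Suc n))"
    unfolding disjoint_family_on_def
  proof (intro ballI impI)
    fix m n :: nat assume "m \<noteq> n"
    then consider "Suc m \<le> n" | "Suc n \<le> m" by linarith
    then show "(A m - A (Suc m)) \<inter> (A n - A (Suc n)) = {}"
      by cases (use dec in blast)+
  qed
  then have "(\<lambda>n. smeas F (A n - A (Suc n))) sums smeas F (\<Union>n. A n - A (Suc n))"
    using A(1) by (intro smeas_sums) auto
  then have "(\<lambda>n. smeas F (A n - A (Suc n))) \<longlonglongrightarrow> 0"
    by (intro summable_LIMSEQ_zero) (auto dest: sums_summable)
  from tendstoD[OF this, of 1] have "\<forall>\<^sub>F n in sequentially. \<bar>smeas F (A n - A (Suc n))\<bar> < 1"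
    by (simp add: dist_real_def)
  then show False
    using A(3) by (auto simp: eventually_sequentially not_le[symmetric])
qed

lemma finite_measure_pos_variation: "finite_measure (pos_variation F)"
  by (rule finite_measureI) (simp add: emeasure_pos_variation upper_finite)

lemma measure_pos_variation:
  "A \<in> sets borel \<Longrightarrow> ennreal (measure (pos_variation F) A) = upper F A"
  using finite_measure.emeasure_eq_measure[OF finite_measure_pos_variation, of F A]
  by (simp add: emeasure_pos_variation)

lemma smeas_le_measure_pos_variation:
  assumes "A \<in> sets borel" "B \<in> sets borel" "B \<subseteq> A"
  shows "smeas F B \<le> measure (pos_variation F) A"
  using upper_ge[OF assms(2,3), of F] by (simp flip: measure_pos_variation[OF assms(1)] add: ennreal_le_iff)

lemma measure_pos_variation_le:
  assumes "A \<in> sets borel" "\<And>B. B \<in> sets borel \<Longrightarrow> B \<subseteq> A \<Longrightarrow> smeas F B \<le> c"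
  shows "measure (pos_variation F) A \<le> c"
proof -
  have "0 \<le> c" using assms(2)[of "{}"] by simp
  moreover have "upper F A \<le> ennreal c" using assms(2) by (intro upper_le ennreal_leI) auto
  ultimately show ?thesis using assms(1) by (simp flip: measure_pos_variation add: ennreal_le_iff)
qed

text \<open>Since \<open>F B = F A - F (A - B)\<close> for \<open>B \<subseteq> A\<close>, large charges of subsets correspond to small charges
  of their complements in \<open>A\<close>.\<close>

lemma jordan_decomposition:
  "smeas F A = measure (pos_variation F) A - measure (neg_variation F) A"
proof (cases "A \<in> sets borel")
  case True
  have "measure (neg_variation F) A \<le> measure (pos_variation F) A - smeas F A"
    unfolding neg_variation_def
  proof (rule measure_pos_variation_le[OF True])
    fix B assume B: "B \<in> sets borel" "B \<subseteq> A"
    have "smeas F (A - B) \<le> measure (pos_variation F) A"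
      using B True by (intro smeas_le_measure_pos_variation) auto
    then show "smeas (- F) B \<le> measure (pos_variation F) A - smeas F A"
      using B True by (simp add: smeas_Diff)
  qed
  moreover have "measure (pos_variation F) A \<le> smeas F A + measure (neg_variation F) A"
  proof (rule measure_pos_variation_le[OF True])
    fix B assume B: "B \<in> sets borel" "B \<subseteq> A"
    have "smeas (- F) (A - B) \<le> measure (neg_variation F) A"
      unfolding neg_variation_def using B True by (intro smeas_le_measure_pos_variation) auto
    then show "smeas F B \<le> smeas F A + measure (neg_variation F) A"
      using B True by (simp add: smeas_Diff)
  qed
  ultimately show ?thesis by simp
next
  case False
  then show ?thesis by (simp add: smeas_notin measure_notin_sets neg_variation_def)
qed

lemma sets_neg_variation [simp, measurable_cong]: "sets (neg_variation F) = sets borel"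
  by (simp add: neg_variation_def)

lemma space_neg_variation [simp]: "space (neg_variation F) = UNIV"
  by (simp add: neg_variation_def)

lemma finite_measure_neg_variation: "finite_measure (neg_variation F)"
  unfolding neg_variation_def by (rule finite_measure_pos_variation)

lemma sets_total_variation [simp, measurable_cong]: "sets (total_variation F) = sets borel"
  unfolding total_variation_def using sets.sigma_sets_eq[of borel] by (simp add: sets_measure_of_conv)

lemma space_total_variation [simp]: "space (total_variation F) = UNIV"
  unfolding total_variation_def by (simp add: space_measure_of_conv)

lemma emeasure_total_variation:
  assumes "A \<in> sets borel"
  shows "emeasure (total_variation F) A = emeasure (pos_variation F) A + emeasure (neg_variation F) A"
proof -
  have sa: "sigma_algebra UNIV (sets (borel :: 'a measure))"
    using sets.sigma_algebra_axioms[of "borel :: 'a measure"] by simp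
  have "countably_additive (sets borel)
      (\<lambda>A. emeasure (pos_variation F) A + emeasure (neg_variation F) A)"
    by (rule countably_additiveI) (auto simp: suminf_add[symmetric] intro!: suminf_emeasure arg_cong2[where f="(+)"])
  with sa show ?thesis
    unfolding total_variation_def
    by (rule_tac emeasure_measure_of_sigma) (auto simp: positive_def assms)
qed

lemma mnorm_0:
  "mnorm 0 F = measure (pos_variation F) UNIV + measure (neg_variation F) UNIV"
proof -
  interpret p: finite_measure "pos_variation F" by (rule finite_measure_pos_variation)
  interpret n: finite_measure "neg_variation F" by (rule finite_measure_neg_variation)
  have "bracket v powr 0 = 1" for v :: 'a
    by (simp add: bracket_def add_nonneg_eq_0_iff)
  then have "mnorm 0 F = measure (total_variation F) UNIV"
    by (simp add: mnorm_def)
  also have "\<dots> = measure (pos_variation F) UNIV + measure (neg_variation F) UNIV"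
    unfolding measure_def
    by (simp add: emeasure_total_variation p.emeasure_eq_measure n.emeasure_eq_measure flip: ennreal_plus)
  finally show ?thesis .
qed

lemma mnorm_0_nonneg [simp]: "0 \<le> mnorm 0 F"
  by (simp add: mnorm_0)

lemma mnorm_0_triangle: "mnorm 0 (F + G) \<le> mnorm 0 F + mnorm 0 G"
proof -
  have *: "measure (pos_variation (F + G)) UNIV
      \<le> measure (pos_variation F) UNIV + measure (pos_variation G) UNIV" for F G :: "'a signed_measure"
    by (rule measure_pos_variation_le) (auto intro!: add_mono smeas_le_measure_pos_variation)
  show ?thesis
    using *[of F G] *[of "-F" "-G"] by (simp add: mnorm_0 neg_variation_def)
qed

lemma mnorm_0_uminus: "mnorm 0 (- F) = mnorm 0 F"
  by (simp add: mnorm_0 neg_variation_def)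

lemma mnorm_0_scaleR: "mnorm 0 (c *\<^sub>R F) \<le> \<bar>c\<bar> * mnorm 0 F"
proof -
  have *: "measure (pos_variation (c *\<^sub>R F)) UNIV \<le> c * measure (pos_variation F) UNIV"
    if "c \<ge> 0" for c and F :: "'a signed_measure"
    using that by (intro measure_pos_variation_le)
      (auto intro!: mult_left_mono smeas_le_measure_pos_variation)
  have **: "mnorm 0 (c *\<^sub>R F) \<le> c * mnorm 0 F" if "c \<ge> 0" for c and F :: "'a signed_measure"
    using *[OF that, of F] *[OF that, of "-F"] by (simp add: mnorm_0 neg_variation_def algebra_simps)
  show ?thesis
  proof (cases "c \<ge> 0")
    case False
    then show ?thesis using **[of "-c" F] mnorm_0_uminus[of "c *\<^sub>R F"] by simp
  qed (use ** in simp)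
qed

text \<open>The positive and the negative variation are suprema of \<open>F\<close> and \<open>-F\<close>, whence the factor 2.\<close>

lemma mnorm_0_le:
  assumes "\<And>A. A \<in> sets borel \<Longrightarrow> \<bar>smeas F A\<bar> \<le> c"
  shows "mnorm 0 F \<le> 2 * c"
proof -
  have "measure (pos_variation F) UNIV \<le> c" "measure (neg_variation F) UNIV \<le> c"
    unfolding neg_variation_def using assms by (auto intro!: measure_pos_variation_le simp: abs_le_iff)
  then show ?thesis by (simp add: mnorm_0)
qed

lemma pos_variation_nonneg:
  assumes "\<And>A. A \<in> sets borel \<Longrightarrow> 0 \<le> smeas F A"
  shows "A \<in> sets borel \<Longrightarrow> measure (pos_variation F) A = smeas F A"
    and "neg_variation F = null_measure borel"
    and "of_measure (pos_variation F) = F"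
proof -
  have "measure (neg_variation F) UNIV \<le> 0"
    unfolding neg_variation_def using assms by (intro measure_pos_variation_le) auto
  then have n0: "emeasure (neg_variation F) UNIV = 0"
    using finite_measure.emeasure_eq_measure[OF finite_measure_neg_variation[of F], of UNIV]
    by (simp add: ennreal_eq_0_iff)
  then have n: "emeasure (neg_variation F) A = 0" if "A \<in> sets borel" for A
    using emeasure_mono[of A UNIV "neg_variation F"] that by simp
  show "neg_variation F = null_measure borel"
    by (rule measure_eqI) (auto simp: n)
  then have eq: "measure (pos_variation F) A = smeas F A" for A
    using jordan_decomposition[of F A] by simp
  then show "A \<in> sets borel \<Longrightarrow> measure (pos_variation F) A = smeas F A" by simp
  show "of_measure (pos_variation F) = F"
    by (rule signed_measure_eqI) (simp add: smeas_of_measure finite_measure_pos_variation eq)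
qed

lemma pos_variation_of_measure:
  assumes "finite_measure \<mu>" "sets \<mu> = sets borel"
  shows "pos_variation (of_measure \<mu>) = \<mu>"
proof (rule measure_eqI)
  interpret finite_measure \<mu> by fact
  interpret p: finite_measure "pos_variation (of_measure \<mu>)" by (rule finite_measure_pos_variation)
  fix A assume "A \<in> sets (pos_variation (of_measure \<mu>))"
  then have "measure (pos_variation (of_measure \<mu>)) A = measure \<mu> A"
    using pos_variation_nonneg(1)[of "of_measure \<mu>" A] by (simp add: smeas_of_measure assms)
  then show "emeasure (pos_variation (of_measure \<mu>)) A = emeasure \<mu> A"
    by (simp add: emeasure_eq_measure p.emeasure_eq_measure)
qed (use assms in simp)

lemma sint_of_measure:
  assumes "finite_measure \<mu>" "sets \<mu> = sets borel"
  shows "sint (of_measure \<mu>) f = integral\<^sup>L \<mu> f"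
proof -
  have "neg_variation (of_measure \<mu>) = null_measure borel"
    by (rule pos_variation_nonneg(2)) (simp add: smeas_of_measure assms)
  then show ?thesis
    by (simp add: sint_def pos_variation_of_measure assms)
qed

lemma sint_indicator: "A \<in> sets borel \<Longrightarrow> sint F (indicator A :: _ \<Rightarrow> real) = smeas F A"
  by (simp add: sint_def jordan_decomposition)

lemma signed_measure_eqI_sint:
  assumes "\<forall>\<psi> \<in> borel_measurable borel. bounded (range \<psi>) \<longrightarrow> sint F \<psi> = I \<psi>"
    and "\<forall>\<psi> \<in> borel_measurable borel. bounded (range \<psi>) \<longrightarrow> sint G \<psi> = (I \<psi> :: real)"
  shows "F = G"
proof (rule signed_measure_eqI)
  fix A :: "'a set" assume A: "A \<in> sets borel"
  have "bounded (range (indicator A :: 'a \<Rightarrow> real))"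
    by (rule boundedI[of _ 1]) (auto simp: indicator_def)
  moreover have "(indicator A :: 'a \<Rightarrow> real) \<in> borel_measurable borel" using A by simp
  ultimately have "sint F (indicator A) = sint G (indicator A :: 'a \<Rightarrow> real)"
    using assms by auto
  then show "smeas F A = smeas G A" using A by (simp add: sint_indicator)
qed

text \<open>Indicator functions are bounded Borel functions, so a signed measure is determined by its
  integrals of such functions. Hence any finite measure with the right integrals is the one
  described in \<open>Qplus\<close> or \<open>Qminus\<close>.\<close>

lemma the_signed_measure_eq:
  assumes "finite_measure \<nu>" "sets \<nu> = sets borel"
    and "\<And>\<psi>. \<psi> \<in> borel_measurable borel \<Longrightarrow> bounded (range \<psi>) \<Longrightarrow> integral\<^sup>L \<nu> \<psi> = (I \<psi> :: real)"
  shows "(THE H. \<forall>\<psi> \<in> borel_measurable borel. bounded (range \<psi>) \<longrightarrow> sint H \<psi> = I \<psi>) = of_measure \<nu>"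
proof (rule the_equality)
  show "\<forall>\<psi> \<in> borel_measurable borel. bounded (range \<psi>) \<longrightarrow> sint (of_measure \<nu>) \<psi> = I \<psi>"
    using assms by (auto simp: sint_of_measure)
  then show "H = of_measure \<nu>"
    if "\<forall>\<psi> \<in> borel_measurable borel. bounded (range \<psi>) \<longrightarrow> sint H \<psi> = I \<psi>" for H
    using that signed_measure_eqI_sint by metis
qed

section \<open>Lebesgue measure under translations, dilations and reflections\<close>

lemma nn_integral_lborel_translate:
  fixes f :: "'a::euclidean_space \<Rightarrow> ennreal"
  assumes [measurable]: "f \<in> borel_measurable borel"
  shows "(\<integral>\<^sup>+x. f (x + a) \<partial>lborel) = (\<integral>\<^sup>+x. f x \<partial>lborel)"
proof -
  have "(\<integral>\<^sup>+x. f x \<partial>lborel) = (\<integral>\<^sup>+x. f x \<partial>distr lborel borel ((+) a))"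
    by (simp add: lborel_distr_plus)
  also have "\<dots> = (\<integral>\<^sup>+x. f (a + x) \<partial>lborel)"
    by (subst nn_integral_distr) auto
  finally show ?thesis by (simp add: add.commute)
qed

lemma nn_integral_lborel_scale:
  fixes f :: "'a::euclidean_space \<Rightarrow> ennreal"
  assumes [measurable]: "f \<in> borel_measurable borel" and c: "c > 0"
  shows "(\<integral>\<^sup>+x. f x \<partial>lborel) = ennreal (c ^ DIM('a)) * (\<integral>\<^sup>+x. f (c *\<^sub>R x) \<partial>lborel)"
  using c by (subst lborel_affine[of c 0])
     (simp_all add: nn_integral_density nn_integral_distr nn_integral_cmult)

text \<open>The uniqueness proof for Haar measure: with \<open>g\<close> the indicator of the unit ball, the product of
  the integrals of \<open>f \<circ> R\<close> and \<open>g\<close> becomes, by a translation in one variable and then one in the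
  other, the product of the integrals of \<open>f\<close> and \<open>x \<mapsto> g (- R x)\<close>; and \<open>g\<close> is invariant under \<open>R\<close>
  and under \<open>-1\<close>.\<close>

lemma nn_integral_lborel_involution:
  fixes f :: "'a::euclidean_space \<Rightarrow> ennreal"
  assumes [measurable]: "f \<in> borel_measurable borel"
    and lin: "linear R" and norm_R: "\<And>x. norm (R x) = norm x" and inv: "\<And>x. R (R x) = x"
  shows "(\<integral>\<^sup>+x. f (R x) \<partial>lborel) = (\<integral>\<^sup>+x. f x \<partial>lborel)"
proof -
  have [measurable]: "R \<in> borel_measurable borel"
    using lin by (intro borel_measurable_continuous_onI linear_continuous_on linear_conv_bounded_linear[THEN iffD1])
  have R_add: "R (x + y) = R x + R y" for x y
    using lin by (rule linear_add)
  define g :: "'a \<Rightarrow> ennreal" where "g = indicator (ball 0 1)"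
  have [measurable]: "g \<in> borel_measurable borel"
    unfolding g_def by (intro borel_measurable_indicator) auto
  have g_even: "g (- x) = g x" and g_R: "g (R x) = g x" for x
    by (auto simp: g_def norm_R indicator_def)
  define c where "c = (\<integral>\<^sup>+x. g x \<partial>lborel)"
  have c: "c = ennreal (unit_ball_vol DIM('a))"
    by (simp add: c_def g_def emeasure_ball)
  have "(\<integral>\<^sup>+x. f (R x) \<partial>lborel) * c = (\<integral>\<^sup>+x. \<integral>\<^sup>+y. f (R x) * g y \<partial>lborel \<partial>lborel)"
    by (simp add: nn_integral_cmult nn_integral_multc c_def)
  also have "\<dots> = (\<integral>\<^sup>+x. \<integral>\<^sup>+y. f (R x) * g (y + - R x) \<partial>lborel \<partial>lborel)"
  proof (rule nn_integral_cong)
    fix x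
    show "(\<integral>\<^sup>+y. f (R x) * g y \<partial>lborel) = (\<integral>\<^sup>+y. f (R x) * g (y + - R x) \<partial>lborel)"
      using nn_integral_lborel_translate[of "\<lambda>y. f (R x) * g y" "- R x"] by simp
  qed
  also have "\<dots> = (\<integral>\<^sup>+y. \<integral>\<^sup>+x. f (R x) * g (y + - R x) \<partial>lborel \<partial>lborel)"
    by (rule lborel_pair.Fubini') simp
  also have "\<dots> = (\<integral>\<^sup>+y. \<integral>\<^sup>+x. f (R x + y) * g (- R x) \<partial>lborel \<partial>lborel)"
  proof (rule nn_integral_cong)
    fix y
    have "(\<integral>\<^sup>+x. f (R x) * g (y + - R x) \<partial>lborel)
        = (\<integral>\<^sup>+x. f (R (x + R y)) * g (y + - R (x + R y)) \<partial>lborel)"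
      by (subst nn_integral_lborel_translate[of "\<lambda>x. f (R x) * g (y + - R x)" "R y"]) simp_all
    then show "(\<integral>\<^sup>+x. f (R x) * g (y + - R x) \<partial>lborel) = (\<integral>\<^sup>+x. f (R x + y) * g (- R x) \<partial>lborel)"
      by (simp add: R_add inv)
  qed
  also have "\<dots> = (\<integral>\<^sup>+x. \<integral>\<^sup>+y. f (R x + y) * g (- R x) \<partial>lborel \<partial>lborel)"
    by (rule lborel_pair.Fubini') simp
  also have "\<dots> = (\<integral>\<^sup>+x. \<integral>\<^sup>+y. f (y + R x) * g x \<partial>lborel \<partial>lborel)"
    by (simp add: g_even g_R add.commute)
  also have "\<dots> = (\<integral>\<^sup>+x. f x \<partial>lborel) * c"
    by (simp add: nn_integral_cmult nn_integral_multc nn_integral_lborel_translate c_def)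
  finally have "c * (\<integral>\<^sup>+x. f (R x) \<partial>lborel) = c * (\<integral>\<^sup>+x. f x \<partial>lborel)"
    by (simp only: mult.commute)
  moreover have "c \<noteq> 0" "c \<noteq> top"
    using unit_ball_vol_pos[of "real DIM('a)", OF of_nat_0_le_iff]
    by (simp_all add: c ennreal_eq_0_iff not_le)
  ultimately show ?thesis by (simp add: ennreal_mult_cancel_left)
qed

definition reflect :: "'a::euclidean_space \<Rightarrow> 'a \<Rightarrow> 'a" where
  "reflect d x = x - (2 * (x \<bullet> d) / (d \<bullet> d)) *\<^sub>R d"

lemma reflect_linear: "linear (reflect d)"
  unfolding reflect_def by (rule linearI) (auto simp: inner_simps algebra_simps add_divide_distrib)

lemma reflect_inner: "reflect d x \<bullet> reflect d y = x \<bullet> y"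
  by (cases "d = 0") (auto simp: reflect_def inner_simps inner_commute divide_simps)

lemma reflect_norm: "norm (reflect d x) = norm x"
  by (simp add: norm_eq_sqrt_inner reflect_inner)

lemma reflect_reflect: "reflect d (reflect d x) = x"
  by (cases "d = 0") (auto simp: reflect_def inner_simps divide_simps algebra_simps simp flip: scaleR_add_left)

lemma reflect_diff:
  assumes "norm a = norm b"
  shows "reflect (a - b) a = b"
proof (cases "a = b")
  case False
  have ab: "a \<bullet> a = b \<bullet> b" using assms by (simp add: norm_eq_sqrt_inner)
  have "(a - b) \<bullet> (a - b) \<noteq> 0" using False by simp
  moreover have "2 * (a \<bullet> (a - b)) = (a - b) \<bullet> (a - b)"
    using ab by (simp add: inner_simps inner_commute)
  ultimately show ?thesis unfolding reflect_def by simp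
qed (simp add: reflect_def)

section \<open>Surface measure, polar coordinates and zonal functions\<close>

text \<open>The surface measure pushed to the whole space. Its \<open>\<sigma>\<close>-algebra is then the Borel algebra, and
  products with it are again of Borel type.\<close>

definition usphere :: "('a::euclidean_space) measure" where
  "usphere = distr sphere_measure borel (\<lambda>x. x)"

lemma sets_usphere [simp, measurable_cong]: "sets usphere = sets borel"
  by (simp add: usphere_def)

lemma space_usphere [simp]: "space usphere = UNIV"
  by (simp add: usphere_def)

lemma sets_sphere_measure: "sets sphere_measure = sets (restrict_space borel (sphere 0 1))"
  by (simp add: sphere_measure_def)

lemma measurable_id_sphere_measure [simp]: "(\<lambda>x. x) \<in> sphere_measure \<rightarrow>\<^sub>M borel"
  by (subst measurable_cong_sets[OF sets_sphere_measure refl]) (rule measurable_restrict_space1, simp)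

lemma nn_integral_usphere:
  fixes f :: "'a::euclidean_space \<Rightarrow> ennreal"
  assumes f [measurable]: "f \<in> borel_measurable borel"
  shows "(\<integral>\<^sup>+\<sigma>. f \<sigma> \<partial>usphere)
    = of_nat DIM('a) * (\<integral>\<^sup>+y. indicator (ball 0 1 - {0}) y * f (sgn y) \<partial>lborel)"
proof -
  have m [measurable]: "sgn \<in> measurable (restrict_space lborel (ball 0 1 - {0}))
                  (restrict_space borel (sphere (0::'a) 1))"
  proof (rule measurable_restrict_space2)
    show "sgn \<in> borel_measurable (restrict_space lborel (ball (0::'a) 1 - {0}))"
      by (rule measurable_restrict_space1) simp
  qed (auto simp: space_restrict_space norm_sgn)
  have f': "f \<in> borel_measurable (restrict_space borel (sphere 0 1))"
    using f by (rule measurable_restrict_space1)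
  have "(\<integral>\<^sup>+\<sigma>. f \<sigma> \<partial>usphere) = (\<integral>\<^sup>+\<sigma>. f \<sigma> \<partial>sphere_measure)"
    unfolding usphere_def by (subst nn_integral_distr) auto
  also have "\<dots> = of_nat DIM('a) * (\<integral>\<^sup>+y. f (sgn y) \<partial>restrict_space lborel (ball 0 1 - {0}))"
    unfolding sphere_measure_def using f'
    by (subst nn_integral_scale_measure) (auto simp: nn_integral_distr[OF m])
  also have "\<dots> = of_nat DIM('a) * (\<integral>\<^sup>+y. indicator (ball 0 1 - {0}) y * f (sgn y) \<partial>lborel)"
    by (subst nn_integral_restrict_space) (auto simp: mult.commute)
  finally show ?thesis .
qed

lemma AE_usphere: "AE \<sigma> in (usphere :: 'a::euclidean_space measure). norm \<sigma> = 1"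
  unfolding usphere_def
proof (subst AE_distr_iff)
  show "AE x in sphere_measure. norm x = 1"
    by (rule AE_I2) (simp add: sphere_measure_def space_scale_measure space_restrict_space)
qed auto

lemma finite_measure_usphere: "finite_measure (usphere :: 'a::euclidean_space measure)"
proof (rule finite_measureI)
  have "emeasure (usphere :: 'a measure) UNIV = (\<integral>\<^sup>+\<sigma>. 1 \<partial>(usphere :: 'a measure))" by simp
  also have "\<dots> = of_nat DIM('a) * (\<integral>\<^sup>+y. indicator (ball 0 1 - {0}) y * 1 \<partial>(lborel :: 'a measure))"
    by (rule nn_integral_usphere) simp
  also have "\<dots> = of_nat DIM('a) * emeasure lborel (ball (0::'a) 1 - {0})" by simp
  also have "\<dots> < \<infinity>"
    using emeasure_mono[of "ball (0::'a) 1 - {0}" "ball 0 1" lborel]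
    by (auto simp: ennreal_mult_less_top emeasure_ball ennreal_of_nat_eq_real_of_nat intro: le_less_trans)
  finally show "emeasure (usphere :: 'a measure) (space usphere) \<noteq> \<infinity>" by simp
qed

interpretation usphere: finite_measure "usphere :: 'a::euclidean_space measure"
  by (rule finite_measure_usphere)

lemma nn_integral_power_tail:
  assumes "a > 0" "n > 0"
  shows "(\<integral>\<^sup>+s. indicator {a<..} s * ennreal (1 / s ^ Suc n) \<partial>lborel) = ennreal (1 / (real n * a ^ n))"
proof -
  define F where "F s = - (1 / (real n * s ^ n))" for s :: real
  have "(\<integral>\<^sup>+s. indicator {a<..} s * ennreal (1 / s ^ Suc n) \<partial>lborel)
      = (\<integral>\<^sup>+s. ennreal (1 / s ^ Suc n) * indicator {a..} s \<partial>lborel)"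
  proof (rule nn_integral_cong_AE)
    show "AE x in lborel. indicator {a<..} x * ennreal (1 / x ^ Suc n)
        = ennreal (1 / x ^ Suc n) * indicator {a..} x"
      using AE_lborel_singleton[of a] by eventually_elim (auto simp: indicator_def)
  qed
  also have "\<dots> = 0 - F a"
  proof (rule nn_integral_FTC_atLeast)
    fix x assume "a \<le> x"
    then have x: "x > 0" using assms by simp
    have "(F has_real_derivative (real n * (real n * x ^ (n - 1)) / (real n * x ^ n)\<^sup>2)) (at x)"
      unfolding F_def using x assms
      by (auto intro!: derivative_eq_intros simp: power2_eq_square)
    moreover have "real n * (real n * x ^ (n - 1)) / (real n * x ^ n)\<^sup>2 = 1 / x ^ Suc n"
    proof -
      obtain k where k: "n = Suc k" using assms by (cases n) auto
      have "c * (c * x ^ k) / (c * x ^ Suc k)\<^sup>2 = 1 / x ^ Suc (Suc k)" if "c \<noteq> 0" for c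
        using x that by (simp add: field_simps power2_eq_square)
      from this[of "real n"] show ?thesis using assms k by simp
    qed
    ultimately show "(F has_real_derivative 1 / x ^ Suc n) (at x)" by simp
    show "0 \<le> 1 / x ^ Suc n" using x by simp
  next
    have "filterlim (\<lambda>s::real. real n * s ^ n) at_top at_top"
      using assms by (intro filterlim_tendsto_pos_mult_at_top[OF tendsto_const]
          filterlim_pow_at_top filterlim_ident) auto
    then have "((\<lambda>s. 1 / (real n * s ^ n)) \<longlongrightarrow> 0) at_top"
      by (rule tendsto_divide_0[OF tendsto_const filterlim_at_top_imp_at_infinity])
    then show "(F \<longlongrightarrow> 0) at_top"
      unfolding F_def using tendsto_minus by fastforce
  qed simp
  finally show ?thesis by (simp add: F_def)
qed

text \<open>Tonelli and dilations suffice. With the cone description of the surface measure the right-hand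
  side is \<open>N \<integral> r^(N-1) \<integral> f (r y/|y|) dy dr\<close> over \<open>r > 0\<close> and \<open>|y| < 1\<close>; putting \<open>r = s |y|\<close> and
  then \<open>x = s y\<close> gives \<open>\<integral> f x |x|^N (N \<integral> s^(-N-1) ds) dx\<close> with \<open>s > |x|\<close>, and the bracket is
  \<open>|x|^(-N)\<close>.\<close>

lemma nn_integral_polar:
  fixes f :: "'a::euclidean_space \<Rightarrow> ennreal"
  assumes [measurable]: "f \<in> borel_measurable borel"
  shows "(\<integral>\<^sup>+x. f x \<partial>lborel)
    = (\<integral>\<^sup>+r. indicator {0<..} r * ennreal (r ^ (DIM('a) - 1)) * (\<integral>\<^sup>+\<sigma>. f (r *\<^sub>R \<sigma>) \<partial>usphere) \<partial>lborel)"
proof -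
  define N where "N = DIM('a)"
  have N: "N > 0" by (simp add: N_def)
  have rN: "r ^ N = r * r ^ (N - 1)" for r :: real using N by (cases N) auto
  define B :: "'a \<Rightarrow> ennreal" where "B = indicator (ball 0 1 - {0})"
  define I :: "real \<Rightarrow> ennreal" where "I = indicator {0<..}"
  let ?A = "\<lambda>r y. of_nat N * (I r * ennreal (r ^ (N - 1)) * (B y * f (r *\<^sub>R sgn y)))"
  let ?C = "\<lambda>s y. of_nat N * (I s * ennreal (norm y ^ N * s ^ (N - 1)) * (B y * f (s *\<^sub>R y)))"
  let ?E = "\<lambda>s x. of_nat N * (ennreal (norm x ^ N) * f x) * (indicator {norm x<..} s * ennreal (1 / s ^ Suc N) * indicator (-{0}) x)"
  let ?G = "\<lambda>s x. of_nat N * (ennreal (norm x ^ N) * f x) * (indicator {x. norm x < s} x * ennreal (1 / s ^ Suc N) * indicator (-{0}) x)"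
  have [measurable]: "B \<in> borel_measurable borel" "I \<in> borel_measurable borel"
    unfolding B_def I_def by (intro borel_measurable_indicator; auto)+
  have "(\<integral>\<^sup>+r. I r * ennreal (r ^ (N - 1)) * (\<integral>\<^sup>+\<sigma>. f (r *\<^sub>R \<sigma>) \<partial>usphere) \<partial>lborel)
    = (\<integral>\<^sup>+r. \<integral>\<^sup>+y. ?A r y \<partial>lborel \<partial>lborel)"
  proof (rule nn_integral_cong)
    fix r
    have "I r * ennreal (r ^ (N - 1)) * (\<integral>\<^sup>+\<sigma>. f (r *\<^sub>R \<sigma>) \<partial>usphere)
      = of_nat N * (I r * ennreal (r ^ (N - 1)) * (\<integral>\<^sup>+y. B y * f (r *\<^sub>R sgn y) \<partial>lborel))"
      by (subst nn_integral_usphere) (simp_all add: B_def N_def mult_ac)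
    also have "\<dots> = (\<integral>\<^sup>+y. ?A r y \<partial>lborel)"
      by (simp add: nn_integral_cmult)
    finally show "I r * ennreal (r ^ (N - 1)) * (\<integral>\<^sup>+\<sigma>. f (r *\<^sub>R \<sigma>) \<partial>usphere)
      = (\<integral>\<^sup>+y. ?A r y \<partial>lborel)" .
  qed
  also have "\<dots> = (\<integral>\<^sup>+y. \<integral>\<^sup>+r. ?A r y \<partial>lborel \<partial>lborel)"
    by (rule lborel_pair.Fubini') simp
  also have "\<dots> = (\<integral>\<^sup>+y. \<integral>\<^sup>+s. ?C s y \<partial>lborel \<partial>lborel)"
  proof (rule nn_integral_cong)
    fix y :: 'a
    show "(\<integral>\<^sup>+r. ?A r y \<partial>lborel)
        = (\<integral>\<^sup>+s. ?C s y \<partial>lborel)"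
    proof (cases "y = 0")
      case False
      have "(\<integral>\<^sup>+r. ?A r y \<partial>lborel)
        = ennreal \<bar>norm y\<bar> * (\<integral>\<^sup>+s. ?A (0 + norm y * s) y \<partial>lborel)"
        using False by (intro nn_integral_real_affine) auto
      also have "\<dots> = (\<integral>\<^sup>+s. ennreal (norm y) * ?A (norm y * s) y \<partial>lborel)"
        by (subst nn_integral_cmult) auto
      also have "\<dots> = (\<integral>\<^sup>+s. ?C s y \<partial>lborel)"
      proof (rule nn_integral_cong)
        fix s :: real
        show "ennreal (norm y) * ?A (norm y * s) y =
            ?C s y"
        proof (cases "s > 0")
          case True
          have "(norm y * s) *\<^sub>R sgn y = s *\<^sub>R y" using False by (simp add: sgn_div_norm)
          moreover have "ennreal (norm y) * ennreal ((norm y * s) ^ (N - 1)) = ennreal (norm y ^ N * s ^ (N - 1))"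
            using True by (simp add: rN power_mult_distrib mult.assoc flip: ennreal_mult)
          moreover have "I (norm y * s) = I s" using True False by (simp add: I_def)
          ultimately show ?thesis by (simp add: mult_ac) (metis mult.commute mult.left_commute)
        next
          case neg: False
          then have "I (norm y * s) = 0" "I s = 0"
            using False by (auto simp: I_def indicator_def zero_less_mult_iff)
          then show ?thesis by simp
        qed
      qed
      finally show ?thesis .
    qed (simp add: B_def)
  qed
  also have "\<dots> = (\<integral>\<^sup>+s. \<integral>\<^sup>+y. ?C s y \<partial>lborel \<partial>lborel)"
    by (rule lborel_pair.Fubini'[symmetric]) simp
  also have "\<dots> = (\<integral>\<^sup>+s. \<integral>\<^sup>+x. ?E s x \<partial>lborel \<partial>lborel)"
  proof (rule nn_integral_cong)
    fix s :: real
    show "(\<integral>\<^sup>+y. ?C s y \<partial>lborel)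
      = (\<integral>\<^sup>+x. ?E s x \<partial>lborel)"
      (is "?L = ?R")
    proof (cases "s > 0")
      case True
      have [measurable]: "{x :: 'a. norm x < s} \<in> sets borel" by measurable
      have "?R = (\<integral>\<^sup>+x. ?G s x \<partial>lborel)"
        by (simp add: indicator_def)
      also have "\<dots> = ennreal (s ^ N) * (\<integral>\<^sup>+y. ?G s (s *\<^sub>R y) \<partial>lborel)"
        unfolding N_def using True by (intro nn_integral_lborel_scale) auto
      also have "\<dots> = (\<integral>\<^sup>+y. ennreal (s ^ N) * ?G s (s *\<^sub>R y) \<partial>lborel)"
        by (subst nn_integral_cmult) auto
      also have "\<dots> = ?L"
      proof (rule nn_integral_cong)
        fix y :: 'a
        have 1: "indicator {x. norm x < s} (s *\<^sub>R y) * indicator (-{0}) (s *\<^sub>R y) = B y"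
          using True by (auto simp: B_def indicator_def)
        have 2: "ennreal (s ^ N) * (ennreal (norm (s *\<^sub>R y) ^ N) * ennreal (1 / s ^ Suc N)) = ennreal (norm y ^ N * s ^ (N - 1))"
          using True by (simp add: rN power_mult_distrib flip: ennreal_mult)
        have 3: "I s = 1" using True by (simp add: I_def)
        have "ennreal (s ^ N) * ?G s (s *\<^sub>R y)
          = of_nat N * ((ennreal (s ^ N) * (ennreal (norm (s *\<^sub>R y) ^ N) * ennreal (1 / s ^ Suc N))) * ((indicator {x. norm x < s} (s *\<^sub>R y) * indicator (-{0}) (s *\<^sub>R y)) * f (s *\<^sub>R y)))"
          by (simp only: mult_ac)
        also have "\<dots> = ?C s y"
          unfolding 1 2 3 by simp
        finally show "ennreal (s ^ N) * ?G s (s *\<^sub>R y)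
          = ?C s y" .
      qed
      finally show ?thesis by simp
    next
      case False
      then have "indicator {norm x<..} s = (0::ennreal)" for x :: 'a
        using norm_ge_zero[of x] by (auto simp: indicator_def simp del: norm_ge_zero)
      moreover have "I s = 0" using False by (simp add: I_def)
      ultimately show ?thesis by simp
    qed
  qed
  also have "\<dots> = (\<integral>\<^sup>+x. \<integral>\<^sup>+s. ?E s x \<partial>lborel \<partial>lborel)"
    by (rule lborel_pair.Fubini') (simp add: indicator_def)
  also have "\<dots> = (\<integral>\<^sup>+x. f x \<partial>lborel)"
  proof (rule nn_integral_cong_AE, use AE_lborel_singleton[of 0] in eventually_elim)
    fix x :: 'a assume x: "x \<noteq> 0"
    have "(\<integral>\<^sup>+s. ?E s x \<partial>lborel)
      = of_nat N * (ennreal (norm x ^ N) * f x) * ennreal (1 / (real N * norm x ^ N))"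
      using x N nn_integral_power_tail[of "norm x" N] by (simp add: nn_integral_cmult)
    also have "\<dots> = f x * (ennreal (real N) * (ennreal (norm x ^ N) * ennreal (1 / (real N * norm x ^ N))))"
      by (simp add: mult_ac ennreal_of_nat_eq_real_of_nat)
    also have "ennreal (real N) * (ennreal (norm x ^ N) * ennreal (1 / (real N * norm x ^ N))) = 1"
      using x N by (simp flip: ennreal_mult)
    finally show "(\<integral>\<^sup>+s. ?E s x \<partial>lborel) = f x"
      by simp
  qed
  finally show ?thesis unfolding I_def N_def by simp
qed

text \<open>The substitution \<open>t = cot \<theta>\<close>, with \<open>|dt| = d\<theta> / sin\<^sup>2 \<theta>\<close>, as an identity of measures on the
  whole line.\<close>

lemma lborel_eq_distr_cot:
  "lborel = distr (density lborel (\<lambda>\<theta>. indicator {0<..<pi} \<theta> * ennreal (1 / (sin \<theta>)\<^sup>2))) borel cot"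
proof (rule lborel_eqI)
  let ?M = "distr (density lborel (\<lambda>\<theta>. indicator {0<..<pi} \<theta> * ennreal (1 / (sin \<theta>)\<^sup>2))) borel cot"
  have cot_m [measurable]: "(cot :: real \<Rightarrow> real) \<in> borel_measurable borel"
    unfolding cot_def[abs_def] by measurable
  fix l u :: real assume lu: "\<And>b. b \<in> Basis \<Longrightarrow> l \<bullet> b \<le> u \<bullet> b"
  then have lu: "l \<le> u" by simp
  define a where "a x = pi / 2 - arctan x" for x
  have a: "0 < a x" "a x < pi" "cot (a x) = x" for x
    using arctan_lbound[of x] arctan_ubound[of x] tan_cot'[of "a x"] by (auto simp: a_def tan_arctan)
  have eq: "l < cot \<theta> \<and> cot \<theta> < u \<longleftrightarrow> a u < \<theta> \<and> \<theta> < a l" if "0 < \<theta>" "\<theta> < pi" for \<theta>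
  proof -
    have "arctan (cot \<theta>) = pi / 2 - \<theta>"
      using that tan_cot'[of \<theta>] by (intro arctan_unique) auto
    then show ?thesis
      using arctan_less_iff[of l "cot \<theta>"] arctan_less_iff[of "cot \<theta>" u] by (auto simp: a_def)
  qed
  have [measurable]: "cot -` {l<..<u} \<in> sets borel"
    using measurable_sets[OF cot_m, of "{l<..<u}"] by simp
  have "emeasure (?M) (box l u)
    = (\<integral>\<^sup>+\<theta>. indicator {0<..<pi} \<theta> * ennreal (1 / (sin \<theta>)\<^sup>2) * indicator (cot -` {l<..<u}) \<theta> \<partial>lborel)"
    by (simp add: emeasure_distr emeasure_density box_real)
  also have "\<dots> = (\<integral>\<^sup>+\<theta>. ennreal (1 / (sin \<theta>)\<^sup>2) * indicator {a u..a l} \<theta> \<partial>lborel)"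
  proof (rule nn_integral_cong_AE)
    show "AE \<theta> in lborel. indicator {0<..<pi} \<theta> * ennreal (1 / (sin \<theta>)\<^sup>2) * indicator (cot -` {l<..<u}) \<theta>
       = ennreal (1 / (sin \<theta>)\<^sup>2) * indicator {a u..a l} \<theta>"
      using AE_lborel_singleton[of "a u"] AE_lborel_singleton[of "a l"]
    proof eventually_elim
      case (elim \<theta>)
      show ?case
      proof (cases "0 < \<theta> \<and> \<theta> < pi")
        case True
        then show ?thesis using eq[of \<theta>] elim by (auto simp: indicator_def)
      next
        case False
        then have "\<theta> \<notin> {a u..a l}" using a(1)[of u] a(2)[of l] by auto
        then show ?thesis using False by (auto simp: indicator_def)
      qed
    qed
  qed
  also have "\<dots> = ennreal ((- cot (a l)) - (- cot (a u)))"
  proof (rule nn_integral_FTC_Icc)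
    show "a u \<le> a l" using lu by (simp add: a_def arctan_le_iff)
    fix x assume "x \<in> {a u..a l}"
    then have "0 < x" "x < pi" using a(1)[of u] a(2)[of l] by auto
    then have "sin x > 0" by (rule sin_gt_zero)
    then show "((\<lambda>x. - cot x) has_real_derivative 1 / (sin x)\<^sup>2) (at x)"
      using DERIV_minus[OF DERIV_cot[of x]] by (simp add: inverse_eq_divide)
    show "0 \<le> 1 / (sin x)\<^sup>2" by simp
  qed simp
  finally show "emeasure (?M) (box l u)
    = (\<Prod>b\<in>Basis. (u - l) \<bullet> b)"
    by (simp add: a)
qed simp

text \<open>The volume of balls is the distribution function of the Euclidean norm. The coordinates range
  over an arbitrary finite set so that one coordinate of a Euclidean space can be split off.\<close>

lemma nn_integral_radial_PiM:
  fixes G :: "real \<Rightarrow> ennreal" and J :: "'i set"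
  assumes J: "finite J" "J \<noteq> {}" and [measurable]: "G \<in> borel_measurable borel"
  shows "(\<integral>\<^sup>+x. G (sqrt (\<Sum>i\<in>J. (x i)\<^sup>2)) \<partial>PiM J (\<lambda>_. lborel))
    = (\<integral>\<^sup>+r. indicator {0<..} r * ennreal (card J * unit_ball_vol (card J) * r ^ (card J - 1)) * G r \<partial>lborel)"
proof -
  define n where "n = card J"
  have n: "n > 0" using J by (simp add: n_def card_gt_0_iff)
  define \<omega> where "\<omega> = unit_ball_vol (real n)"
  have \<omega>: "\<omega> \<ge> 0" by (simp add: \<omega>_def)
  let ?R = "\<lambda>x :: 'i \<Rightarrow> real. sqrt (\<Sum>i\<in>J. (x i)\<^sup>2)"
  let ?M = "PiM J (\<lambda>_. lborel :: real measure)"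
  let ?D = "distr ?M borel ?R"
  have R [measurable]: "?R \<in> borel_measurable ?M" by measurable
  define w where "w r = indicator {0<..} r * ennreal (n * \<omega> * r ^ (n - 1))" for r :: real
  have [measurable]: "w \<in> borel_measurable borel" unfolding w_def by measurable
  have pos: "emeasure ?D {..r} = ennreal (\<omega> * r ^ n)" if "r > 0" for r
  proof -
    have "emeasure ?D {..r} = emeasure ?M ({x. ?R x \<le> r} \<inter> space ?M)"
      by (subst emeasure_distr) (auto intro!: arg_cong[where f="emeasure ?M"])
    then show ?thesis
      using emeasure_cball_aux[OF J(1) that] by (simp add: n_def \<omega>_def)
  qed
  have zero: "emeasure ?D {..0} = 0"
  proof -
    have "emeasure ?D {..0} \<le> ennreal (\<omega> * (1 / real (Suc k)) ^ n)" for k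
      by (subst pos[symmetric]) (auto intro!: emeasure_mono)
    moreover have "(\<lambda>k. ennreal (\<omega> * (1 / real (Suc k)) ^ n)) \<longlonglongrightarrow> ennreal (\<omega> * 0 ^ n)"
      by (intro tendsto_ennrealI tendsto_intros LIMSEQ_inverse_real_of_nat[unfolded inverse_eq_divide])
    ultimately have "emeasure ?D {..0} \<le> ennreal (\<omega> * 0 ^ n)"
      by (intro LIMSEQ_le_const[of _ _ "emeasure ?D {..0}"]) auto
    then show ?thesis using n by (simp add: zero_power)
  qed
  have dens: "emeasure (density lborel w) {..r} = (if r > 0 then ennreal (\<omega> * r ^ n) else 0)" for r
  proof (cases "r > 0")
    case True
    have "emeasure (density lborel w) {..r} = (\<integral>\<^sup>+x. ennreal (n * \<omega> * x ^ (n - 1)) * indicator {0..r} x \<partial>lborel)"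
      unfolding w_def
      by (subst emeasure_density, simp, simp, rule nn_integral_cong_AE, use AE_lborel_singleton[of 0] in eventually_elim)
         (auto simp: indicator_def)
    also have "\<dots> = ennreal (\<omega> * r ^ n - \<omega> * 0 ^ n)"
      using True n \<omega> by (intro nn_integral_FTC_Icc) (auto intro!: derivative_eq_intros)
    finally show ?thesis using True n by (simp add: zero_power)
  next
    case False
    then have "emeasure (density lborel w) {..r} = (\<integral>\<^sup>+x. 0 \<partial>(lborel :: real measure))"
      by (subst emeasure_density, simp, simp, intro nn_integral_cong) (auto simp: w_def indicator_def)
    then show ?thesis using False by simp
  qed
  have eq: "distr ?M borel ?R = density lborel w"
  proof (rule measure_eqI_generator_eq[where E="range (\<lambda>a. {..a::real})" and \<Omega>=UNIV and A="\<lambda>i. {..real i}"])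
    show "Int_stable (range (\<lambda>a. {..a::real}))" by (auto simp: Int_stable_def)
    show "sets ?D = sigma_sets UNIV (range (\<lambda>a. {..a::real}))"
      "sets (density lborel w) = sigma_sets UNIV (range (\<lambda>a. {..a::real}))"
      by (simp_all add: borel_eq_atMost)
    show "(\<Union>i. {..real i}) = UNIV" using real_arch_simple by auto
    fix X assume "X \<in> range (\<lambda>a. {..a::real})"
    then obtain r where r: "X = {..r}" by auto
    show "emeasure ?D X = emeasure (density lborel w) X"
    proof (cases "r > 0")
      case False
      then have "emeasure ?D {..r} \<le> emeasure ?D {..0}"
        by (intro emeasure_mono) auto
      then show ?thesis using False r dens zero by simp
    qed (use r dens pos in simp)
  next
    fix i :: nat
    show "emeasure ?D {..real i} \<noteq> \<infinity>"
      using pos[of "real i"] zero by (cases i) auto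
  qed auto
  have "(\<integral>\<^sup>+x. G (?R x) \<partial>?M) = (\<integral>\<^sup>+r. G r \<partial>distr ?M borel ?R)"
    by (subst nn_integral_distr) auto
  also have "\<dots> = (\<integral>\<^sup>+r. w r * G r \<partial>lborel)"
    unfolding eq by (subst nn_integral_density) auto
  finally show ?thesis by (simp add: w_def n_def \<omega>_def)
qed

text \<open>Write \<open>y = t e + x\<close> with \<open>x\<close> orthogonal to \<open>e\<close> and \<open>|x| = r\<close>; then \<open>e \<bullet> y/|y| = t / sqrt (t\<^sup>2 + r\<^sup>2)\<close>.
  After \<open>t = r s\<close> this depends on \<open>s\<close> alone, the integral over \<open>r\<close> is elementary, and \<open>s = cot \<theta>\<close>
  produces \<open>cos \<theta>\<close> and the power of \<open>sin \<theta>\<close>.\<close>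

lemma nn_integral_zonal_basis:
  fixes e :: "'a::euclidean_space" and h :: "real \<Rightarrow> ennreal"
  assumes N: "DIM('a) \<ge> 2" and e: "e \<in> Basis" and h [measurable]: "h \<in> borel_measurable borel"
  shows "(\<integral>\<^sup>+\<sigma>. h (e \<bullet> \<sigma>) \<partial>usphere) = ennreal (sphere_area (DIM('a) - 2)) *
    (\<integral>\<^sup>+\<theta>. indicator {0..pi} \<theta> * (h (cos \<theta>) * ennreal (sin \<theta> ^ (DIM('a) - 2))) \<partial>lborel)"
proof -
  define J where "J = Basis - {e}"
  define n where "n = DIM('a) - 1"
  have J: "finite J" "e \<notin> J" "insert e J = Basis" "card J = n"
    using e by (auto simp: J_def n_def card_Diff_singleton)
  have J': "J \<noteq> {}"
    using J(4) N by (auto simp: n_def)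
  have Nn: "DIM('a) = Suc n" "n > 0" "DIM('a) - 2 = n - 1" using N by (auto simp: n_def)
  define c where "c = sphere_area (DIM('a) - 2)"
  have c: "c = real n * unit_ball_vol (real n)" "c \<ge> 0" using Nn by (auto simp: c_def sphere_area_def)
  let ?g = "\<lambda>r t :: real. indicator {0<..<1} (t\<^sup>2 + r\<^sup>2) * h (t / sqrt (t\<^sup>2 + r\<^sup>2))"
  define G where "G r = (\<integral>\<^sup>+t. ?g r t \<partial>lborel)" for r :: real
  have [measurable]: "G \<in> borel_measurable borel" unfolding G_def by measurable
  define q where "q s = 1 / sqrt (1 + s\<^sup>2)" for s :: real
  let ?S = "\<lambda>r s. indicator {0<..<q s} r * ennreal (c * r ^ n) * h (s * q s)"
  let ?z = "\<lambda>\<theta>. indicator {0..pi} \<theta> * (h (cos \<theta>) * ennreal (sin \<theta> ^ (DIM('a) - 2)))"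
  let ?l = "\<lambda>\<theta>. indicator {0<..<pi} \<theta> * ennreal (1 / (sin \<theta>)\<^sup>2) *
      (ennreal (c / DIM('a) * q (cot \<theta>) ^ DIM('a)) * h (cot \<theta> * q (cot \<theta>)))"
  have q: "q s > 0" for s by (auto simp: q_def add_pos_nonneg)
  have [measurable]: "q \<in> borel_measurable borel" unfolding q_def by measurable
  interpret product_sigma_finite "\<lambda>_::'a. lborel :: real measure" by standard
  let ?k = "\<lambda>y::'a. indicator (ball 0 1 - {0}) y * h (e \<bullet> sgn y)"
  have [measurable]: "?k \<in> borel_measurable borel"
    by (intro borel_measurable_times_ennreal borel_measurable_indicator) auto
  have "(\<integral>\<^sup>+y. ?k y \<partial>lborel) = (\<integral>\<^sup>+f. ?k (\<Sum>b\<in>Basis. f b *\<^sub>R b) \<partial>PiM Basis (\<lambda>_. lborel))"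
    by (subst lborel_eq, subst nn_integral_distr) simp_all
  also have "\<dots> = (\<integral>\<^sup>+f. ?k (\<Sum>b\<in>Basis. f b *\<^sub>R b) \<partial>PiM (insert e J) (\<lambda>_. lborel))"
    by (simp add: J)
  also have "\<dots> = (\<integral>\<^sup>+x. \<integral>\<^sup>+t. ?k (\<Sum>b\<in>Basis. (x(e := t)) b *\<^sub>R b) \<partial>lborel \<partial>PiM J (\<lambda>_. lborel))"
  proof (rule product_nn_integral_insert[OF J(1,2)])
    have "(\<lambda>f. ?k (\<Sum>b\<in>Basis. f b *\<^sub>R b)) \<in> borel_measurable (PiM Basis (\<lambda>_. lborel))" by measurable
    then show "(\<lambda>f. ?k (\<Sum>b\<in>Basis. f b *\<^sub>R b)) \<in> borel_measurable (PiM (insert e J) (\<lambda>_. lborel))"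
      by (simp add: J)
  qed
  also have "\<dots> = (\<integral>\<^sup>+x. G (sqrt (\<Sum>b\<in>J. (x b)\<^sup>2)) \<partial>PiM J (\<lambda>_. lborel))"
  proof (rule nn_integral_cong)
    fix x :: "'a \<Rightarrow> real"
    define \<rho> where "\<rho> = sqrt (\<Sum>b\<in>J. (x b)\<^sup>2)"
    have \<rho>: "\<rho>\<^sup>2 = (\<Sum>b\<in>J. (x b)\<^sup>2)" by (simp add: \<rho>_def sum_nonneg)
    show "(\<integral>\<^sup>+t. ?k (\<Sum>b\<in>Basis. (x(e := t)) b *\<^sub>R b) \<partial>lborel) = G (sqrt (\<Sum>b\<in>J. (x b)\<^sup>2))"
      unfolding G_def \<rho>_def[symmetric]
    proof (rule nn_integral_cong)
      fix t :: real
      define y :: 'a where "y = (\<Sum>b\<in>Basis. (x(e := t)) b *\<^sub>R b)"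
      have yb: "y \<bullet> b = (x(e := t)) b" if "b \<in> Basis" for b
        unfolding y_def using that by (rule inner_sum_left_Basis)
      have "(norm y)\<^sup>2 = (\<Sum>b\<in>Basis. (y \<bullet> b)\<^sup>2)"
        unfolding power2_norm_eq_inner by (subst euclidean_inner) (simp add: power2_eq_square)
      also have "\<dots> = (\<Sum>b\<in>insert e J. ((x(e := t)) b)\<^sup>2)" by (simp add: J yb)
      also have "\<dots> = t\<^sup>2 + \<rho>\<^sup>2"
      proof -
        have "(\<Sum>b\<in>J. ((x(e := t)) b)\<^sup>2) = (\<Sum>b\<in>J. (x b)\<^sup>2)"
          using J(2) by (intro sum.cong) auto
        then show ?thesis using J(1,2) by (simp add: \<rho> del: fun_upd_apply) (simp add: \<rho>)
      qed
      finally have n2: "(norm y)\<^sup>2 = t\<^sup>2 + \<rho>\<^sup>2" .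
      then have n1: "norm y = sqrt (t\<^sup>2 + \<rho>\<^sup>2)" by (metis norm_ge_zero real_sqrt_unique)
      have "e \<bullet> sgn y = t / sqrt (t\<^sup>2 + \<rho>\<^sup>2)"
        using yb[OF e] by (simp add: sgn_div_norm n1 inner_commute divide_inverse mult.commute)
      moreover have "indicator (ball 0 1 - {0}) y = (indicator {0<..<1} (t\<^sup>2 + \<rho>\<^sup>2) :: ennreal)"
      proof -
        have "y \<noteq> 0 \<longleftrightarrow> 0 < (norm y)\<^sup>2" by simp
        moreover have "norm y < 1 \<longleftrightarrow> (norm y)\<^sup>2 < 1" by (simp add: power_less_one_iff)
        ultimately show ?thesis unfolding n2 by (auto simp: indicator_def)
      qed
      ultimately show "?k (\<Sum>b\<in>Basis. (x(e := t)) b *\<^sub>R b)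
          = ?g \<rho> t"
        unfolding y_def[symmetric] by simp
    qed
  qed
  also have "\<dots> = (\<integral>\<^sup>+r. indicator {0<..} r * ennreal (c * r ^ (n - 1)) * G r \<partial>lborel)"
    by (subst nn_integral_radial_PiM) (simp_all add: J J' c)
  also have "\<dots> = (\<integral>\<^sup>+r. \<integral>\<^sup>+s. ?S r s \<partial>lborel \<partial>lborel)"
  proof (rule nn_integral_cong)
    fix r :: real
    show "indicator {0<..} r * ennreal (c * r ^ (n - 1)) * G r
        = (\<integral>\<^sup>+s. ?S r s \<partial>lborel)"
    proof (cases "r > 0")
      case True
      have "G r = ennreal \<bar>r\<bar> * (\<integral>\<^sup>+s. ?g r (0 + r * s) \<partial>lborel)"
        unfolding G_def using True by (intro nn_integral_real_affine) auto
      also have "(\<integral>\<^sup>+s. ?g r (0 + r * s) \<partial>lborel)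
          = (\<integral>\<^sup>+s. indicator {0<..<q s} r * h (s * q s) \<partial>lborel)"
      proof (rule nn_integral_cong)
        fix s :: real
        have *: "(0 + r * s)\<^sup>2 + r\<^sup>2 = r\<^sup>2 * (1 + s\<^sup>2)" by (simp add: power2_eq_square algebra_simps)
        have p: "1 + s\<^sup>2 > 0" by (simp add: add_pos_nonneg)
        have "(0 + r * s) / sqrt (r\<^sup>2 * (1 + s\<^sup>2)) = s * q s"
          using True by (simp add: real_sqrt_mult q_def)
        moreover have "r\<^sup>2 * (1 + s\<^sup>2) < 1 \<longleftrightarrow> r < q s"
        proof -
          have "r\<^sup>2 * (1 + s\<^sup>2) < 1 \<longleftrightarrow> sqrt (r\<^sup>2 * (1 + s\<^sup>2)) < sqrt 1" by (simp only: real_sqrt_less_iff)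
          also have "sqrt (r\<^sup>2 * (1 + s\<^sup>2)) = r * sqrt (1 + s\<^sup>2)"
            using True by (simp only: real_sqrt_mult real_sqrt_abs abs_of_pos)
          also have "r * sqrt (1 + s\<^sup>2) < sqrt 1 \<longleftrightarrow> r < q s"
            using p by (simp add: q_def pos_less_divide_eq)
          finally show ?thesis .
        qed
        moreover have "0 < r\<^sup>2 * (1 + s\<^sup>2)" using True p by simp
        ultimately show "?g r (0 + r * s)
          = indicator {0<..<q s} r * h (s * q s)"
          unfolding * using True by (simp add: indicator_def)
      qed
      finally have G: "G r = ennreal r * (\<integral>\<^sup>+s. indicator {0<..<q s} r * h (s * q s) \<partial>lborel)"
        using True by simp
      have m [measurable]: "(\<lambda>s. indicator {0<..<q s} r :: ennreal) \<in> borel_measurable borel"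
        by (simp add: indicator_def)
      have rn: "ennreal (c * r ^ (n - 1)) * ennreal r = ennreal (c * r ^ n)"
        using True c Nn by (cases n) (simp_all add: mult_ac flip: ennreal_mult)
      have "indicator {0<..} r * ennreal (c * r ^ (n - 1)) * G r
          = ennreal (c * r ^ n) * (\<integral>\<^sup>+s. indicator {0<..<q s} r * h (s * q s) \<partial>lborel)"
        using True unfolding G by (simp add: mult.assoc[symmetric] rn del: One_nat_def)
      also have "\<dots> = (\<integral>\<^sup>+s. ?S r s \<partial>lborel)"
        by (subst nn_integral_cmult[symmetric]) (simp_all add: mult_ac)
      finally show ?thesis .
    qed simp
  qed
  also have "\<dots> = (\<integral>\<^sup>+s. \<integral>\<^sup>+r. ?S r s \<partial>lborel \<partial>lborel)"
    by (rule lborel_pair.Fubini') (simp add: indicator_def)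
  also have "\<dots> = (\<integral>\<^sup>+s. ennreal (c / DIM('a) * q s ^ DIM('a)) * h (s * q s) \<partial>lborel)"
  proof (rule nn_integral_cong)
    fix s :: real
    have "(\<integral>\<^sup>+r. ?S r s \<partial>lborel)
      = (\<integral>\<^sup>+r. indicator {0<..<q s} r * ennreal (c * r ^ n) \<partial>lborel) * h (s * q s)"
      by (subst nn_integral_multc) auto
    also have "(\<integral>\<^sup>+r. indicator {0<..<q s} r * ennreal (c * r ^ n) \<partial>lborel)
      = (\<integral>\<^sup>+r. ennreal (c * r ^ n) * indicator {0..q s} r \<partial>lborel)"
      by (rule nn_integral_cong_AE, use AE_lborel_singleton[of 0] AE_lborel_singleton[of "q s"] in eventually_elim)
         (auto simp: indicator_def)
    also have "\<dots> = ennreal (c / DIM('a) * q s ^ DIM('a) - c / DIM('a) * 0 ^ DIM('a))"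
    proof (rule nn_integral_FTC_Icc)
      fix r assume r: "r \<in> {0..q s}"
      have "((\<lambda>r. c / DIM('a) * r ^ DIM('a)) has_real_derivative
          c / DIM('a) * (DIM('a) * r ^ (DIM('a) - Suc 0))) (at r)"
        by (auto intro!: derivative_eq_intros)
      moreover have "c / DIM('a) * (DIM('a) * r ^ (DIM('a) - Suc 0)) = c * r ^ n"
        using Nn(1) by simp
      ultimately show "((\<lambda>r. c / DIM('a) * r ^ DIM('a)) has_real_derivative c * r ^ n) (at r)"
        by (simp only:)
      show "0 \<le> c * r ^ n" using r c(2) by simp
    qed (use q[of s] in simp_all)
    finally show "(\<integral>\<^sup>+r. ?S r s \<partial>lborel)
      = ennreal (c / DIM('a) * q s ^ DIM('a)) * h (s * q s)"
      using Nn by (simp add: zero_power del: of_nat_Suc)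
  qed
  also have "\<dots> = (\<integral>\<^sup>+\<theta>. ?l \<theta> \<partial>lborel)"
  proof -
    have cot_m [measurable]: "(cot :: real \<Rightarrow> real) \<in> borel_measurable borel"
      unfolding cot_def[abs_def] by measurable
    show ?thesis
      by (subst lborel_eq_distr_cot, subst nn_integral_distr, simp, simp, subst nn_integral_density) auto
  qed
  also have "\<dots> = (\<integral>\<^sup>+\<theta>. ennreal (c / DIM('a)) * (?z \<theta>) \<partial>lborel)"
  proof (rule nn_integral_cong_AE, use AE_lborel_singleton[of 0] AE_lborel_singleton[of pi] in eventually_elim)
    fix \<theta> :: real assume \<theta>: "\<theta> \<noteq> 0" "\<theta> \<noteq> pi"
    show "?l \<theta>
      = ennreal (c / DIM('a)) * (?z \<theta>)"
    proof (cases "0 < \<theta> \<and> \<theta> < pi")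
      case True
      then have s: "sin \<theta> > 0" by (intro sin_gt_zero) auto
      have "1 + (cot \<theta>)\<^sup>2 = 1 / (sin \<theta>)\<^sup>2"
        using s sin_cos_squared_add[of \<theta>] by (simp add: cot_def field_simps)
      then have qs: "q (cot \<theta>) = sin \<theta>" using s by (simp add: q_def real_sqrt_divide)
      have "ennreal (1 / (sin \<theta>)\<^sup>2) * ennreal (c / DIM('a) * sin \<theta> ^ DIM('a)) = ennreal (c / DIM('a)) * ennreal (sin \<theta> ^ (DIM('a) - 2))"
      proof -
        have "sin \<theta> ^ DIM('a) = (sin \<theta>)\<^sup>2 * sin \<theta> ^ (DIM('a) - 2)"
          by (metis N le_add_diff_inverse power_add)
        then show ?thesis using s c(2) by (simp flip: ennreal_mult)
      qed
      then have "ennreal (1 / (sin \<theta>)\<^sup>2) * (ennreal (c / DIM('a) * sin \<theta> ^ DIM('a)) * h (cos \<theta>))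
          = ennreal (c / DIM('a)) * (h (cos \<theta>) * ennreal (sin \<theta> ^ (DIM('a) - 2)))"
        by (simp add: mult.assoc[symmetric]) (simp add: mult_ac)
      moreover have "cot \<theta> * sin \<theta> = cos \<theta>" using s by (simp add: cot_def)
      ultimately show ?thesis using True unfolding qs by simp
    next
      case False
      then show ?thesis using \<theta> by (auto simp: indicator_def)
    qed
  qed
  also have "\<dots> = ennreal (c / DIM('a)) * (\<integral>\<^sup>+\<theta>. ?z \<theta> \<partial>lborel)"
    by (subst nn_integral_cmult) auto
  finally have "(\<integral>\<^sup>+\<sigma>. h (e \<bullet> \<sigma>) \<partial>usphere) = of_nat DIM('a) * (ennreal (c / DIM('a)) *
     (\<integral>\<^sup>+\<theta>. ?z \<theta> \<partial>lborel))"
    by (subst nn_integral_usphere) simp_all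
  also have "\<dots> = ennreal c * (\<integral>\<^sup>+\<theta>. ?z \<theta> \<partial>lborel)"
    using c(2) by (simp add: mult.assoc[symmetric] ennreal_of_nat_eq_real_of_nat flip: ennreal_mult)
  finally show ?thesis unfolding c_def .
qed

text \<open>The reflection that exchanges \<open>e\<close> with a basis vector preserves the ball and Lebesgue measure.\<close>

lemma nn_integral_zonal:
  fixes e :: "'a::euclidean_space" and h :: "real \<Rightarrow> ennreal"
  assumes N: "DIM('a) \<ge> 2" and e: "norm e = 1" and h [measurable]: "h \<in> borel_measurable borel"
  shows "(\<integral>\<^sup>+\<sigma>. h (e \<bullet> \<sigma>) \<partial>usphere) = ennreal (sphere_area (DIM('a) - 2)) *
    (\<integral>\<^sup>+\<theta>. indicator {0..pi} \<theta> * (h (cos \<theta>) * ennreal (sin \<theta> ^ (DIM('a) - 2))) \<partial>lborel)"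
proof -
  obtain a :: 'a where a: "a \<in> Basis" using nonempty_Basis by blast
  define R where "R = reflect (e - a)"
  have Re: "R e = a" unfolding R_def using a e by (intro reflect_diff) simp
  have m: "(\<lambda>y. indicator (ball 0 1 - {0}) y * h (v \<bullet> sgn y)) \<in> borel_measurable borel" for v :: 'a
    by (intro borel_measurable_times_ennreal borel_measurable_indicator) auto
  have R0: "R y = 0 \<longleftrightarrow> y = 0" for y using reflect_norm[of "e - a" y] by (metis R_def norm_eq_zero)
  have "(\<integral>\<^sup>+y. indicator (ball 0 1 - {0}) y * h (a \<bullet> sgn y) \<partial>lborel)
     = (\<integral>\<^sup>+y. indicator (ball 0 1 - {0}) (R y) * h (a \<bullet> sgn (R y)) \<partial>lborel)"
    by (rule nn_integral_lborel_involution[symmetric, OF m])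
       (auto simp: R_def reflect_linear reflect_norm reflect_reflect)
  also have "\<dots> = (\<integral>\<^sup>+y. indicator (ball 0 1 - {0}) y * h (e \<bullet> sgn y) \<partial>lborel)"
  proof (rule nn_integral_cong)
    fix y
    have "a \<bullet> sgn (R y) = e \<bullet> sgn y"
      unfolding Re[symmetric] sgn_div_norm by (simp add: R_def reflect_inner reflect_norm)
    moreover have "indicator (ball 0 1 - {0}) (R y) = (indicator (ball 0 1 - {0}) y :: ennreal)"
      using R0[of y] by (auto simp: indicator_def R_def reflect_norm)
    ultimately show "indicator (ball 0 1 - {0}) (R y) * h (a \<bullet> sgn (R y))
        = indicator (ball 0 1 - {0}) y * h (e \<bullet> sgn y)" by simp
  qed
  finally have "(\<integral>\<^sup>+\<sigma>. h (e \<bullet> \<sigma>) \<partial>usphere) = (\<integral>\<^sup>+\<sigma>. h (a \<bullet> \<sigma>) \<partial>usphere)"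
    by (simp add: nn_integral_usphere)
  then show ?thesis using nn_integral_zonal_basis[OF N a h] by simp
qed

section \<open>Gaussian moments and the moments of conservative solutions\<close>

definition gauss :: "real \<Rightarrow> 'a \<Rightarrow> 'a::euclidean_space \<Rightarrow> real" where
  "gauss S u v = exp (- (norm (v - u))\<^sup>2 / (2 * S)) / (2 * pi * S) powr (real DIM('a) / 2)"

lemma gauss_nonneg [simp]: "0 \<le> gauss S u v"
  by (simp add: gauss_def)

lemma borel_measurable_gauss [measurable]: "gauss S u \<in> borel_measurable borel"
  unfolding gauss_def[abs_def] by measurable

lemma norm_power2_Basis: "(norm v)\<^sup>2 = (\<Sum>b\<in>Basis. (v \<bullet> b)\<^sup>2)"
  unfolding power2_norm_eq_inner by (subst euclidean_inner) (simp add: power2_eq_square)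

lemma gauss_eq_prod:
  fixes u v :: "'a::euclidean_space"
  assumes "S > 0"
  shows "gauss S u v = (\<Prod>b\<in>Basis. normal_density (u \<bullet> b) (sqrt S) (v \<bullet> b))"
proof -
  have "(\<Prod>b\<in>(Basis::'a set). normal_density (u \<bullet> b) (sqrt S) (v \<bullet> b))
     = (1 / sqrt (2 * pi * S)) ^ DIM('a) * exp (\<Sum>b\<in>Basis. - (v \<bullet> b - u \<bullet> b)\<^sup>2 / (2 * S))"
    using assms by (simp add: normal_density_def prod_dividef exp_sum power_divide)
  also have "(\<Sum>b\<in>Basis. - (v \<bullet> b - u \<bullet> b)\<^sup>2 / (2 * S)) = - (norm (v - u))\<^sup>2 / (2 * S)"
    by (simp add: norm_power2_Basis[of "v - u"] inner_diff_left sum_negf sum_divide_distrib)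
  also have "(1 / sqrt (2 * pi * S)) ^ DIM('a) = 1 / (2 * pi * S) powr (real DIM('a) / 2)"
    using assms by (simp add: power_divide powr_half_sqrt[symmetric] powr_realpow[symmetric] powr_powr)
  finally show ?thesis by (simp add: gauss_def)
qed

lemma nn_integral_normal_density:
  "s > 0 \<Longrightarrow> (\<integral>\<^sup>+x. ennreal (normal_density m s x) \<partial>lborel) = 1"
  by (subst nn_integral_eq_integral) auto

lemma nn_integral_normal_density_second:
  assumes "s > 0"
  shows "(\<integral>\<^sup>+x. ennreal ((x - m)\<^sup>2 * normal_density m s x) \<partial>lborel) = ennreal (s\<^sup>2)"
proof -
  have "(\<integral>x. normal_density m s x * (x - m) ^ (2 * 1) \<partial>lborel) = s\<^sup>2"
    using assms by (subst integral_normal_moment_even) auto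
  then show ?thesis
    using integrable_normal_moment[OF assms, of m 2] assms
    by (subst nn_integral_eq_integral) (auto simp: mult.commute)
qed

lemma nn_integral_gauss:
  fixes u :: "'a::euclidean_space"
  assumes "S > 0"
  shows "(\<integral>\<^sup>+v. ennreal (gauss S u v) \<partial>lborel) = 1"
proof -
  have "(\<integral>\<^sup>+v. ennreal (gauss S u v) \<partial>lborel)
      = (\<integral>\<^sup>+v. (\<Prod>b\<in>Basis. ennreal (normal_density (u \<bullet> b) (sqrt S) (v \<bullet> b))) \<partial>lborel)"
    by (simp add: gauss_eq_prod[OF assms] prod_ennreal)
  also have "\<dots> = (\<Prod>b\<in>(Basis::'a set). (\<integral>\<^sup>+x. ennreal (normal_density (u \<bullet> b) (sqrt S) x) \<partial>lborel))"
    by (rule nn_integral_lborel_prod) auto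
  finally show ?thesis using assms by (simp add: nn_integral_normal_density)
qed

lemma nn_integral_gauss_second:
  fixes u :: "'a::euclidean_space"
  assumes "S > 0"
  shows "(\<integral>\<^sup>+v. ennreal ((norm (v - u))\<^sup>2 * gauss S u v) \<partial>lborel) = ennreal (real DIM('a) * S)"
proof -
  define f where "f i b x = (if b = i then (x - u \<bullet> b)\<^sup>2 else 1) * normal_density (u \<bullet> b) (sqrt S) x" for i b :: 'a and x
  have f: "f i b x \<ge> 0" for i b x by (simp add: f_def)
  have [measurable]: "f i b \<in> borel_measurable borel" for i b unfolding f_def by measurable
  have "(norm (v - u))\<^sup>2 * gauss S u v = (\<Sum>i\<in>Basis. \<Prod>b\<in>Basis. f i b (v \<bullet> b))" for v
  proof -
    have "(\<Prod>b\<in>Basis. f i b (v \<bullet> b)) = ((v - u) \<bullet> i)\<^sup>2 * gauss S u v" if "i \<in> Basis" for i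
      using that by (simp add: f_def prod.distrib gauss_eq_prod[OF assms] prod.delta inner_diff_left)
    then show ?thesis by (simp add: norm_power2_Basis[of "v - u"] sum_distrib_right)
  qed
  then have "(\<integral>\<^sup>+v. ennreal ((norm (v - u))\<^sup>2 * gauss S u v) \<partial>lborel)
    = (\<integral>\<^sup>+v. (\<Sum>i\<in>Basis. \<Prod>b\<in>Basis. ennreal (f i b (v \<bullet> b))) \<partial>lborel)"
    by (simp add: prod_ennreal f prod_nonneg)
  also have "\<dots> = (\<Sum>i\<in>Basis. \<integral>\<^sup>+v. (\<Prod>b\<in>Basis. ennreal (f i b (v \<bullet> b))) \<partial>lborel)"
    by (rule nn_integral_sum) simp
  also have "\<dots> = (\<Sum>i\<in>(Basis::'a set). \<Prod>b\<in>(Basis::'a set). \<integral>\<^sup>+x. ennreal (f i b x) \<partial>lborel)"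
    by (intro sum.cong refl nn_integral_lborel_prod) auto
  also have "\<dots> = (\<Sum>i\<in>(Basis::'a set). ennreal S)"
  proof (rule sum.cong[OF refl])
    fix i :: 'a assume i: "i \<in> Basis"
    have "(\<integral>\<^sup>+x. ennreal (f i b x) \<partial>lborel) = (if b = i then ennreal S else 1)" for b
      using nn_integral_normal_density_second[of "sqrt S" "u \<bullet> b"]
        nn_integral_normal_density[of "sqrt S" "u \<bullet> b"] assms
      by (auto simp: f_def)
    then show "(\<Prod>b\<in>(Basis::'a set). \<integral>\<^sup>+x. ennreal (f i b x) \<partial>lborel) = ennreal S"
      using i by (simp add: prod.delta)
  qed
  also have "\<dots> = ennreal (real DIM('a) * S)"
    using assms by (simp add: ennreal_mult ennreal_of_nat_eq_real_of_nat)
  finally show ?thesis .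
qed

text \<open>Solution and Maxwellian satisfy this at all times with the same \<open>u\<close>, \<open>\<rho>\<close> and \<open>E = N \<rho> T\<close>.\<close>

locale velocity_measure = finite_measure \<mu> for \<mu> :: "('a::euclidean_space) measure" +
  fixes u :: 'a and \<rho> E :: real
  assumes sets_eq [simp, measurable_cong]: "sets \<mu> = sets borel"
    and mass: "measure \<mu> UNIV = \<rho>"
    and energy: "has_bochner_integral \<mu> (\<lambda>v. (norm (v - u))\<^sup>2) E"
begin

lemma space_eq [simp]: "space \<mu> = UNIV"
  using sets_eq_imp_space_eq[OF sets_eq] by simp

end

definition maxwell_measure :: "real \<Rightarrow> 'a \<Rightarrow> real \<Rightarrow> ('a::euclidean_space) measure" where
  "maxwell_measure \<rho> u T = density lborel (\<lambda>v. ennreal (\<rho> * gauss T u v))"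

lemma maxwellian_eq: "maxwellian \<rho> u T = of_measure (maxwell_measure \<rho> u T)"
  unfolding maxwellian_def maxwell_measure_def gauss_def by simp

lemma nn_integral_maxwell:
  assumes "\<rho> \<ge> 0" and [measurable]: "f \<in> borel_measurable borel"
  shows "(\<integral>\<^sup>+v. f v \<partial>maxwell_measure \<rho> u T) = ennreal \<rho> * (\<integral>\<^sup>+v. ennreal (gauss T u v) * f v \<partial>lborel)"
  unfolding maxwell_measure_def
  by (subst nn_integral_density, measurable)
     (simp add: ennreal_mult assms mult.assoc nn_integral_cmult)

lemma sets_maxwell_measure [simp, measurable_cong]: "sets (maxwell_measure \<rho> u T) = sets borel"
  by (simp add: maxwell_measure_def)

lemma maxwell_velocity_measure:
  fixes u :: "'a::euclidean_space"
  assumes "\<rho> > 0" "T > 0"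
  shows "velocity_measure (maxwell_measure \<rho> u T) u \<rho> (real DIM('a) * \<rho> * T)"
proof -
  have e: "emeasure (maxwell_measure \<rho> u T) UNIV = ennreal \<rho>"
    using nn_integral_maxwell[of \<rho> "\<lambda>_. 1" u T] assms
    by (simp add: nn_integral_gauss maxwell_measure_def)
  interpret finite_measure "maxwell_measure \<rho> u T"
    by (rule finite_measureI) (use e in \<open>simp add: maxwell_measure_def\<close>)
  show ?thesis
  proof
    show "measure (maxwell_measure \<rho> u T) UNIV = \<rho>"
      using e assms by (simp add: measure_def)
    have "(\<integral>\<^sup>+v. ennreal ((norm (v - u))\<^sup>2) \<partial>maxwell_measure \<rho> u T)
        = ennreal \<rho> * (\<integral>\<^sup>+v. ennreal ((norm (v - u))\<^sup>2 * gauss T u v) \<partial>lborel)"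
      using assms by (subst nn_integral_maxwell)
        (auto intro!: arg_cong2[where f="(*)"] nn_integral_cong simp: mult.commute simp flip: ennreal_mult)
    also have "\<dots> = ennreal (real DIM('a) * \<rho> * T)"
      unfolding nn_integral_gauss_second[OF assms(2)]
      using assms by (simp add: mult_ac flip: ennreal_mult)
    finally show "has_bochner_integral (maxwell_measure \<rho> u T) (\<lambda>v. (norm (v - u))\<^sup>2) (real DIM('a) * \<rho> * T)"
      using assms by (intro has_bochner_integral_nn_integral) auto
  qed simp
qed

text \<open>The factor 4 leaves a Gaussian of temperature \<open>2 T\<close>, whence the power of 2. This moment
  expresses the Gaussian tail that the logarithm in the final estimate comes from.\<close>

lemma maxwell_exponential_moment:
  fixes u :: "'a::euclidean_space"
  assumes "\<rho> > 0" "T > 0"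
  shows "has_bochner_integral (maxwell_measure \<rho> u T) (\<lambda>v. exp ((norm (v - u))\<^sup>2 / (4 * T)))
    (\<rho> * 2 powr (real DIM('a) / 2))"
proof -
  have g: "exp ((norm (v - u))\<^sup>2 / (4 * T)) * gauss T u v = 2 powr (real DIM('a) / 2) * gauss (2 * T) u v" for v
  proof -
    have "exp ((norm (v - u))\<^sup>2 / (4 * T)) * exp (- (norm (v - u))\<^sup>2 / (2 * T)) = exp (- (norm (v - u))\<^sup>2 / (2 * (2 * T)))"
      using assms by (simp add: field_simps flip: exp_add)
    moreover have "(2 * pi * (2 * T)) powr (real DIM('a) / 2) = 2 powr (real DIM('a) / 2) * (2 * pi * T) powr (real DIM('a) / 2)"
      using assms by (subst powr_mult[symmetric]) (auto simp: mult_ac)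
    ultimately show ?thesis by (simp add: gauss_def field_simps)
  qed
  have "(\<integral>\<^sup>+v. ennreal (exp ((norm (v - u))\<^sup>2 / (4 * T))) \<partial>maxwell_measure \<rho> u T)
      = ennreal \<rho> * (\<integral>\<^sup>+v. ennreal (2 powr (real DIM('a) / 2)) * ennreal (gauss (2 * T) u v) \<partial>lborel)"
    using assms by (subst nn_integral_maxwell)
      (auto intro!: arg_cong2[where f="(*)"] nn_integral_cong simp: g mult.commute[of "gauss T u _"] simp flip: ennreal_mult)
  also have "\<dots> = ennreal (\<rho> * 2 powr (real DIM('a) / 2))"
    using assms by (subst nn_integral_cmult) (auto simp: nn_integral_gauss ennreal_mult)
  finally show ?thesis
    using assms by (intro has_bochner_integral_nn_integral) auto
qed

lemma Bs_pos_2_moments: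
  fixes F :: "('a::euclidean_space) signed_measure"
  assumes "F \<in> Bs_pos 2"
  shows "of_measure (pos_variation F) = F"
    and "sint F f = integral\<^sup>L (pos_variation F) f"
    and "integrable (pos_variation F) (\<lambda>v. (norm v)\<^sup>2)"
    and "integrable (pos_variation F) (\<lambda>v. v)"
proof -
  interpret finite_measure "pos_variation F" by (rule finite_measure_pos_variation)
  have F: "\<And>A. A \<in> sets borel \<Longrightarrow> 0 \<le> smeas F A" and F2: "F \<in> Bs 2"
    using assms by (auto simp: Bs_pos_def)
  note n = pos_variation_nonneg(2)[OF F]
  show o: "of_measure (pos_variation F) = F" by (rule pos_variation_nonneg(3)[OF F])
  show "sint F f = integral\<^sup>L (pos_variation F) f" by (simp add: sint_def n)
  have tv: "total_variation F = pos_variation F"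
    by (rule measure_eqI) (auto simp: emeasure_total_variation n)
  have "bracket v powr 2 = 1 + (norm v)\<^sup>2" for v :: 'a
    by (simp add: bracket_def powr_numeral add_nonneg_nonneg add_pos_nonneg)
  then have "integrable (pos_variation F) (\<lambda>v. 1 + (norm v)\<^sup>2)"
    using F2 by (simp add: Bs_def tv)
  then have i: "integrable (pos_variation F) (\<lambda>v. 1 + (norm v)\<^sup>2)" .
  show "integrable (pos_variation F) (\<lambda>v. (norm v)\<^sup>2)"
    by (rule Bochner_Integration.integrable_bound[OF i]) auto
  show "integrable (pos_variation F) (\<lambda>v. v)"
  proof (rule Bochner_Integration.integrable_bound[OF i])
    have le: "norm v \<le> 1 + (norm v)\<^sup>2" for v :: 'a
    proof -
      have "0 \<le> (norm v - 1 / 2)\<^sup>2" by simp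
      also have "\<dots> = (norm v)\<^sup>2 - norm v + 1 / 4" by (simp add: power2_diff field_simps)
      finally show ?thesis by linarith
    qed
    show "AE v in pos_variation F. norm v \<le> norm (1 + (norm v)\<^sup>2)"
      unfolding real_norm_def by (rule AE_I2) (rule order_trans[OF le abs_ge_self])
  qed simp
qed

lemma integral_shifted_energy:
  fixes u :: "'a::euclidean_space"
  assumes F: "F \<in> Bs_pos 2"
  shows "has_bochner_integral (pos_variation F) (\<lambda>v. (norm (v - u))\<^sup>2)
    (sint F (\<lambda>v. (norm v)\<^sup>2) - 2 * (sint F (\<lambda>v. v) \<bullet> u) + (norm u)\<^sup>2 * sint F (\<lambda>v. 1::real))"
proof -
  interpret finite_measure "pos_variation F" by (rule finite_measure_pos_variation)
  note m = Bs_pos_2_moments[OF F]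
  have "has_bochner_integral (pos_variation F) (\<lambda>v. (norm v)\<^sup>2 - 2 * (v \<bullet> u) + (norm u)\<^sup>2 * 1)
    (sint F (\<lambda>v. (norm v)\<^sup>2) - 2 * (sint F (\<lambda>v. v) \<bullet> u) + (norm u)\<^sup>2 * sint F (\<lambda>v. 1::real))"
    unfolding m(2)
    by (intro has_bochner_integral_add has_bochner_integral_diff has_bochner_integral_mult_right
        has_bochner_integral_inner_left has_bochner_integral_integrable m(3,4)) simp
  moreover have "(norm v)\<^sup>2 - 2 * (v \<bullet> u) + (norm u)\<^sup>2 * 1 = (norm (v - u))\<^sup>2" for v
    by (simp add: power2_norm_eq_inner inner_simps inner_commute)
  ultimately show ?thesis by simp
qed

text \<open>Centring the energy at \<open>u\<close> mixes it with momentum and mass, and all three are conserved.\<close>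

lemma conservative_velocity_measure:
  fixes F :: "real \<Rightarrow> ('a::euclidean_space) signed_measure"
  assumes F: "\<And>t. t \<ge> 0 \<Longrightarrow> F t \<in> Bs_pos 2" and cons: "conservative F"
    and F0: "F 0 \<in> B_moments \<rho> u T" and \<rho>: "\<rho> > 0" and t: "t \<ge> 0"
  shows "velocity_measure (pos_variation (F t)) u \<rho> (real DIM('a) * \<rho> * T)"
proof -
  interpret finite_measure "pos_variation (F t)" by (rule finite_measure_pos_variation)
  have c: "sint (F t) (\<lambda>v. 1::real) = sint (F 0) (\<lambda>v. 1::real)"
     "sint (F t) (\<lambda>v. v) = sint (F 0) (\<lambda>v. v)"
     "sint (F t) (\<lambda>v. (norm v)\<^sup>2) = sint (F 0) (\<lambda>v. (norm v)\<^sup>2)"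
    using cons t unfolding conservative_def by blast+
  have "(1 / (real DIM('a) * \<rho>)) * sint (F 0) (\<lambda>v. (norm (v - u))\<^sup>2) = T"
    and m0: "sint (F 0) (\<lambda>v. 1::real) = \<rho>"
    using F0 by (auto simp: B_moments_def)
  then have T: "sint (F 0) (\<lambda>v. (norm (v - u))\<^sup>2) = real DIM('a) * \<rho> * T"
    using \<rho> by (auto simp: field_simps)
  show ?thesis
  proof
    show "measure (pos_variation (F t)) UNIV = \<rho>"
      using c(1) m0 unfolding Bs_pos_2_moments(2)[OF F[OF t]] by simp
    have "integral\<^sup>L (pos_variation (F 0)) (\<lambda>v. (norm (v - u))\<^sup>2) = real DIM('a) * \<rho> * T"
      using T unfolding Bs_pos_2_moments(2)[OF F[of 0, OF order_refl]] .
    then show "has_bochner_integral (pos_variation (F t)) (\<lambda>v. (norm (v - u))\<^sup>2) (real DIM('a) * \<rho> * T)"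
      using integral_shifted_energy[OF F[OF t], of u] integral_shifted_energy[OF F[of 0], of u]
      by (simp add: c has_bochner_integral_iff)
  qed simp
qed

section \<open>The collision operator on measures with finite energy\<close>

definition rate :: "real \<Rightarrow> 'a::euclidean_space \<Rightarrow> 'a \<Rightarrow> real" where
  "rate \<gamma> v w = norm (v - w) powr \<gamma>"

lemma rate_nonneg [simp]: "0 \<le> rate \<gamma> v w"
  by (simp add: rate_def)

lemma rate_measurable [measurable (raw)]:
  "f \<in> borel_measurable M \<Longrightarrow> g \<in> borel_measurable M \<Longrightarrow> (\<lambda>x. rate \<gamma> (f x) (g x)) \<in> borel_measurable M"
  unfolding rate_def by measurable

lemma vprime_measurable [measurable (raw)]:
  fixes f g h :: "'b \<Rightarrow> 'a::euclidean_space"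
  assumes [measurable]: "f \<in> borel_measurable M" "g \<in> borel_measurable M" "h \<in> borel_measurable M"
  shows "(\<lambda>x. vprime (f x) (g x) (h x)) \<in> borel_measurable M"
  unfolding vprime_def by measurable

lemma norm_diff_power2_le:
  fixes u v w :: "'a::real_inner"
  shows "(norm (v - w))\<^sup>2 \<le> 2 * ((norm (v - u))\<^sup>2 + (norm (w - u))\<^sup>2)"
proof -
  have "(norm ((v - u) - (w - u)))\<^sup>2 + (norm ((v - u) + (w - u)))\<^sup>2
      = 2 * (norm (v - u))\<^sup>2 + 2 * (norm (w - u))\<^sup>2"
    by (simp add: power2_norm_eq_inner inner_simps inner_commute)
  moreover have "(v - u) - (w - u) = v - w" by simp
  ultimately have "(norm (v - w))\<^sup>2 + (norm ((v - u) + (w - u)))\<^sup>2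
      = 2 * (norm (v - u))\<^sup>2 + 2 * (norm (w - u))\<^sup>2" by metis
  then show ?thesis using zero_le_power2[of "norm ((v - u) + (w - u))"]
    unfolding distrib_left by linarith
qed

text \<open>The tangent at \<open>a\<close> of a concave power. Integrating it, with \<open>a\<close> the mean value, is Jensen's
  inequality for a measure of any total mass.\<close>

lemma powr_le_tangent:
  fixes x a s :: real
  assumes "0 < a" "0 \<le> x" "0 < s" "s \<le> 1"
  shows "x powr s \<le> a powr s * (1 - s) + s * a powr (s - 1) * x"
proof (cases "x = 0")
  case False
  then have x: "x > 0" using assms by simp
  have "x powr s * a powr (1 - s) \<le> s * x + (1 - s) * a"
    using Youngs_inequality_0[of s "1 - s" x a] assms x by simp
  then have "x powr s * a powr (1 - s) * a powr (s - 1) \<le> (s * x + (1 - s) * a) * a powr (s - 1)"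
    by (rule mult_right_mono) simp
  also have "(s * x + (1 - s) * a) * a powr (s - 1) = (a * a powr (s - 1)) * (1 - s) + s * a powr (s - 1) * x"
    by (simp add: algebra_simps)
  also have "a * a powr (s - 1) = a powr s"
    using assms by (simp add: powr_mult_base)
  also have "x powr s * a powr (1 - s) * a powr (s - 1) = x powr s"
    using assms by (simp add: mult.assoc flip: powr_add)
  finally show ?thesis .
qed (use assms in simp)

lemma powr_eq_power2_powr: "norm x powr \<gamma> = ((norm x)\<^sup>2) powr (\<gamma> / 2)"
  by (simp add: powr_powr flip: powr_numeral)

lemma rate_le:
  fixes u v w :: "'a::euclidean_space"
  assumes "0 < \<gamma>" "\<gamma> \<le> 2"
  shows "rate \<gamma> v w \<le> 1 + 2 * ((norm (v - u))\<^sup>2 + (norm (w - u))\<^sup>2)"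
proof -
  have "rate \<gamma> v w \<le> 1 powr (\<gamma> / 2) * (1 - \<gamma> / 2) + \<gamma> / 2 * 1 powr (\<gamma> / 2 - 1) * (norm (v - w))\<^sup>2"
    unfolding rate_def powr_eq_power2_powr[of "v - w"] using assms by (intro powr_le_tangent) auto
  also have "\<dots> \<le> 1 + 1 * (norm (v - w))\<^sup>2"
    using mult_right_mono[of "\<gamma> / 2" 1 "(norm (v - w))\<^sup>2"] assms by simp
  finally show ?thesis using norm_diff_power2_le[of v w u] by simp
qed

text \<open>\<open>LB\<close> with \<open>sgn (v - w)\<close> as direction, which is Borel in the pair of velocities. The two differ
  for \<open>v = w\<close> in the direction only, and there the rate is 0.\<close>

definition gain :: "(real \<Rightarrow> real) \<Rightarrow> real \<Rightarrow> ('a \<Rightarrow> real) \<Rightarrow> 'a \<Rightarrow> 'a::euclidean_space \<Rightarrow> real" where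
  "gain \<beta> \<gamma> \<psi> v w = rate \<gamma> v w * (\<integral>\<sigma>. \<beta> (sgn (v - w) \<bullet> \<sigma>) * \<psi> (vprime v w \<sigma>) \<partial>usphere)"

lemma LB_eq_gain:
  fixes \<psi> :: "'a::euclidean_space \<Rightarrow> real"
  assumes [measurable]: "\<beta> \<in> borel_measurable borel" "\<psi> \<in> borel_measurable borel"
    and eq: "\<And>x. x \<in> {-1..1} \<Longrightarrow> b x = \<beta> x"
  shows "LB b \<gamma> \<psi> v w = gain \<beta> \<gamma> \<psi> v w"
proof (cases "v = w")
  case False
  then have n: "ndir v w = sgn (v - w)" "norm (sgn (v - w)) = 1"
    by (auto simp: ndir_def sgn_div_norm divide_inverse norm_sgn)
  have "(\<integral>\<sigma>. b (ndir v w \<bullet> \<sigma>) * \<psi> (vprime v w \<sigma>) \<partial>sphere_measure)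
      = (\<integral>\<sigma>. \<beta> (sgn (v - w) \<bullet> \<sigma>) * \<psi> (vprime v w \<sigma>) \<partial>sphere_measure)"
  proof (rule Bochner_Integration.integral_cong)
    fix \<sigma> :: 'a assume "\<sigma> \<in> space sphere_measure"
    then have "norm \<sigma> = 1"
      by (simp add: sphere_measure_def space_scale_measure space_restrict_space)
    then have "\<bar>sgn (v - w) \<bullet> \<sigma>\<bar> \<le> 1"
      using Cauchy_Schwarz_ineq2[of "sgn (v - w)" \<sigma>] n(2) by simp
    then show "b (ndir v w \<bullet> \<sigma>) * \<psi> (vprime v w \<sigma>) = \<beta> (sgn (v - w) \<bullet> \<sigma>) * \<psi> (vprime v w \<sigma>)"
      unfolding n(1) by (subst eq) (auto simp: abs_le_iff)
  qed simp
  also have "\<dots> = (\<integral>\<sigma>. \<beta> (sgn (v - w) \<bullet> \<sigma>) * \<psi> (vprime v w \<sigma>) \<partial>usphere)"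
    unfolding usphere_def by (subst integral_distr) auto
  finally show ?thesis by (simp add: LB_def gain_def rate_def)
qed (simp add: LB_def gain_def rate_def)

lemma gain_measurable [measurable (raw)]:
  assumes [measurable]: "\<beta> \<in> borel_measurable borel" "\<psi> \<in> borel_measurable borel"
    "f \<in> borel_measurable M" "g \<in> borel_measurable M"
  shows "(\<lambda>x. gain \<beta> \<gamma> \<psi> (f x) (g x)) \<in> borel_measurable M"
  unfolding gain_def by measurable

text \<open>The function \<open>\<beta>\<close> is the angular kernel extended to the real line, and its normalisation is stated
  on the sphere.\<close>

locale collision = velocity_measure \<mu> u \<rho> E
  for \<mu> :: "('a::euclidean_space) measure" and u \<rho> E +
  fixes \<beta> :: "real \<Rightarrow> real" and \<gamma> :: real
  assumes \<beta>_measurable [measurable]: "\<beta> \<in> borel_measurable borel"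
    and \<beta>_nonneg [simp]: "\<And>x. 0 \<le> \<beta> x"
    and \<beta>_normalised: "\<And>e::'a. norm e = 1 \<Longrightarrow> (\<integral>\<^sup>+\<sigma>. ennreal (\<beta> (e \<bullet> \<sigma>)) \<partial>usphere) = 1"
    and \<gamma>: "0 < \<gamma>" "\<gamma> \<le> 2"
begin

lemma nn_integral_rate_\<beta>:
  fixes v w :: 'a
  shows "(\<integral>\<^sup>+\<sigma>. ennreal (rate \<gamma> v w * \<beta> (sgn (v - w) \<bullet> \<sigma>)) \<partial>usphere) = ennreal (rate \<gamma> v w)"
proof (cases "v = w")
  case False
  then have "norm (sgn (v - w)) = 1" by (simp add: norm_sgn)
  from \<beta>_normalised[OF this] show ?thesis
    by (simp add: ennreal_mult nn_integral_cmult)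
qed (simp add: rate_def)

lemma integrable_rate_\<beta>:
  fixes v w :: 'a
  assumes [measurable]: "\<psi> \<in> borel_measurable borel" and C: "\<And>v. \<bar>\<psi> v\<bar> \<le> C"
  shows "integrable usphere (\<lambda>\<sigma>. rate \<gamma> v w * \<beta> (sgn (v - w) \<bullet> \<sigma>) * \<psi> (vprime v w \<sigma>))"
proof (rule Bochner_Integration.integrable_bound)
  show "integrable usphere (\<lambda>\<sigma>. rate \<gamma> v w * \<beta> (sgn (v - w) \<bullet> \<sigma>) * C)"
    using nn_integral_rate_\<beta>[of v w]
    by (intro integrable_mult_left integrableI_nonneg) auto
  show "AE \<sigma> in usphere. norm (rate \<gamma> v w * \<beta> (sgn (v - w) \<bullet> \<sigma>) * \<psi> (vprime v w \<sigma>))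
      \<le> norm (rate \<gamma> v w * \<beta> (sgn (v - w) \<bullet> \<sigma>) * C)"
    by (auto simp: abs_mult intro!: mult_left_mono order_trans[OF C abs_ge_self])
qed measurable

lemma gain_eq: "gain \<beta> \<gamma> \<psi> v w = (\<integral>\<sigma>. rate \<gamma> v w * \<beta> (sgn (v - w) \<bullet> \<sigma>) * \<psi> (vprime v w \<sigma>) \<partial>usphere)"
  unfolding gain_def by (simp add: mult.assoc)

lemma ennreal_gain_indicator:
  fixes v w :: 'a
  assumes [measurable]: "A \<in> sets borel"
  shows "ennreal (gain \<beta> \<gamma> (indicator A) v w)
    = (\<integral>\<^sup>+\<sigma>. ennreal (rate \<gamma> v w * \<beta> (sgn (v - w) \<bullet> \<sigma>)) * indicator A (vprime v w \<sigma>) \<partial>usphere)"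
proof -
  have "(\<integral>\<^sup>+\<sigma>. ennreal (rate \<gamma> v w * \<beta> (sgn (v - w) \<bullet> \<sigma>) * indicator A (vprime v w \<sigma>)) \<partial>usphere)
    = ennreal (gain \<beta> \<gamma> (indicator A) v w)"
    unfolding gain_eq
    by (rule nn_integral_eq_integral[OF integrable_rate_\<beta>[of _ 1]]) (auto simp: indicator_def)
  then show ?thesis by (simp add: ennreal_mult ennreal_indicator)
qed

lemma gain_indicator_bounds:
  fixes v w :: 'a
  assumes A [measurable]: "A \<in> sets borel"
  shows "0 \<le> gain \<beta> \<gamma> (indicator A) v w" "gain \<beta> \<gamma> (indicator A) v w \<le> rate \<gamma> v w"
proof -
  show "0 \<le> gain \<beta> \<gamma> (indicator A) v w" by (simp add: gain_def)
  have "ennreal (gain \<beta> \<gamma> (indicator A) v w)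
    \<le> (\<integral>\<^sup>+\<sigma>. ennreal (rate \<gamma> v w * \<beta> (sgn (v - w) \<bullet> \<sigma>)) \<partial>usphere)"
    unfolding ennreal_gain_indicator[OF A]
    by (intro nn_integral_mono) (auto simp: indicator_def)
  then show "gain \<beta> \<gamma> (indicator A) v w \<le> rate \<gamma> v w"
    by (simp add: nn_integral_rate_\<beta> ennreal_le_iff)
qed

lemma energy_integrable [simp]: "integrable \<mu> (\<lambda>v. (norm (v - u))\<^sup>2)"
  using energy by (rule integrable.intros)

lemma integral_rate_bound:
  "has_bochner_integral \<mu> (\<lambda>v. 1 + 2 * ((norm (v - u))\<^sup>2 + (norm (w - u))\<^sup>2))
     (\<rho> + 2 * (E + (norm (w - u))\<^sup>2 * \<rho>))"
proof -
  have c: "has_bochner_integral \<mu> (\<lambda>v. c) (c * \<rho>)" for c :: real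
    using mass by (simp add: has_bochner_integral_iff mult.commute)
  show ?thesis
    using c[of 1] by (intro has_bochner_integral_add has_bochner_integral_mult_right energy c) simp
qed

lemma integrable_rate: "integrable \<mu> (\<lambda>v. rate \<gamma> v w)"
proof (rule Bochner_Integration.integrable_bound[OF integrable.intros[OF integral_rate_bound[of w]]])
  show "AE v in \<mu>. norm (rate \<gamma> v w) \<le> norm (1 + 2 * ((norm (v - u))\<^sup>2 + (norm (w - u))\<^sup>2))"
    unfolding real_norm_def abs_of_nonneg[OF rate_nonneg]
    by (intro AE_I2 order_trans[OF rate_le[OF \<gamma>] abs_ge_self])
qed measurable

lemma nn_integral_rate_le:
  "(\<integral>\<^sup>+v. ennreal (rate \<gamma> v w) \<partial>\<mu>) \<le> ennreal (\<rho> + 2 * (E + (norm (w - u))\<^sup>2 * \<rho>))"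
proof -
  have "(\<integral>\<^sup>+v. ennreal (rate \<gamma> v w) \<partial>\<mu>) \<le> (\<integral>\<^sup>+v. ennreal (1 + 2 * ((norm (v - u))\<^sup>2 + (norm (w - u))\<^sup>2)) \<partial>\<mu>)"
    by (intro nn_integral_mono ennreal_leI rate_le[OF \<gamma>])
  also have "\<dots> = ennreal (\<rho> + 2 * (E + (norm (w - u))\<^sup>2 * \<rho>))"
    unfolding has_bochner_integral_integral_eq[OF integral_rate_bound[of w], symmetric]
    by (rule nn_integral_eq_integral[OF integrable.intros[OF integral_rate_bound[of w]]]) simp
  finally show ?thesis .
qed

lemma nn_integral_rate_finite: "(\<integral>\<^sup>+w. \<integral>\<^sup>+v. ennreal (rate \<gamma> v w) \<partial>\<mu> \<partial>\<mu>) < \<infinity>"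
proof -
  have "(\<integral>\<^sup>+w. \<integral>\<^sup>+v. ennreal (rate \<gamma> v w) \<partial>\<mu> \<partial>\<mu>) \<le> (\<integral>\<^sup>+w. ennreal (\<rho> + 2 * (E + (norm (w - u))\<^sup>2 * \<rho>)) \<partial>\<mu>)"
    by (intro nn_integral_mono nn_integral_rate_le)
  also have "\<dots> < \<infinity>"
  proof -
    have "integrable \<mu> (\<lambda>w. \<rho> + 2 * (E + (norm (w - u))\<^sup>2 * \<rho>))"
      by (intro Bochner_Integration.integrable_add integrable_mult_right integrable_mult_left energy_integrable) auto
    then have "(\<integral>\<^sup>+w. ennreal (norm (\<rho> + 2 * (E + (norm (w - u))\<^sup>2 * \<rho>))) \<partial>\<mu>) < \<infinity>"
      by (simp only: integrable_iff_bounded)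
    moreover have "(\<integral>\<^sup>+w. ennreal (\<rho> + 2 * (E + (norm (w - u))\<^sup>2 * \<rho>)) \<partial>\<mu>)
        \<le> (\<integral>\<^sup>+w. ennreal (norm (\<rho> + 2 * (E + (norm (w - u))\<^sup>2 * \<rho>))) \<partial>\<mu>)"
      unfolding real_norm_def by (intro nn_integral_mono ennreal_leI abs_ge_self)
    ultimately show ?thesis by (rule le_less_trans[rotated])
  qed
  finally show ?thesis .
qed

text \<open>The gain and loss terms as image measures: incoming pairs are weighted with their collision
  rate and sent to the outgoing velocity or to \<open>v\<close>. The product has \<open>w\<close> as first factor because the
  outer integral in \<open>Qplus\<close> and \<open>Qminus\<close> runs over \<open>w\<close>.\<close>

definition gain_measure :: "'a measure" where
  "gain_measure = distr (density (\<mu> \<Otimes>\<^sub>M (\<mu> \<Otimes>\<^sub>M usphere))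
     (\<lambda>x. ennreal (case x of (w, v, \<sigma>) \<Rightarrow> rate \<gamma> v w * \<beta> (sgn (v - w) \<bullet> \<sigma>)))) borel (\<lambda>(w, v, \<sigma>). vprime v w \<sigma>)"

definition loss_measure :: "'a measure" where
  "loss_measure = distr (density (\<mu> \<Otimes>\<^sub>M \<mu>) (\<lambda>x. ennreal (case x of (w, v) \<Rightarrow> rate \<gamma> v w))) borel snd"

lemma sets_gain_loss [simp]: "sets gain_measure = sets borel" "sets loss_measure = sets borel"
  by (simp_all add: gain_measure_def loss_measure_def)

sublocale mm: pair_sigma_finite \<mu> \<mu> ..
sublocale ms: pair_sigma_finite \<mu> usphere ..
sublocale mms: pair_sigma_finite \<mu> "\<mu> \<Otimes>\<^sub>M usphere" ..

lemma nn_integral_triple: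
  assumes [measurable]: "f \<in> borel_measurable (\<mu> \<Otimes>\<^sub>M (\<mu> \<Otimes>\<^sub>M usphere))"
  shows "(\<integral>\<^sup>+x. f x \<partial>(\<mu> \<Otimes>\<^sub>M (\<mu> \<Otimes>\<^sub>M usphere))) = (\<integral>\<^sup>+w. \<integral>\<^sup>+v. \<integral>\<^sup>+\<sigma>. f (w, v, \<sigma>) \<partial>usphere \<partial>\<mu> \<partial>\<mu>)"
proof -
  have "sigma_finite_measure (\<mu> \<Otimes>\<^sub>M usphere)" ..
  from sigma_finite_measure.nn_integral_fst[OF this assms]
  have "(\<integral>\<^sup>+x. f x \<partial>(\<mu> \<Otimes>\<^sub>M (\<mu> \<Otimes>\<^sub>M usphere))) = (\<integral>\<^sup>+w. \<integral>\<^sup>+x. f (w, x) \<partial>(\<mu> \<Otimes>\<^sub>M usphere) \<partial>\<mu>)" by simp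
  also have "\<dots> = (\<integral>\<^sup>+w. \<integral>\<^sup>+v. \<integral>\<^sup>+\<sigma>. f (w, v, \<sigma>) \<partial>usphere \<partial>\<mu> \<partial>\<mu>)"
    by (rule nn_integral_cong, rule usphere.nn_integral_fst[symmetric]) simp
  finally show ?thesis .
qed

lemma nn_integral_pair:
  assumes [measurable]: "f \<in> borel_measurable (\<mu> \<Otimes>\<^sub>M \<mu>)"
  shows "(\<integral>\<^sup>+x. f x \<partial>(\<mu> \<Otimes>\<^sub>M \<mu>)) = (\<integral>\<^sup>+w. \<integral>\<^sup>+v. f (w, v) \<partial>\<mu> \<partial>\<mu>)"
  using nn_integral_fst[OF assms] by simp

lemma nn_integral_gain_measure:
  assumes [measurable]: "f \<in> borel_measurable borel"
  shows "(\<integral>\<^sup>+x. f x \<partial>gain_measure)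
    = (\<integral>\<^sup>+w. \<integral>\<^sup>+v. \<integral>\<^sup>+\<sigma>. ennreal (rate \<gamma> v w * \<beta> (sgn (v - w) \<bullet> \<sigma>)) * f (vprime v w \<sigma>) \<partial>usphere \<partial>\<mu> \<partial>\<mu>)"
proof -
  have "(\<integral>\<^sup>+x. f x \<partial>gain_measure)
    = (\<integral>\<^sup>+(w, v, \<sigma>). ennreal (rate \<gamma> v w * \<beta> (sgn (v - w) \<bullet> \<sigma>)) * f (vprime v w \<sigma>) \<partial>(\<mu> \<Otimes>\<^sub>M (\<mu> \<Otimes>\<^sub>M usphere)))"
    unfolding gain_measure_def
    by (subst nn_integral_distr, measurable, subst nn_integral_density, measurable)
       (auto intro!: nn_integral_cong)
  also have "\<dots> = (\<integral>\<^sup>+w. \<integral>\<^sup>+v. \<integral>\<^sup>+\<sigma>. ennreal (rate \<gamma> v w * \<beta> (sgn (v - w) \<bullet> \<sigma>)) * f (vprime v w \<sigma>) \<partial>usphere \<partial>\<mu> \<partial>\<mu>)"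
    by (subst nn_integral_triple) simp_all
  finally show ?thesis .
qed

lemma nn_integral_loss_measure:
  assumes [measurable]: "f \<in> borel_measurable borel"
  shows "(\<integral>\<^sup>+x. f x \<partial>loss_measure) = (\<integral>\<^sup>+w. \<integral>\<^sup>+v. ennreal (rate \<gamma> v w) * f v \<partial>\<mu> \<partial>\<mu>)"
proof -
  have "(\<integral>\<^sup>+x. f x \<partial>loss_measure) = (\<integral>\<^sup>+(w, v). ennreal (rate \<gamma> v w) * f v \<partial>(\<mu> \<Otimes>\<^sub>M \<mu>))"
    unfolding loss_measure_def
    by (subst nn_integral_distr, measurable, subst nn_integral_density, measurable)
       (auto intro!: nn_integral_cong)
  also have "\<dots> = (\<integral>\<^sup>+w. \<integral>\<^sup>+v. ennreal (rate \<gamma> v w) * f v \<partial>\<mu> \<partial>\<mu>)"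
    by (subst nn_integral_pair) simp_all
  finally show ?thesis .
qed

lemma finite_gain_loss: "finite_measure gain_measure" "finite_measure loss_measure"
proof -
  have "emeasure gain_measure UNIV = (\<integral>\<^sup>+w. \<integral>\<^sup>+v. ennreal (rate \<gamma> v w) \<partial>\<mu> \<partial>\<mu>)"
    using nn_integral_gain_measure[of "\<lambda>_. 1"] sets_eq_imp_space_eq[OF sets_gain_loss(1)]
    by (simp add: nn_integral_rate_\<beta>)
  then show "finite_measure gain_measure"
    using nn_integral_rate_finite sets_eq_imp_space_eq[OF sets_gain_loss(1)] by (intro finite_measureI) auto
  have "emeasure loss_measure UNIV = (\<integral>\<^sup>+w. \<integral>\<^sup>+v. ennreal (rate \<gamma> v w) \<partial>\<mu> \<partial>\<mu>)"
    using nn_integral_loss_measure[of "\<lambda>_. 1"] sets_eq_imp_space_eq[OF sets_gain_loss(2)] by simp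
  then show "finite_measure loss_measure"
    using nn_integral_rate_finite sets_eq_imp_space_eq[OF sets_gain_loss(2)] by (intro finite_measureI) auto
qed

lemma integral_gain_measure:
  assumes [measurable]: "\<psi> \<in> borel_measurable borel" and C: "\<And>v. \<bar>\<psi> v\<bar> \<le> C"
  shows "integral\<^sup>L gain_measure \<psi> = (\<integral>w. \<integral>v. gain \<beta> \<gamma> \<psi> v w \<partial>\<mu> \<partial>\<mu>)"
proof -
  let ?W = "\<lambda>w v \<sigma>. rate \<gamma> v w * \<beta> (sgn (v - w) \<bullet> \<sigma>)"
  let ?f = "\<lambda>(w, v, \<sigma>). ?W w v \<sigma> * \<psi> (vprime v w \<sigma>)"
  have C0: "C \<ge> 0" using C[of 0] by simp
  have W1: "integrable (\<mu> \<Otimes>\<^sub>M usphere) (\<lambda>(v, \<sigma>). ?W w v \<sigma>)" for w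
  proof (rule integrableI_nonneg)
    have "(\<integral>\<^sup>+x. ennreal (case x of (v, \<sigma>) \<Rightarrow> ?W w v \<sigma>) \<partial>(\<mu> \<Otimes>\<^sub>M usphere)) = (\<integral>\<^sup>+v. ennreal (rate \<gamma> v w) \<partial>\<mu>)"
      by (subst usphere.nn_integral_fst[symmetric]) (measurable, simp add: nn_integral_rate_\<beta>)
    also have "\<dots> < \<infinity>" using nn_integral_rate_le[of w] by (rule le_less_trans) simp
    finally show "(\<integral>\<^sup>+x. ennreal (case x of (v, \<sigma>) \<Rightarrow> ?W w v \<sigma>) \<partial>(\<mu> \<Otimes>\<^sub>M usphere)) < \<infinity>" .
  qed (measurable, auto)
  have W2: "integrable (\<mu> \<Otimes>\<^sub>M (\<mu> \<Otimes>\<^sub>M usphere)) (\<lambda>(w, v, \<sigma>). ?W w v \<sigma>)"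
  proof (rule integrableI_nonneg)
    have "(\<integral>\<^sup>+x. ennreal (case x of (w, v, \<sigma>) \<Rightarrow> ?W w v \<sigma>) \<partial>(\<mu> \<Otimes>\<^sub>M (\<mu> \<Otimes>\<^sub>M usphere))) = (\<integral>\<^sup>+w. \<integral>\<^sup>+v. ennreal (rate \<gamma> v w) \<partial>\<mu> \<partial>\<mu>)"
      by (subst nn_integral_triple) (simp_all add: nn_integral_rate_\<beta>)
    then show "(\<integral>\<^sup>+x. ennreal (case x of (w, v, \<sigma>) \<Rightarrow> ?W w v \<sigma>) \<partial>(\<mu> \<Otimes>\<^sub>M (\<mu> \<Otimes>\<^sub>M usphere))) < \<infinity>"
      using nn_integral_rate_finite by simp
  qed (measurable, auto)
  have bd: "\<bar>?W w v \<sigma> * \<psi> (vprime v w \<sigma>)\<bar> \<le> \<bar>?W w v \<sigma> * C\<bar>" for w v \<sigma>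
    using C0 C by (auto simp: abs_mult intro!: mult_left_mono)
  have i1: "integrable (\<mu> \<Otimes>\<^sub>M usphere) (\<lambda>(v, \<sigma>). ?W w v \<sigma> * \<psi> (vprime v w \<sigma>))" for w
    by (rule Bochner_Integration.integrable_bound[OF integrable_mult_left[OF W1[of w], of C]])
       (measurable, auto intro!: AE_I2 bd)
  have i2: "integrable (\<mu> \<Otimes>\<^sub>M (\<mu> \<Otimes>\<^sub>M usphere)) ?f"
    by (rule Bochner_Integration.integrable_bound[OF integrable_mult_left[OF W2, of C]])
       (measurable, auto intro!: AE_I2 bd)
  have "integral\<^sup>L gain_measure \<psi> = integral\<^sup>L (\<mu> \<Otimes>\<^sub>M (\<mu> \<Otimes>\<^sub>M usphere)) ?f"
  proof -
    have "integral\<^sup>L gain_measure \<psi> = integral\<^sup>L (density (\<mu> \<Otimes>\<^sub>M (\<mu> \<Otimes>\<^sub>M usphere))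
        (\<lambda>x. ennreal (case x of (w, v, \<sigma>) \<Rightarrow> ?W w v \<sigma>))) (\<lambda>x. \<psi> (case x of (w, v, \<sigma>) \<Rightarrow> vprime v w \<sigma>))"
      unfolding gain_measure_def by (rule integral_distr) simp_all
    also have "\<dots> = (\<integral>x. (case x of (w, v, \<sigma>) \<Rightarrow> ?W w v \<sigma>) *\<^sub>R \<psi> (case x of (w, v, \<sigma>) \<Rightarrow> vprime v w \<sigma>) \<partial>(\<mu> \<Otimes>\<^sub>M (\<mu> \<Otimes>\<^sub>M usphere)))"
      by (rule integral_density) (auto intro!: AE_I2)
    also have "\<dots> = integral\<^sup>L (\<mu> \<Otimes>\<^sub>M (\<mu> \<Otimes>\<^sub>M usphere)) ?f"
      by (intro Bochner_Integration.integral_cong) auto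
    finally show ?thesis .
  qed
  also have "\<dots> = (\<integral>w. (\<integral>x. ?f (w, x) \<partial>(\<mu> \<Otimes>\<^sub>M usphere)) \<partial>\<mu>)"
    by (rule mms.integral_fst'[OF i2, symmetric])
  also have "\<dots> = (\<integral>w. (\<integral>v. gain \<beta> \<gamma> \<psi> v w \<partial>\<mu>) \<partial>\<mu>)"
  proof (rule Bochner_Integration.integral_cong[OF refl])
    fix w
    show "(\<integral>x. ?f (w, x) \<partial>(\<mu> \<Otimes>\<^sub>M usphere)) = (\<integral>v. gain \<beta> \<gamma> \<psi> v w \<partial>\<mu>)"
      using ms.integral_fst'[OF i1[of w]] by (simp add: gain_eq)
  qed
  finally show ?thesis .
qed

lemma integral_loss_measure:
  assumes [measurable]: "\<psi> \<in> borel_measurable borel" and C: "\<And>v. \<bar>\<psi> v\<bar> \<le> C"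
  shows "integral\<^sup>L loss_measure \<psi> = (\<integral>w. \<integral>v. rate \<gamma> v w * \<psi> v \<partial>\<mu> \<partial>\<mu>)"
proof -
  have C0: "C \<ge> 0" using C[of 0] by simp
  have W: "integrable (\<mu> \<Otimes>\<^sub>M \<mu>) (\<lambda>(w, v). rate \<gamma> v w)"
  proof (rule integrableI_nonneg)
    have "(\<integral>\<^sup>+x. ennreal (case x of (w, v) \<Rightarrow> rate \<gamma> v w) \<partial>(\<mu> \<Otimes>\<^sub>M \<mu>)) = (\<integral>\<^sup>+w. \<integral>\<^sup>+v. ennreal (rate \<gamma> v w) \<partial>\<mu> \<partial>\<mu>)"
      by (subst nn_integral_pair) simp_all
    then show "(\<integral>\<^sup>+x. ennreal (case x of (w, v) \<Rightarrow> rate \<gamma> v w) \<partial>(\<mu> \<Otimes>\<^sub>M \<mu>)) < \<infinity>"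
      using nn_integral_rate_finite by simp
  qed (measurable, auto)
  have i: "integrable (\<mu> \<Otimes>\<^sub>M \<mu>) (\<lambda>(w, v). rate \<gamma> v w * \<psi> v)"
    by (rule Bochner_Integration.integrable_bound[OF integrable_mult_left[OF W, of C]])
       (measurable, use C0 C in \<open>auto simp: abs_mult intro!: AE_I2 mult_left_mono\<close>)
  have "integral\<^sup>L loss_measure \<psi> = (\<integral>(w, v). rate \<gamma> v w * \<psi> v \<partial>(\<mu> \<Otimes>\<^sub>M \<mu>))"
  proof -
    have "integral\<^sup>L loss_measure \<psi> = integral\<^sup>L (density (\<mu> \<Otimes>\<^sub>M \<mu>)
        (\<lambda>x. ennreal (case x of (w, v) \<Rightarrow> rate \<gamma> v w))) (\<lambda>x. \<psi> (snd x))"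
      unfolding loss_measure_def by (rule integral_distr) simp_all
    also have "\<dots> = (\<integral>x. (case x of (w, v) \<Rightarrow> rate \<gamma> v w) *\<^sub>R \<psi> (snd x) \<partial>(\<mu> \<Otimes>\<^sub>M \<mu>))"
      by (rule integral_density) (auto intro!: AE_I2)
    also have "\<dots> = (\<integral>(w, v). rate \<gamma> v w * \<psi> v \<partial>(\<mu> \<Otimes>\<^sub>M \<mu>))"
      by (intro Bochner_Integration.integral_cong) auto
    finally show ?thesis .
  qed
  also have "\<dots> = (\<integral>w. \<integral>v. rate \<gamma> v w * \<psi> v \<partial>\<mu> \<partial>\<mu>)"
    using mm.integral_fst'[OF i] by simp
  finally show ?thesis .
qed

lemma Qcoll_eq:
  assumes b: "\<And>x. x \<in> {-1..1} \<Longrightarrow> b x = \<beta> x" and A0: "A0 DIM('a) b = 1"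
  shows "Qcoll b \<gamma> (of_measure \<mu>) (of_measure \<mu>) = of_measure gain_measure - of_measure loss_measure"
proof -
  have fm: "finite_measure \<mu>" by unfold_locales
  have bdd: "\<exists>C. \<forall>v. \<bar>\<psi> v\<bar> \<le> C" if "bounded (range \<psi>)" for \<psi> :: "'a \<Rightarrow> real"
    using that by (auto simp: bounded_iff)
  have "Qplus b \<gamma> (of_measure \<mu>) (of_measure \<mu>) = of_measure gain_measure"
    unfolding Qplus_def
  proof (rule the_signed_measure_eq[OF finite_gain_loss(1) sets_gain_loss(1)])
    fix \<psi> :: "'a \<Rightarrow> real" assume \<psi>: "\<psi> \<in> borel_measurable borel" "bounded (range \<psi>)"
    from bdd[OF \<psi>(2)] obtain C where "\<And>v. \<bar>\<psi> v\<bar> \<le> C" by auto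
    note g = integral_gain_measure[OF \<psi>(1) this]
    have "LB b \<gamma> \<psi> v w = gain \<beta> \<gamma> \<psi> v w" for v w
      by (rule LB_eq_gain[OF \<beta>_measurable \<psi>(1) b])
    with g
    show "integral\<^sup>L gain_measure \<psi> = sint (of_measure \<mu>) (\<lambda>w. sint (of_measure \<mu>) (\<lambda>v. LB b \<gamma> \<psi> v w))"
      by (simp add: sint_of_measure[OF fm sets_eq])
  qed
  moreover have "Qminus b \<gamma> (of_measure \<mu>) (of_measure \<mu>) = of_measure loss_measure"
    unfolding Qminus_def
  proof (rule the_signed_measure_eq[OF finite_gain_loss(2) sets_gain_loss(2)])
    fix \<psi> :: "'a \<Rightarrow> real" assume \<psi>: "\<psi> \<in> borel_measurable borel" "bounded (range \<psi>)"
    from bdd[OF \<psi>(2)] obtain C where "\<And>v. \<bar>\<psi> v\<bar> \<le> C" by auto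
    from integral_loss_measure[OF \<psi>(1) this]
    show "integral\<^sup>L loss_measure \<psi> = A0 DIM('a) b * sint (of_measure \<mu>) (\<lambda>w. sint (of_measure \<mu>) (\<lambda>v. norm (v - w) powr \<gamma> * \<psi> v))"
      by (simp add: sint_of_measure[OF fm sets_eq] A0 rate_def)
  qed
  ultimately show ?thesis by (simp add: Qcoll_def)
qed

lemma integrable_rate_mult:
  assumes "A \<in> sets borel"
  shows "integrable \<mu> (\<lambda>v. gain \<beta> \<gamma> (indicator A) v w)" "integrable \<mu> (\<lambda>v. rate \<gamma> v w * indicator A v)"
  using assms gain_indicator_bounds[OF assms]
  by (auto intro!: Bochner_Integration.integrable_bound[OF integrable_rate[of w]] simp: indicator_def)

end

section \<open>The Maxwellian is an equilibrium\<close>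

text \<open>Two successive translations, \<open>v = z + w\<close> for fixed \<open>w\<close> and \<open>w = x - z/2\<close> for fixed \<open>z\<close>, so that no
  Jacobian appears.\<close>

lemma nn_integral_centre_relative:
  fixes H :: "'a::euclidean_space \<Rightarrow> 'a \<Rightarrow> ennreal"
  assumes [measurable]: "case_prod H \<in> borel_measurable (borel \<Otimes>\<^sub>M borel)"
  shows "(\<integral>\<^sup>+w. \<integral>\<^sup>+v. H v w \<partial>lborel \<partial>lborel)
    = (\<integral>\<^sup>+x. \<integral>\<^sup>+z. H (x + (1 / 2) *\<^sub>R z) (x - (1 / 2) *\<^sub>R z) \<partial>lborel \<partial>lborel)"
proof -
  have H [measurable (raw)]: "(\<lambda>x. H (f x) (g x)) \<in> borel_measurable N"
    if [measurable]: "f \<in> borel_measurable N" "g \<in> borel_measurable N" for f g and N :: "'b measure"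
    using measurable_compose[OF measurable_Pair[OF that] assms] by simp
  have "(\<integral>\<^sup>+w. \<integral>\<^sup>+v. H v w \<partial>lborel \<partial>lborel) = (\<integral>\<^sup>+w. \<integral>\<^sup>+z. H (z + w) w \<partial>lborel \<partial>lborel)"
    by (rule nn_integral_cong, rule nn_integral_lborel_translate[symmetric]) measurable
  also have "\<dots> = (\<integral>\<^sup>+z. \<integral>\<^sup>+w. H (z + w) w \<partial>lborel \<partial>lborel)"
    by (rule lborel_pair.Fubini') measurable
  also have "\<dots> = (\<integral>\<^sup>+z. \<integral>\<^sup>+x. H (x + (1 / 2) *\<^sub>R z) (x - (1 / 2) *\<^sub>R z) \<partial>lborel \<partial>lborel)"
  proof (rule nn_integral_cong)
    fix z :: 'a
    have eq: "z + (x + - ((1 / 2) *\<^sub>R z)) = x + (1 / 2) *\<^sub>R z" for x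
      by (simp add: algebra_simps flip: scaleR_add_left)
    have "(\<integral>\<^sup>+w. H (z + w) w \<partial>lborel)
        = (\<integral>\<^sup>+x. H (z + (x + - ((1 / 2) *\<^sub>R z))) (x + - ((1 / 2) *\<^sub>R z)) \<partial>lborel)"
      by (rule nn_integral_lborel_translate[symmetric]) measurable
    then show "(\<integral>\<^sup>+w. H (z + w) w \<partial>lborel) = (\<integral>\<^sup>+x. H (x + (1 / 2) *\<^sub>R z) (x - (1 / 2) *\<^sub>R z) \<partial>lborel)"
      unfolding eq unfolding add_uminus_conv_diff .
  qed
  also have "\<dots> = (\<integral>\<^sup>+x. \<integral>\<^sup>+z. H (x + (1 / 2) *\<^sub>R z) (x - (1 / 2) *\<^sub>R z) \<partial>lborel \<partial>lborel)"
    by (rule lborel_pair.Fubini') measurable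
  finally show ?thesis .
qed

text \<open>In polar coordinates \<open>z = r \<omega>\<close> the two directions enter through \<open>\<beta> (\<omega> \<bullet> \<sigma>)\<close>, which is symmetric,
  so averaging over the incoming direction \<open>\<omega>\<close> gives 1 for every outgoing \<open>\<sigma>\<close>.\<close>

lemma nn_integral_isotropic_scattering:
  fixes K :: "real \<Rightarrow> 'a::euclidean_space \<Rightarrow> ennreal"
  assumes K [measurable]: "case_prod K \<in> borel_measurable (borel \<Otimes>\<^sub>M borel)"
    and [measurable]: "\<beta> \<in> borel_measurable borel"
    and normalised: "\<And>e::'a. norm e = 1 \<Longrightarrow> (\<integral>\<^sup>+\<sigma>. ennreal (\<beta> (e \<bullet> \<sigma>)) \<partial>usphere) = 1"
  shows "(\<integral>\<^sup>+z. \<integral>\<^sup>+\<sigma>. ennreal (\<beta> (sgn z \<bullet> \<sigma>)) * K (norm z) \<sigma> \<partial>usphere \<partial>lborel)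
    = (\<integral>\<^sup>+z. K (norm z) (sgn z) \<partial>lborel)"
proof -
  let ?a = "\<lambda>r. \<integral>\<^sup>+\<omega>. \<integral>\<^sup>+\<sigma>. ennreal (\<beta> (sgn (r *\<^sub>R \<omega>) \<bullet> \<sigma>)) * K (norm (r *\<^sub>R \<omega>)) \<sigma> \<partial>usphere \<partial>usphere"
  let ?b = "\<lambda>r. \<integral>\<^sup>+\<omega>. K (norm (r *\<^sub>R \<omega>)) (sgn (r *\<^sub>R \<omega>)) \<partial>usphere"
  have Kc [measurable (raw)]: "(\<lambda>x. K (f x) (g x)) \<in> borel_measurable N"
    if [measurable]: "f \<in> borel_measurable N" "g \<in> borel_measurable N" for f g and N :: "'b measure"
    using measurable_compose[OF measurable_Pair[OF that] K] by simp
  have f [measurable]: "(\<lambda>z. \<integral>\<^sup>+\<sigma>. ennreal (\<beta> (sgn z \<bullet> \<sigma>)) * K (norm z) \<sigma> \<partial>usphere) \<in> borel_measurable borel"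
    by measurable
  have sph: "(?a r)
     = (?b r)" if r: "r > 0" for r
  proof -
    have polar: "norm (r *\<^sub>R \<omega>) = r" "sgn (r *\<^sub>R \<omega>) = \<omega>" if "norm \<omega> = 1" for \<omega> :: 'a
      using that r by (auto simp: sgn_scaleR sgn_div_norm)
    interpret S: pair_sigma_finite "usphere :: 'a measure" "usphere :: 'a measure" ..
    have "(?a r)
      = (\<integral>\<^sup>+\<omega>. \<integral>\<^sup>+\<sigma>. ennreal (\<beta> (\<omega> \<bullet> \<sigma>)) * K r \<sigma> \<partial>usphere \<partial>usphere)"
      by (rule nn_integral_cong_AE, use AE_usphere in eventually_elim) (simp add: polar abs_of_pos[OF r])
    also have "\<dots> = (\<integral>\<^sup>+\<sigma>. \<integral>\<^sup>+\<omega>. ennreal (\<beta> (\<omega> \<bullet> \<sigma>)) * K r \<sigma> \<partial>usphere \<partial>usphere)"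
      by (rule S.Fubini') measurable
    also have "\<dots> = (\<integral>\<^sup>+\<sigma>. K r \<sigma> \<partial>usphere)"
    proof (rule nn_integral_cong_AE, use AE_usphere in eventually_elim)
      fix \<sigma> :: 'a assume "norm \<sigma> = 1"
      from normalised[OF this] show "(\<integral>\<^sup>+\<omega>. ennreal (\<beta> (\<omega> \<bullet> \<sigma>)) * K r \<sigma> \<partial>usphere) = K r \<sigma>"
        by (subst nn_integral_multc) (simp_all add: inner_commute)
    qed
    also have "\<dots> = (?b r)"
      by (rule nn_integral_cong_AE, use AE_usphere in eventually_elim) (simp add: polar abs_of_pos[OF r])
    finally show ?thesis .
  qed
  have g: "(\<lambda>z. K (norm z) (sgn z)) \<in> borel_measurable borel"
    by measurable
  show ?thesis
    unfolding nn_integral_polar[OF f] nn_integral_polar[OF g]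
  proof (rule nn_integral_cong)
    fix r :: real
    show "indicator {0<..} r * ennreal (r ^ (DIM('a) - 1)) * (?a r)
      = indicator {0<..} r * ennreal (r ^ (DIM('a) - 1)) * (?b r)"
    proof (cases "r > 0")
      case True
      show ?thesis unfolding sph[OF True] ..
    qed simp
  qed
qed

text \<open>Conservation of energy: the product depends on the relative velocity \<open>z\<close> through its length
  alone.\<close>

lemma gauss_mult:
  fixes x z u :: "'a::euclidean_space"
  shows "gauss T u (x - (1 / 2) *\<^sub>R z) * gauss T u (x + (1 / 2) *\<^sub>R z)
    = exp (- (4 * (norm (x - u))\<^sup>2 + (norm z)\<^sup>2) / (4 * T)) / ((2 * pi * T) powr (real DIM('a) / 2))\<^sup>2"
proof -
  have "(norm (x - (1 / 2) *\<^sub>R z - u))\<^sup>2 + (norm (x + (1 / 2) *\<^sub>R z - u))\<^sup>2 = 2 * (norm (x - u))\<^sup>2 + (norm z)\<^sup>2 / 2"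
    by (simp add: power2_norm_eq_inner inner_simps inner_commute field_simps)
  then have "- (norm (x - (1 / 2) *\<^sub>R z - u))\<^sup>2 / (2 * T) + - (norm (x + (1 / 2) *\<^sub>R z - u))\<^sup>2 / (2 * T)
      = - (2 * (norm (x - u))\<^sup>2 + (norm z)\<^sup>2 / 2) / (2 * T)"
    by (metis add_divide_distrib minus_add_distrib)
  also have "\<dots> = - (4 * (norm (x - u))\<^sup>2 + (norm z)\<^sup>2) / (4 * T)"
    by (cases "T = 0") (auto simp: field_simps)
  finally show ?thesis
    by (simp add: gauss_def power2_eq_square flip: exp_add)
qed

lemma nn_integral_maxwell_pair:
  fixes f :: "'a::euclidean_space \<Rightarrow> 'a \<Rightarrow> ennreal"
  assumes [measurable]: "case_prod f \<in> borel_measurable (borel \<Otimes>\<^sub>M borel)" and \<rho>: "\<rho> \<ge> 0"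
  shows "(\<integral>\<^sup>+w. \<integral>\<^sup>+v. f v w \<partial>maxwell_measure \<rho> u T \<partial>maxwell_measure \<rho> u T)
    = (\<integral>\<^sup>+x. \<integral>\<^sup>+z. ennreal (\<rho>\<^sup>2 * (exp (- (4 * (norm (x - u))\<^sup>2 + (norm z)\<^sup>2) / (4 * T)) / ((2 * pi * T) powr (real DIM('a) / 2))\<^sup>2))
        * f (x + (1 / 2) *\<^sub>R z) (x - (1 / 2) *\<^sub>R z) \<partial>lborel \<partial>lborel)"
proof -
  let ?L = "\<integral>\<^sup>+w. \<integral>\<^sup>+v. f v w \<partial>maxwell_measure \<rho> u T \<partial>maxwell_measure \<rho> u T"
  let ?i = "\<lambda>w. \<integral>\<^sup>+v. ennreal (gauss T u v) * f v w \<partial>lborel"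
  let ?m = "\<lambda>v w. ennreal (\<rho>\<^sup>2 * (gauss T u w * gauss T u v)) * f v w"
  have f [measurable (raw)]: "(\<lambda>x. f (g x) (h x)) \<in> borel_measurable N"
    if [measurable]: "g \<in> borel_measurable N" "h \<in> borel_measurable N" for g h and N :: "'b measure"
    using measurable_compose[OF measurable_Pair[OF that] assms(1)] by simp
  have "?L
    = ennreal \<rho> * (\<integral>\<^sup>+w. ennreal (gauss T u w) * (ennreal \<rho> * ?i w) \<partial>lborel)"
  proof -
    have "?L
      = (\<integral>\<^sup>+w. ennreal \<rho> * ?i w \<partial>maxwell_measure \<rho> u T)"
      by (rule nn_integral_cong, rule nn_integral_maxwell[OF \<rho>]) measurable
    also have "\<dots> = ennreal \<rho> * (\<integral>\<^sup>+w. ennreal (gauss T u w) * (ennreal \<rho> * ?i w) \<partial>lborel)"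
      by (rule nn_integral_maxwell[OF \<rho>]) measurable
    finally show ?thesis .
  qed
  also have "\<dots> = (\<integral>\<^sup>+w. \<integral>\<^sup>+v. ?m v w \<partial>lborel \<partial>lborel)"
  proof (subst nn_integral_cmult[symmetric], measurable, rule nn_integral_cong)
    fix w
    have "ennreal \<rho> * (ennreal (gauss T u w) * (ennreal \<rho> * ?i w))
        = ennreal (\<rho> * gauss T u w * \<rho>) * ?i w"
      using \<rho> by (simp add: ennreal_mult mult.assoc)
    also have "\<dots> = (\<integral>\<^sup>+v. ?m v w \<partial>lborel)"
    proof (subst nn_integral_cmult[symmetric], measurable, rule nn_integral_cong)
      fix v
      have "ennreal (\<rho> * gauss T u w * \<rho>) * ennreal (gauss T u v) = ennreal (\<rho>\<^sup>2 * (gauss T u w * gauss T u v))"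
        using \<rho> by (subst ennreal_mult[symmetric]) (auto simp: power2_eq_square mult_ac)
      then show "ennreal (\<rho> * gauss T u w * \<rho>) * (ennreal (gauss T u v) * f v w)
          = ?m v w"
        by (simp only: mult.assoc[symmetric])
    qed
    finally show "ennreal \<rho> * (ennreal (gauss T u w) * (ennreal \<rho> * ?i w))
        = (\<integral>\<^sup>+v. ?m v w \<partial>lborel)" .
  qed
  also have "\<dots> = (\<integral>\<^sup>+x. \<integral>\<^sup>+z. ennreal (\<rho>\<^sup>2 * (gauss T u (x - (1 / 2) *\<^sub>R z) * gauss T u (x + (1 / 2) *\<^sub>R z)))
      * f (x + (1 / 2) *\<^sub>R z) (x - (1 / 2) *\<^sub>R z) \<partial>lborel \<partial>lborel)"
    by (rule nn_integral_centre_relative[where H="?m"]) measurable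
  finally show ?thesis unfolding gauss_mult .
qed

text \<open>For fixed centre of mass \<open>x\<close>, the rate and the two Gaussian factors depend on \<open>|z|\<close> alone, and
  scattering replaces \<open>z/2\<close> by \<open>|z| \<sigma>/2\<close>. By isotropy both have the same law.\<close>

lemma maxwell_gain_eq_loss:
  fixes u :: "'a::euclidean_space"
  assumes \<rho>: "\<rho> > 0" and "collision (maxwell_measure \<rho> u T) u \<rho> E \<beta> \<gamma>"
  shows "collision.gain_measure (maxwell_measure \<rho> u T) \<beta> \<gamma> = collision.loss_measure (maxwell_measure \<rho> u T) \<gamma>"
proof -
  interpret collision "maxwell_measure \<rho> u T" u \<rho> E \<beta> \<gamma> by fact
  define c where "c x r = \<rho>\<^sup>2 * (exp (- (4 * (norm (x - u))\<^sup>2 + r\<^sup>2) / (4 * T)) / ((2 * pi * T) powr (real DIM('a) / 2))\<^sup>2)" for x r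
  have c0: "c x r \<ge> 0" for x r by (simp add: c_def)
  have [measurable]: "(\<lambda>p. c (f p) (g p)) \<in> borel_measurable N"
    if [measurable]: "f \<in> borel_measurable N" "g \<in> borel_measurable N" for f g and N :: "'b measure"
    unfolding c_def by measurable
  show ?thesis
  proof (rule measure_eqI)
    fix A assume "A \<in> sets gain_measure"
    then have [measurable]: "A \<in> sets borel" by simp
    define K where "K x r \<sigma> = ennreal (c x r * r powr \<gamma>) * indicator A (x + (r / 2) *\<^sub>R \<sigma>)" for x :: 'a and r \<sigma>
    have K: "case_prod (K x) \<in> borel_measurable (borel \<Otimes>\<^sub>M borel)" for x
      unfolding K_def c_def case_prod_beta by measurable
    have geom: "(norm z / 2) *\<^sub>R sgn z = (1 / 2) *\<^sub>R z" for z :: 'a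
      by (cases "z = 0") (simp_all add: sgn_div_norm)
    have rel: "(x + (1 / 2) *\<^sub>R z) - (x - (1 / 2) *\<^sub>R z) = z" for x z :: 'a
      by (simp flip: scaleR_add_left)
    have rate: "rate \<gamma> (x + (1 / 2) *\<^sub>R z) (x - (1 / 2) *\<^sub>R z) = norm z powr \<gamma>" for x z :: 'a
      unfolding rate_def rel ..
    have vpr: "vprime (x + (1 / 2) *\<^sub>R z) (x - (1 / 2) *\<^sub>R z) \<sigma> = x + (norm z / 2) *\<^sub>R \<sigma>" for x z \<sigma> :: 'a
      unfolding vprime_def rel by (simp flip: scaleR_2)
    have "emeasure gain_measure A = (\<integral>\<^sup>+v. indicator A v \<partial>gain_measure)" by simp
    also have "\<dots> = (\<integral>\<^sup>+x. \<integral>\<^sup>+z. ennreal (c x (norm z)) * (\<integral>\<^sup>+\<sigma>. ennreal (norm z powr \<gamma> * \<beta> (sgn z \<bullet> \<sigma>))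
          * indicator A (x + (norm z / 2) *\<^sub>R \<sigma>) \<partial>usphere) \<partial>lborel \<partial>lborel)"
      unfolding c_def using \<rho>
      by (subst nn_integral_gain_measure, simp, subst nn_integral_maxwell_pair) (simp_all add: rate vpr rel)
    also have "\<dots> = (\<integral>\<^sup>+x. \<integral>\<^sup>+z. \<integral>\<^sup>+\<sigma>. ennreal (\<beta> (sgn z \<bullet> \<sigma>)) * K x (norm z) \<sigma> \<partial>usphere \<partial>lborel \<partial>lborel)"
      unfolding K_def using c0
      by (subst nn_integral_cmult[symmetric]) (auto intro!: nn_integral_cong simp: ennreal_mult mult_ac)
    also have "\<dots> = (\<integral>\<^sup>+x. \<integral>\<^sup>+z. K x (norm z) (sgn z) \<partial>lborel \<partial>lborel)"
      by (rule nn_integral_cong, rule nn_integral_isotropic_scattering[OF K \<beta>_measurable \<beta>_normalised])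
    also have "\<dots> = (\<integral>\<^sup>+x. \<integral>\<^sup>+z. ennreal (c x (norm z)) * (ennreal (norm z powr \<gamma>) * indicator A (x + (1 / 2) *\<^sub>R z)) \<partial>lborel \<partial>lborel)"
      unfolding K_def geom by (simp add: ennreal_mult c0 mult.assoc)
    also have "\<dots> = (\<integral>\<^sup>+v. indicator A v \<partial>loss_measure)"
      unfolding c_def using \<rho>
      by (subst nn_integral_loss_measure, simp, subst nn_integral_maxwell_pair) (simp_all add: rate)
    also have "\<dots> = emeasure loss_measure A" by simp
    finally show "emeasure gain_measure A = emeasure loss_measure A" .
  qed simp
qed

section \<open>Positive and negative part of a difference of measures\<close>

text \<open>For \<open>\<mu> - \<nu> = p - n\<close>, written without subtraction.\<close>

lemma nn_integral_eq_of_emeasure_sum_eq: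
  fixes p n \<mu> \<nu> :: "('a::topological_space) measure"
  assumes sets [measurable_cong]: "sets p = sets borel" "sets n = sets borel" "sets \<mu> = sets borel" "sets \<nu> = sets borel"
    and eq: "\<And>A. A \<in> sets borel \<Longrightarrow> emeasure p A + emeasure \<nu> A = emeasure \<mu> A + emeasure n A"
    and f: "f \<in> borel_measurable borel"
  shows "(\<integral>\<^sup>+x. f x \<partial>p) + (\<integral>\<^sup>+x. f x \<partial>\<nu>) = (\<integral>\<^sup>+x. f x \<partial>\<mu>) + (\<integral>\<^sup>+x. f x \<partial>n)"
  using f
proof (induction rule: borel_measurable_induct)
  case (cong f g)
  then have "f = g" by auto
  then show ?case using cong by simp
next
  case (set A)
  then show ?case using eq sets by simp
next
  case (mult u c)
  then show ?case by (simp add: nn_integral_cmult flip: distrib_left)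
next
  case (add u v)
  have "(\<integral>\<^sup>+x. v x + u x \<partial>p) + (\<integral>\<^sup>+x. v x + u x \<partial>\<nu>)
      = ((\<integral>\<^sup>+x. u x \<partial>p) + (\<integral>\<^sup>+x. u x \<partial>\<nu>)) + ((\<integral>\<^sup>+x. v x \<partial>p) + (\<integral>\<^sup>+x. v x \<partial>\<nu>))"
    using add by (simp add: nn_integral_add ac_simps)
  also have "\<dots> = (\<integral>\<^sup>+x. v x + u x \<partial>\<mu>) + (\<integral>\<^sup>+x. v x + u x \<partial>n)"
    unfolding add.IH using add by (simp add: nn_integral_add ac_simps)
  finally show ?case .
next
  case (seq U)
  have U [measurable]: "\<And>i. U i \<in> borel_measurable borel" using seq by simp
  have inc: "incseq (\<lambda>i. \<integral>\<^sup>+x. U i x \<partial>M)" for M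
    using seq(3) by (auto simp: incseq_def le_fun_def intro!: nn_integral_mono)
  have sup: "(\<integral>\<^sup>+x. (SUP i. U i) x \<partial>M) = (SUP i. \<integral>\<^sup>+x. U i x \<partial>M)" if [measurable_cong]: "sets M = sets borel" for M
    using seq(3) by (simp add: image_comp nn_integral_monotone_convergence_SUP)
  show ?case
    unfolding sup[OF sets(1)] sup[OF sets(2)] sup[OF sets(3)] sup[OF sets(4)]
    by (simp add: ennreal_SUP_add[OF inc inc, symmetric] seq.IH)
qed

text \<open>For \<open>\<mu>, \<nu> \<ge> 0\<close> the positive part of \<open>\<mu> - \<nu>\<close> is at most \<open>\<mu>\<close> and the negative part at most \<open>\<nu>\<close>. With
  \<open>\<nu>\<close> the Maxwellian this is how its tail controls the distance to equilibrium.\<close>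

locale jordan_difference = \<mu>: finite_measure \<mu> + \<nu>: finite_measure \<nu>
  for \<mu> \<nu> :: "('a::euclidean_space) measure" +
  assumes sets_\<mu>: "sets \<mu> = sets borel" and sets_\<nu>: "sets \<nu> = sets borel"
begin

definition "H = of_measure \<mu> - of_measure \<nu>"
definition "p = pos_variation H"
definition "n = neg_variation H"

lemma sets_pn [simp, measurable_cong]: "sets p = sets borel" "sets n = sets borel"
  by (simp_all add: p_def n_def)

lemma space_pn [simp]: "space p = UNIV" "space n = UNIV"
  by (simp_all add: p_def n_def)

sublocale p: finite_measure p unfolding p_def by (rule finite_measure_pos_variation)
sublocale n: finite_measure n unfolding n_def by (rule finite_measure_neg_variation)

lemma smeas_H: "smeas H A = measure \<mu> A - measure \<nu> A"
  by (simp add: H_def smeas_of_measure sets_\<mu> sets_\<nu> \<mu>.finite_measure_axioms \<nu>.finite_measure_axioms)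

lemma measure_pn: "measure p A - measure n A = measure \<mu> A - measure \<nu> A"
  using jordan_decomposition[of H A] smeas_H[of A] by (simp add: p_def n_def)

lemma measure_p_le: "A \<in> sets borel \<Longrightarrow> measure p A \<le> measure \<mu> A"
  unfolding p_def
proof (rule measure_pos_variation_le)
  fix B assume B: "A \<in> sets borel" "B \<in> sets borel" "B \<subseteq> A"
  show "smeas H B \<le> measure \<mu> A"
  proof -
    have "measure \<mu> B \<le> measure \<mu> A" using B by (intro \<mu>.finite_measure_mono) (auto simp: sets_\<mu>)
    then show ?thesis unfolding smeas_H using measure_nonneg[of \<nu> B] by linarith
  qed
qed

lemma measure_n_le: "A \<in> sets borel \<Longrightarrow> measure n A \<le> measure \<nu> A"
proof -
  assume A: "A \<in> sets borel"
  show ?thesis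
    unfolding n_def neg_variation_def
  proof (rule measure_pos_variation_le[OF A])
    fix B assume B: "B \<in> sets borel" "B \<subseteq> A"
    show "smeas (- H) B \<le> measure \<nu> A"
    proof -
      have "measure \<nu> B \<le> measure \<nu> A" using A B by (intro \<nu>.finite_measure_mono) (auto simp: sets_\<nu>)
      then show ?thesis unfolding smeas_simps smeas_H using measure_nonneg[of \<mu> B] by linarith
    qed
  qed
qed

lemma le_measures: "p \<le> \<mu>" "n \<le> \<nu>"
  using measure_p_le measure_n_le
  by (simp_all add: le_measure sets_\<mu> sets_\<nu> p.emeasure_eq_measure n.emeasure_eq_measure
      \<mu>.emeasure_eq_measure \<nu>.emeasure_eq_measure)

lemma nn_integral_pn_le:
  "(\<integral>\<^sup>+x. f x \<partial>p) \<le> (\<integral>\<^sup>+x. f x \<partial>\<mu>)" "(\<integral>\<^sup>+x. f x \<partial>n) \<le> (\<integral>\<^sup>+x. f x \<partial>\<nu>)"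
  using le_measures by (auto intro!: nn_integral_mono_measure simp: sets_\<mu> sets_\<nu>)

lemma nn_integral_pn:
  assumes "f \<in> borel_measurable borel"
  shows "(\<integral>\<^sup>+x. f x \<partial>p) + (\<integral>\<^sup>+x. f x \<partial>\<nu>) = (\<integral>\<^sup>+x. f x \<partial>\<mu>) + (\<integral>\<^sup>+x. f x \<partial>n)"
proof (rule nn_integral_eq_of_emeasure_sum_eq[OF sets_pn sets_\<mu> sets_\<nu> _ assms])
  fix A :: "'a set"
  have "measure p A + measure \<nu> A = measure \<mu> A + measure n A" using measure_pn[of A] by simp
  then show "emeasure p A + emeasure \<nu> A = emeasure \<mu> A + emeasure n A"
    by (simp add: p.emeasure_eq_measure n.emeasure_eq_measure
        \<mu>.emeasure_eq_measure \<nu>.emeasure_eq_measure flip: ennreal_plus)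
qed

lemma integrable_pn:
  fixes f :: "'a \<Rightarrow> real"
  shows "integrable \<mu> f \<Longrightarrow> integrable p f" "integrable \<nu> f \<Longrightarrow> integrable n f"
  using nn_integral_pn_le[of "\<lambda>x. ennreal (norm (f x))"]
  by (auto simp: integrable_iff_bounded measurable_cong_sets[OF sets_\<mu> refl] measurable_cong_sets[OF sets_\<nu> refl]
      measurable_cong_sets[OF sets_pn(1) refl] measurable_cong_sets[OF sets_pn(2) refl] intro: le_less_trans)

lemma integral_pn_nonneg:
  fixes f :: "'a \<Rightarrow> real"
  assumes "integrable \<mu> f" "integrable \<nu> f" "\<And>x. 0 \<le> f x"
  shows "integral\<^sup>L p f - integral\<^sup>L n f = integral\<^sup>L \<mu> f - integral\<^sup>L \<nu> f"
proof -
  have f: "(\<lambda>x. ennreal (f x)) \<in> borel_measurable borel"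
    using borel_measurable_integrable[OF assms(1)] by (simp add: measurable_cong_sets[OF sets_\<mu> refl])
  have "ennreal (integral\<^sup>L p f) + ennreal (integral\<^sup>L \<nu> f) = ennreal (integral\<^sup>L \<mu> f) + ennreal (integral\<^sup>L n f)"
    using nn_integral_pn[OF f] assms by (simp add: nn_integral_eq_integral integrable_pn)
  then have "integral\<^sup>L p f + integral\<^sup>L \<nu> f = integral\<^sup>L \<mu> f + integral\<^sup>L n f"
    using assms(3) by (simp flip: ennreal_plus add: ennreal_inj)
  then show ?thesis by simp
qed

lemma integral_pn:
  fixes f :: "'a \<Rightarrow> real"
  assumes "integrable \<mu> f" "integrable \<nu> f"
  shows "integral\<^sup>L p f - integral\<^sup>L n f = integral\<^sup>L \<mu> f - integral\<^sup>L \<nu> f"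
proof -
  have i: "integrable M (\<lambda>x. max 0 (f x))" "integrable M (\<lambda>x. max 0 (- f x))" if "integrable M f" for M
    using that by auto
  have d: "integral\<^sup>L M f = integral\<^sup>L M (\<lambda>x. max 0 (f x)) - integral\<^sup>L M (\<lambda>x. max 0 (- f x))" if "integrable M f" for M
  proof -
    have "integral\<^sup>L M f = (\<integral>x. max 0 (f x) - max 0 (- f x) \<partial>M)"
      by (intro Bochner_Integration.integral_cong) auto
    then show ?thesis using Bochner_Integration.integral_diff[OF i[OF that]] by simp
  qed
  show ?thesis
    using integral_pn_nonneg[OF i(1)[OF assms(1)] i(1)[OF assms(2)]]
      integral_pn_nonneg[OF i(2)[OF assms(1)] i(2)[OF assms(2)]]
    by (simp add: d[OF assms(1)] d[OF assms(2)] d[OF integrable_pn(1)[OF assms(1)]] d[OF integrable_pn(2)[OF assms(2)]])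
qed

lemma abs_integral_diff_le:
  fixes f :: "'a \<Rightarrow> real"
  assumes "integrable \<mu> f" "integrable \<nu> f"
  shows "ennreal \<bar>integral\<^sup>L \<mu> f - integral\<^sup>L \<nu> f\<bar> \<le> (\<integral>\<^sup>+x. ennreal \<bar>f x\<bar> \<partial>p) + (\<integral>\<^sup>+x. ennreal \<bar>f x\<bar> \<partial>n)"
proof -
  have "\<bar>integral\<^sup>L \<mu> f - integral\<^sup>L \<nu> f\<bar> \<le> \<bar>integral\<^sup>L p f\<bar> + \<bar>integral\<^sup>L n f\<bar>"
    using integral_pn[OF assms] by linarith
  then have "ennreal \<bar>integral\<^sup>L \<mu> f - integral\<^sup>L \<nu> f\<bar> \<le> ennreal \<bar>integral\<^sup>L p f\<bar> + ennreal \<bar>integral\<^sup>L n f\<bar>"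
    by (simp flip: ennreal_plus add: ennreal_leI)
  also have "\<dots> \<le> (\<integral>\<^sup>+x. ennreal \<bar>f x\<bar> \<partial>p) + (\<integral>\<^sup>+x. ennreal \<bar>f x\<bar> \<partial>n)"
    using integral_norm_bound_ennreal[OF integrable_pn(1)[OF assms(1)]]
      integral_norm_bound_ennreal[OF integrable_pn(2)[OF assms(2)]]
    by (intro add_mono) simp_all
  finally show ?thesis .
qed

end

section \<open>The collision operator near a common equilibrium\<close>

context collision begin

text \<open>Jensen's inequality for the power \<open>\<gamma>/2\<close> of \<open>|v - w|\<^sup>2\<close>, with
  \<open>|v - w|\<^sup>2 \<le> 2 |v - u|\<^sup>2 + 2 |w - u|\<^sup>2\<close>.\<close>

lemma nn_integral_rate_sublinear:
  assumes \<rho>: "\<rho> > 0" and E: "E > 0"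
  shows "(\<integral>\<^sup>+v. ennreal (rate \<gamma> v w) \<partial>\<mu>) \<le> ennreal (\<rho> * (2 * ((norm (w - u))\<^sup>2 + E / \<rho>)) powr (\<gamma> / 2))"
proof -
  define s where "s = \<gamma> / 2"
  have s: "0 < s" "s \<le> 1" using \<gamma> by (auto simp: s_def)
  define a where "a = 2 * ((norm (w - u))\<^sup>2 + E / \<rho>)"
  have a: "a > 0" using \<rho> E by (auto simp: a_def intro!: add_nonneg_pos)
  have le: "rate \<gamma> v w \<le> a powr s * (1 - s) + s * a powr (s - 1) * (2 * ((norm (v - u))\<^sup>2 + (norm (w - u))\<^sup>2))" for v
  proof -
    have "rate \<gamma> v w \<le> a powr s * (1 - s) + s * a powr (s - 1) * (norm (v - w))\<^sup>2"
      unfolding rate_def powr_eq_power2_powr[of "v - w"] s_def[symmetric] using a s by (intro powr_le_tangent) auto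
    also have "\<dots> \<le> a powr s * (1 - s) + s * a powr (s - 1) * (2 * ((norm (v - u))\<^sup>2 + (norm (w - u))\<^sup>2))"
      using s by (intro add_left_mono mult_left_mono norm_diff_power2_le) auto
    finally show ?thesis .
  qed
  have c: "has_bochner_integral \<mu> (\<lambda>v. c) (c * \<rho>)" for c :: real
    using mass by (simp add: has_bochner_integral_iff mult.commute)
  have h: "has_bochner_integral \<mu> (\<lambda>v. a powr s * (1 - s) + s * a powr (s - 1) * (2 * ((norm (v - u))\<^sup>2 + (norm (w - u))\<^sup>2)))
      (a powr s * (1 - s) * \<rho> + s * a powr (s - 1) * (2 * (E + (norm (w - u))\<^sup>2 * \<rho>)))"
    by (intro has_bochner_integral_add has_bochner_integral_mult_right energy c)
  have "2 * (E + (norm (w - u))\<^sup>2 * \<rho>) = a * \<rho>" using \<rho> by (simp add: a_def field_simps)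
  moreover have "a powr (s - 1) * a = a powr s" using a by (simp add: mult.commute powr_mult_base)
  ultimately have val: "a powr s * (1 - s) * \<rho> + s * a powr (s - 1) * (2 * (E + (norm (w - u))\<^sup>2 * \<rho>)) = \<rho> * a powr s"
    by (simp add: mult.assoc[symmetric]) (simp add: mult.assoc algebra_simps)
  have "(\<integral>\<^sup>+v. ennreal (rate \<gamma> v w) \<partial>\<mu>) \<le> (\<integral>\<^sup>+v. ennreal (a powr s * (1 - s) + s * a powr (s - 1) * (2 * ((norm (v - u))\<^sup>2 + (norm (w - u))\<^sup>2))) \<partial>\<mu>)"
    by (intro nn_integral_mono ennreal_leI le)
  also have "\<dots> = ennreal (\<rho> * a powr s)"
    unfolding val[symmetric] has_bochner_integral_integral_eq[OF h, symmetric]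
    by (rule nn_integral_eq_integral[OF integrable.intros[OF h]]) (use le in \<open>auto intro!: AE_I2 order_trans[OF rate_nonneg]\<close>)
  finally show ?thesis by (simp add: a_def s_def)
qed

end

lemma rate_commute: "rate \<gamma> v w = rate \<gamma> w v"
  by (simp add: rate_def norm_minus_commute)

locale collision_pair = F: collision \<mu> u \<rho> E \<beta> \<gamma> + M: collision \<nu> u \<rho> E \<beta> \<gamma>
  for \<mu> \<nu> :: "('a::euclidean_space) measure" and u \<rho> E \<beta> \<gamma> +
  assumes \<rho>: "\<rho> > 0" and E: "E > 0"
begin

sublocale jordan_difference \<mu> \<nu>
  by unfold_locales simp_all

text \<open>The density of collisions between \<open>v\<close> and \<open>w\<close> that bring a particle into \<open>A\<close>, minus that of those
  that take one out of \<open>A\<close>.\<close>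

definition kern :: "'a set \<Rightarrow> 'a \<Rightarrow> 'a \<Rightarrow> real" where
  "kern A v w = gain \<beta> \<gamma> (indicator A) v w - rate \<gamma> v w * indicator A v"

text \<open>Up to the factor \<open>\<rho>\<close>, the bound of \<open>nn_integral_rate_sublinear\<close> for the integrated collision rate.\<close>

definition weight :: "'a \<Rightarrow> real" where
  "weight v = (2 * ((norm (v - u))\<^sup>2 + E / \<rho>)) powr (\<gamma> / 2)"

definition "weighted_variation = (\<integral>\<^sup>+v. ennreal (weight v) \<partial>p) + (\<integral>\<^sup>+v. ennreal (weight v) \<partial>n)"

lemma weight_measurable [measurable]: "weight \<in> borel_measurable borel"
  unfolding weight_def by measurable

lemma weight_nonneg [simp]: "0 \<le> weight v" by (simp add: weight_def)

lemma kern_measurable [measurable (raw)]: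
  assumes [measurable]: "A \<in> sets borel" "f \<in> borel_measurable N" "g \<in> borel_measurable N"
  shows "(\<lambda>x. kern A (f x) (g x)) \<in> borel_measurable N"
  unfolding kern_def by measurable

text \<open>Gain and loss both lie between 0 and the rate, so their difference does not exceed the rate.\<close>

lemma abs_kern_le: "A \<in> sets borel \<Longrightarrow> \<bar>kern A v w\<bar> \<le> rate \<gamma> v w"
  using F.gain_indicator_bounds[of A v w] by (auto simp: kern_def indicator_def abs_le_iff)

lemma integrable_kern:
  assumes [measurable]: "A \<in> sets borel"
  shows "integrable \<mu> (\<lambda>v. kern A v w)" "integrable \<nu> (\<lambda>v. kern A v w)"
  by (rule Bochner_Integration.integrable_bound[OF F.integrable_rate[of w]], simp, simp add: abs_kern_le)
     (rule Bochner_Integration.integrable_bound[OF M.integrable_rate[of w]], simp, simp add: abs_kern_le)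

lemma smeas_Qcoll:
  assumes [measurable]: "A \<in> sets borel"
    and b: "\<And>x. x \<in> {-1..1} \<Longrightarrow> b x = \<beta> x" and A0: "A0 DIM('a) b = 1"
    and "N = \<mu> \<or> N = \<nu>"
  shows "smeas (Qcoll b \<gamma> (of_measure N) (of_measure N)) A = (\<integral>w. \<integral>v. kern A v w \<partial>N \<partial>N)"
proof -
  have "collision N u \<rho> E \<beta> \<gamma>"
    using assms(4) F.collision_axioms M.collision_axioms by auto
  then interpret N: collision N u \<rho> E \<beta> \<gamma> .
  have bi: "\<bar>indicator A v :: real\<bar> \<le> 1" for v :: 'a by (simp add: indicator_def)
  have i: "integrable N (\<lambda>v. gain \<beta> \<gamma> (indicator A) v w)" "integrable N (\<lambda>v. rate \<gamma> v w * indicator A v)" for w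
    using N.integrable_rate_mult[of A w] by auto
  have iw: "integrable N (\<lambda>w. 1 + 2 * ((norm (v - u))\<^sup>2 + (norm (w - u))\<^sup>2))" for v
    by (intro Bochner_Integration.integrable_add integrable_mult_right N.energy_integrable) auto
  have ir: "integrable N (\<lambda>w. \<integral>v. f v w \<partial>N)" if f: "\<And>v w. 0 \<le> f v w" "\<And>v w. f v w \<le> rate \<gamma> v w"
    and m: "case_prod f \<in> borel_measurable (borel \<Otimes>\<^sub>M borel)" for f
  proof (rule integrableI_bounded)
    have m1 [measurable]: "(\<lambda>x. f (snd x) (fst x)) \<in> borel_measurable (N \<Otimes>\<^sub>M N)"
      using measurable_compose[OF measurable_Pair[OF measurable_snd measurable_fst] m] by simp
    have m2 [measurable]: "(\<lambda>v. f v w) \<in> borel_measurable N" for w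
      using measurable_compose[OF measurable_Pair[OF measurable_ident_sets[OF N.sets_eq] measurable_const] m] by simp
    show "(\<lambda>w. \<integral>v. f v w \<partial>N) \<in> borel_measurable N"
      by (rule N.borel_measurable_lebesgue_integral) (simp add: case_prod_beta)
    have "integrable N (\<lambda>v. f v w)" for w
      by (rule Bochner_Integration.integrable_bound[OF N.integrable_rate[of w]]) (use f in auto)
    then have "(\<integral>\<^sup>+w. ennreal (norm (\<integral>v. f v w \<partial>N)) \<partial>N) = (\<integral>\<^sup>+w. \<integral>\<^sup>+v. ennreal (f v w) \<partial>N \<partial>N)"
      using f(1) by (intro nn_integral_cong) (simp add: nn_integral_eq_integral)
    also have "\<dots> \<le> (\<integral>\<^sup>+w. \<integral>\<^sup>+v. ennreal (rate \<gamma> v w) \<partial>N \<partial>N)"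
      using f(2) by (intro nn_integral_mono ennreal_leI) auto
    also have "\<dots> < \<infinity>" by (rule N.nn_integral_rate_finite)
    finally show "(\<integral>\<^sup>+w. ennreal (norm (\<integral>v. f v w \<partial>N)) \<partial>N) < \<infinity>" .
  qed
  have Q: "Qcoll b \<gamma> (of_measure N) (of_measure N) = of_measure N.gain_measure - of_measure N.loss_measure"
    by (rule N.Qcoll_eq) (use b A0 in auto)
  have "smeas (Qcoll b \<gamma> (of_measure N) (of_measure N)) A = measure N.gain_measure A - measure N.loss_measure A"
    by (simp add: Q smeas_of_measure N.finite_gain_loss)
  also have "\<dots> = (\<integral>x. indicator A x \<partial>N.gain_measure) - (\<integral>x. indicator A x \<partial>N.loss_measure)"
    by simp
  also have "\<dots> = (\<integral>w. \<integral>v. gain \<beta> \<gamma> (indicator A) v w \<partial>N \<partial>N) - (\<integral>w. \<integral>v. rate \<gamma> v w * indicator A v \<partial>N \<partial>N)"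
    by (subst N.integral_gain_measure[OF _ bi], simp, subst N.integral_loss_measure[OF _ bi]) simp_all
  also have "\<dots> = (\<integral>w. (\<integral>v. gain \<beta> \<gamma> (indicator A) v w \<partial>N) - (\<integral>v. rate \<gamma> v w * indicator A v \<partial>N) \<partial>N)"
  proof (rule Bochner_Integration.integral_diff[symmetric])
    show "integrable N (\<lambda>w. \<integral>v. gain \<beta> \<gamma> (indicator A) v w \<partial>N)"
      by (rule ir) (use N.gain_indicator_bounds[of A] in \<open>auto simp: case_prod_beta\<close>)
    show "integrable N (\<lambda>w. \<integral>v. rate \<gamma> v w * indicator A v \<partial>N)"
      by (rule ir) (auto simp: case_prod_beta indicator_def)
  qed
  also have "\<dots> = (\<integral>w. \<integral>v. kern A v w \<partial>N \<partial>N)"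
    unfolding kern_def by (intro Bochner_Integration.integral_cong refl) (simp add: i)
  finally show ?thesis .
qed

text \<open>Change one factor at a time: \<open>\<mu> \<otimes> \<mu> - \<nu> \<otimes> \<nu> = (\<mu> - \<nu>) \<otimes> \<mu> + \<nu> \<otimes> (\<mu> - \<nu>)\<close>. In either term the
  remaining factor integrates the rate to at most \<open>\<rho>\<close> times the weight.\<close>

lemma kern_integral_diff_le:
  assumes A [measurable]: "A \<in> sets borel"
  shows "ennreal \<bar>(\<integral>w. \<integral>v. kern A v w \<partial>\<mu> \<partial>\<mu>) - (\<integral>w. \<integral>v. kern A v w \<partial>\<nu> \<partial>\<nu>)\<bar> \<le> ennreal (2 * \<rho>) * weighted_variation"
proof -
  have rateF: "(\<integral>\<^sup>+v. ennreal (rate \<gamma> v w) \<partial>\<mu>) \<le> ennreal (\<rho> * weight w)"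
    and rateM: "(\<integral>\<^sup>+v. ennreal (rate \<gamma> v w) \<partial>\<nu>) \<le> ennreal (\<rho> * weight w)" for w
    unfolding weight_def by (rule F.nn_integral_rate_sublinear[OF \<rho> E] M.nn_integral_rate_sublinear[OF \<rho> E])+
  define a1 where "a1 w = (\<integral>v. kern A v w \<partial>\<mu>)" for w
  define a2 where "a2 w = (\<integral>v. kern A v w \<partial>\<nu>)" for w
  have [measurable]: "a1 \<in> borel_measurable borel" "a2 \<in> borel_measurable borel"
    unfolding a1_def a2_def by measurable
  have norm_le: "ennreal \<bar>\<integral>v. kern A v w \<partial>N\<bar> \<le> ennreal (\<rho> * weight w)"
    if "integrable N (\<lambda>v. kern A v w)" "(\<integral>\<^sup>+v. ennreal (rate \<gamma> v w) \<partial>N) \<le> ennreal (\<rho> * weight w)" for N w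
  proof -
    have "ennreal \<bar>\<integral>v. kern A v w \<partial>N\<bar> \<le> (\<integral>\<^sup>+v. ennreal \<bar>kern A v w\<bar> \<partial>N)"
      using integral_norm_bound_ennreal[OF that(1)] by simp
    also have "\<dots> \<le> (\<integral>\<^sup>+v. ennreal (rate \<gamma> v w) \<partial>N)"
      by (intro nn_integral_mono ennreal_leI abs_kern_le A)
    finally show ?thesis using that(2) by (rule order_trans)
  qed
  have norm_a1: "ennreal \<bar>a1 w\<bar> \<le> ennreal (\<rho> * weight w)" for w
    unfolding a1_def by (rule norm_le[OF integrable_kern(1)[OF A] rateF])
  have norm_a2: "ennreal \<bar>a2 w\<bar> \<le> ennreal (\<rho> * weight w)" for w
    unfolding a2_def by (rule norm_le[OF integrable_kern(2)[OF A] rateM])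
  have weight_le: "weight v \<le> 1 + 2 * ((norm (v - u))\<^sup>2 + E / \<rho>)" for v
  proof -
    define x where "x = 2 * ((norm (v - u))\<^sup>2 + E / \<rho>)"
    have x: "0 \<le> x" using \<rho> E by (simp add: x_def)
    have "weight v \<le> 1 powr (\<gamma> / 2) * (1 - \<gamma> / 2) + \<gamma> / 2 * 1 powr (\<gamma> / 2 - 1) * x"
      unfolding weight_def x_def[symmetric] using F.\<gamma> x by (intro powr_le_tangent) auto
    moreover have "\<gamma> / 2 * x \<le> x" using mult_right_mono[of "\<gamma> / 2" 1 x] F.\<gamma> x by simp
    ultimately show ?thesis unfolding x_def[symmetric] powr_one_eq_one mult_1_right mult_1_left using F.\<gamma> by linarith
  qed
  have iw: "integrable N (\<lambda>w. \<rho> * weight w)" if "N = \<mu> \<or> N = \<nu>" for N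
  proof (rule integrable_mult_right, rule Bochner_Integration.integrable_bound)
    show "integrable N (\<lambda>v. 1 + 2 * ((norm (v - u))\<^sup>2 + E / \<rho>))"
      using that by (auto intro!: Bochner_Integration.integrable_add integrable_mult_right)
    show "AE v in N. norm (weight v) \<le> norm (1 + 2 * ((norm (v - u))\<^sup>2 + E / \<rho>))"
      unfolding real_norm_def abs_of_nonneg[OF weight_nonneg] by (intro AE_I2 order_trans[OF weight_le abs_ge_self])
    show "weight \<in> borel_measurable N" using that by auto
  qed
  have ia: "integrable \<mu> a1" "integrable \<mu> a2" "integrable \<nu> a2"
  proof -
    have le: "norm (a1 w) \<le> norm (\<rho> * weight w)" "norm (a2 w) \<le> norm (\<rho> * weight w)" for w
      using norm_a1[of w] norm_a2[of w] \<rho> by (auto simp: ennreal_le_iff)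
    show "integrable \<mu> a1"
      by (rule Bochner_Integration.integrable_bound[OF iw[of \<mu>]], simp, measurable, rule AE_I2, rule le)
    show "integrable \<mu> a2"
      by (rule Bochner_Integration.integrable_bound[OF iw[of \<mu>]], simp, measurable, rule AE_I2, rule le)
    show "integrable \<nu> a2"
      by (rule Bochner_Integration.integrable_bound[OF iw[of \<nu>]], simp, measurable, rule AE_I2, rule le)
  qed
  have 1: "ennreal \<bar>integral\<^sup>L \<mu> a2 - integral\<^sup>L \<nu> a2\<bar> \<le> ennreal \<rho> * weighted_variation"
  proof -
    have "ennreal \<bar>integral\<^sup>L \<mu> a2 - integral\<^sup>L \<nu> a2\<bar> \<le> (\<integral>\<^sup>+x. ennreal \<bar>a2 x\<bar> \<partial>p) + (\<integral>\<^sup>+x. ennreal \<bar>a2 x\<bar> \<partial>n)"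
      by (rule abs_integral_diff_le[OF ia(2,3)])
    also have "\<dots> \<le> (\<integral>\<^sup>+x. ennreal (\<rho> * weight x) \<partial>p) + (\<integral>\<^sup>+x. ennreal (\<rho> * weight x) \<partial>n)"
      by (intro add_mono nn_integral_mono norm_a2)
    also have "\<dots> = ennreal \<rho> * weighted_variation"
      using \<rho> by (simp add: weighted_variation_def ennreal_mult nn_integral_cmult distrib_left)
    finally show ?thesis .
  qed
  \<comment> \<open>Tonelli moves the integral against \<open>\<mu>\<close> inside, where the rate is controlled by the weight.\<close>
  have swap: "(\<integral>\<^sup>+w. \<integral>\<^sup>+v. ennreal (rate \<gamma> v w) \<partial>N \<partial>\<mu>) \<le> ennreal \<rho> * (\<integral>\<^sup>+v. ennreal (weight v) \<partial>N)"
    if N: "finite_measure N" and [measurable_cong]: "sets N = sets borel" for N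
  proof -
    interpret N: finite_measure N by fact
    interpret P: pair_sigma_finite N \<mu> ..
    have "(\<integral>\<^sup>+w. \<integral>\<^sup>+v. ennreal (rate \<gamma> v w) \<partial>N \<partial>\<mu>) = (\<integral>\<^sup>+v. \<integral>\<^sup>+w. ennreal (rate \<gamma> v w) \<partial>\<mu> \<partial>N)"
      by (rule P.Fubini') measurable
    also have "\<dots> \<le> (\<integral>\<^sup>+v. ennreal (\<rho> * weight v) \<partial>N)"
      by (intro nn_integral_mono) (subst rate_commute, rule rateF)
    also have "\<dots> = ennreal \<rho> * (\<integral>\<^sup>+v. ennreal (weight v) \<partial>N)"
      using \<rho> by (simp add: ennreal_mult nn_integral_cmult)
    finally show ?thesis .
  qed
  have 2: "ennreal \<bar>integral\<^sup>L \<mu> a1 - integral\<^sup>L \<mu> a2\<bar> \<le> ennreal \<rho> * weighted_variation"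
  proof -
    have "ennreal \<bar>integral\<^sup>L \<mu> a1 - integral\<^sup>L \<mu> a2\<bar> = ennreal \<bar>\<integral>w. a1 w - a2 w \<partial>\<mu>\<bar>"
      by (simp add: ia)
    also have "\<dots> \<le> (\<integral>\<^sup>+w. ennreal \<bar>a1 w - a2 w\<bar> \<partial>\<mu>)"
      using integral_norm_bound_ennreal[of \<mu> "\<lambda>w. a1 w - a2 w"] ia by simp
    also have "\<dots> \<le> (\<integral>\<^sup>+w. (\<integral>\<^sup>+v. ennreal (rate \<gamma> v w) \<partial>p) + (\<integral>\<^sup>+v. ennreal (rate \<gamma> v w) \<partial>n) \<partial>\<mu>)"
    proof (rule nn_integral_mono)
      fix w
      have "ennreal \<bar>a1 w - a2 w\<bar> \<le> (\<integral>\<^sup>+v. ennreal \<bar>kern A v w\<bar> \<partial>p) + (\<integral>\<^sup>+v. ennreal \<bar>kern A v w\<bar> \<partial>n)"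
        unfolding a1_def a2_def by (rule abs_integral_diff_le[OF integrable_kern[OF A]])
      also have "\<dots> \<le> (\<integral>\<^sup>+v. ennreal (rate \<gamma> v w) \<partial>p) + (\<integral>\<^sup>+v. ennreal (rate \<gamma> v w) \<partial>n)"
        by (intro add_mono nn_integral_mono ennreal_leI abs_kern_le A)
      finally show "ennreal \<bar>a1 w - a2 w\<bar> \<le> (\<integral>\<^sup>+v. ennreal (rate \<gamma> v w) \<partial>p) + (\<integral>\<^sup>+v. ennreal (rate \<gamma> v w) \<partial>n)" .
    qed
    also have "\<dots> = (\<integral>\<^sup>+w. \<integral>\<^sup>+v. ennreal (rate \<gamma> v w) \<partial>p \<partial>\<mu>) + (\<integral>\<^sup>+w. \<integral>\<^sup>+v. ennreal (rate \<gamma> v w) \<partial>n \<partial>\<mu>)"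
      by (rule nn_integral_add) measurable
    also have "\<dots> \<le> ennreal \<rho> * weighted_variation"
      unfolding weighted_variation_def distrib_left by (intro add_mono swap p.finite_measure_axioms n.finite_measure_axioms sets_pn)
    finally show ?thesis .
  qed
  have "ennreal \<bar>integral\<^sup>L \<mu> a1 - integral\<^sup>L \<nu> a2\<bar>
      \<le> ennreal (\<bar>integral\<^sup>L \<mu> a1 - integral\<^sup>L \<mu> a2\<bar> + \<bar>integral\<^sup>L \<mu> a2 - integral\<^sup>L \<nu> a2\<bar>)"
    by (rule ennreal_leI) linarith
  also have "\<dots> \<le> ennreal \<rho> * weighted_variation + ennreal \<rho> * weighted_variation"
    using 1 2 by (simp add: add_mono)
  also have "\<dots> = ennreal (2 * \<rho>) * weighted_variation"
  proof -
    have "ennreal (2 * \<rho>) = ennreal \<rho> + ennreal \<rho>"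
      unfolding mult_2 using \<rho> by (intro ennreal_plus) simp_all
    then show ?thesis by (simp only: distrib_right)
  qed
  finally show ?thesis by (simp add: a1_def[abs_def] a2_def[abs_def])
qed

end

text \<open>Let \<open>p\<close> and \<open>n\<close> be the parts of the difference and \<open>m = y/2\<close> their common mass. As \<open>n\<close> is below the
  Maxwellian, integrating \<open>X/(4T) \<le> \<Lambda> - 1 + exp (X/(4T) - \<Lambda>)\<close> bounds its energy by \<open>4 T \<Lambda> m\<close> for the
  \<open>\<Lambda>\<close> that gives the exponential term the integral \<open>m\<close> against the Maxwellian; and \<open>p\<close> has the same
  energy. The tangent of the concave power at \<open>a = 8 N T L\<close> transfers this to the weight of
  \<open>kern_integral_diff_le\<close>.\<close>

lemma collision_norm_bound:
  fixes u :: "'a::euclidean_space" and \<mu> :: "'a measure"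
  assumes N: "DIM('a) \<ge> 2" and T: "T > 0" and \<rho>0: "\<rho> > 0"
    and F: "collision \<mu> u \<rho> (real DIM('a) * \<rho> * T) \<beta> \<gamma>"
    and M: "collision (maxwell_measure \<rho> u T) u \<rho> (real DIM('a) * \<rho> * T) \<beta> \<gamma>"
    and b: "\<And>x. x \<in> {-1..1} \<Longrightarrow> b x = \<beta> x" and A0: "A0 DIM('a) b = 1"
  defines "y \<equiv> mnorm 0 (of_measure \<mu> - maxwellian \<rho> u T)"
  shows "y \<le> 2 * \<rho>"
    and "y > 0 \<Longrightarrow> mnorm 0 (Qcoll b \<gamma> (of_measure \<mu>) (of_measure \<mu>))
      \<le> 2 ^ 6 * (real DIM('a) + 1)\<^sup>2 * \<rho> * T powr (\<gamma> / 2) * (y * ln (4 * \<rho> / y) powr (\<gamma> / 2))"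
proof -
  define d where "d = real DIM('a)"
  have d: "d \<ge> 2" using N by (simp add: d_def)
  define \<nu> where "\<nu> = maxwell_measure \<rho> u T"
  interpret F: collision \<mu> u \<rho> "d * \<rho> * T" \<beta> \<gamma> using F by (simp add: d_def)
  interpret M: collision \<nu> u \<rho> "d * \<rho> * T" \<beta> \<gamma> using M by (simp add: d_def \<nu>_def)
  interpret P: collision_pair \<mu> \<nu> u \<rho> "d * \<rho> * T" \<beta> \<gamma>
    using \<rho>0 T d by unfold_locales auto
  define m where "m = measure P.n UNIV"
  have mp: "measure P.p UNIV = m"
    using P.measure_pn[of UNIV] F.mass M.mass by (simp add: m_def)
  have y: "y = 2 * m"
  proof -
    have "of_measure \<mu> - maxwellian \<rho> u T = P.H"
      unfolding maxwellian_eq \<nu>_def[symmetric] P.H_def ..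
    then have "y = measure P.p UNIV + measure P.n UNIV"
      unfolding y_def mnorm_0 P.p_def P.n_def by simp
    then show ?thesis using mp by (simp add: m_def)
  qed
  have m\<rho>: "m \<le> \<rho>" using P.measure_n_le[of UNIV] M.mass by (simp add: m_def)
  then show "y \<le> 2 * \<rho>" by (simp add: y)
  assume "y > 0"
  then have m: "m > 0" by (simp add: y)
  define s where "s = \<gamma> / 2"
  have s: "0 < s" "s \<le> 1" using F.\<gamma> by (auto simp: s_def)
  define L where "L = ln (4 * \<rho> / y)"
  have L_eq: "L = ln 2 + ln (\<rho> / m)"
  proof -
    have "4 * \<rho> / y = 2 * (\<rho> / m)" using m by (simp add: y)
    then have "L = ln (2 * (\<rho> / m))" by (simp only: L_def)
    also have "\<dots> = ln 2 + ln (\<rho> / m)" using m \<rho>0 by (intro ln_mult_pos) auto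
    finally show ?thesis .
  qed
  have l0: "ln (\<rho> / m) \<ge> 0" using m m\<rho> by simp
  \<comment> \<open>\<open>y \<le> 2 \<rho>\<close> keeps \<open>L\<close> above \<open>ln 2\<close>, so that constants can be absorbed into \<open>L\<close>.\<close>
  have ln2: "1 \<le> 2 * ln (2::real)" using ln2_ge_two_thirds by simp
  have L: "1 \<le> 2 * L" using L_eq l0 ln2 by simp
  define X where "X v = (norm (v - u))\<^sup>2" for v
  \<comment> \<open>The value for which the exponential moment of the Maxwellian times \<open>exp (- \<Lambda>)\<close> equals \<open>m\<close>.\<close>
  define \<Lambda> where "\<Lambda> = ln (\<rho> * 2 powr (d / 2) / m)"
  have "\<Lambda> = ln (\<rho> / m) + d / 2 * ln 2"
    using m \<rho>0 by (simp add: \<Lambda>_def ln_div ln_mult ln_powr)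
  also have "\<dots> \<le> d / 2 * ln (\<rho> / m) + d / 2 * ln 2"
    using mult_right_mono[of 1 "d / 2" "ln (\<rho> / m)"] l0 d by simp
  finally have \<Lambda>_le: "\<Lambda> \<le> d / 2 * L" by (simp add: L_eq algebra_simps)
  have e\<Lambda>: "exp (- \<Lambda>) * (\<rho> * 2 powr (d / 2)) = m"
    using m \<rho>0 by (simp add: \<Lambda>_def exp_minus)
  have iX: "integrable P.p X" "integrable P.n X"
    unfolding X_def by (rule P.integrable_pn, simp)+
  define R where "R = integral\<^sup>L P.n X"
  have R: "integral\<^sup>L P.p X = R"
    using P.integral_pn[of X] F.energy M.energy
    by (simp add: X_def[abs_def] R_def has_bochner_integral_iff)
  let ?e = "\<lambda>v. exp (X v / (4 * T))"
  have exp_int: "integrable \<nu> ?e" "integral\<^sup>L \<nu> ?e = \<rho> * 2 powr (d / 2)"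
    using maxwell_exponential_moment[OF \<rho>0 T, of u] by (simp_all add: has_bochner_integral_iff X_def \<nu>_def d_def)
  have exp_n: "integral\<^sup>L P.n ?e \<le> \<rho> * 2 powr (d / 2)"
  proof -
    have "ennreal (integral\<^sup>L P.n ?e) \<le> ennreal (integral\<^sup>L \<nu> ?e)"
      using P.nn_integral_pn_le(2)[of "\<lambda>v. ennreal (exp (X v / (4 * T)))"] exp_int(1) P.integrable_pn(2)[OF exp_int(1)]
      by (simp add: nn_integral_eq_integral)
    then show ?thesis using \<rho>0 by (simp add: exp_int(2) ennreal_le_iff)
  qed
  have "R \<le> (\<integral>v. 4 * T * ((\<Lambda> - 1) + exp (- \<Lambda>) * exp (X v / (4 * T))) \<partial>P.n)"
    unfolding R_def
  proof (rule integral_mono)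
    show "integrable P.n (\<lambda>v. 4 * T * ((\<Lambda> - 1) + exp (- \<Lambda>) * exp (X v / (4 * T))))"
      by (intro integrable_mult_right Bochner_Integration.integrable_add P.integrable_pn(2)[OF exp_int(1)]) simp
    fix v
    have "1 + (X v / (4 * T) - \<Lambda>) \<le> exp (X v / (4 * T) - \<Lambda>)" by (rule exp_ge_add_one_self)
    also have "\<dots> = exp (- \<Lambda>) * exp (X v / (4 * T))" by (simp flip: exp_add)
    finally have "X v / (4 * T) \<le> (\<Lambda> - 1) + exp (- \<Lambda>) * exp (X v / (4 * T))" by simp
    then show "X v \<le> 4 * T * ((\<Lambda> - 1) + exp (- \<Lambda>) * exp (X v / (4 * T)))"
      using T by (simp add: pos_divide_le_eq mult.commute)
  qed (rule iX)
  also have "\<dots> = 4 * T * ((\<Lambda> - 1) * m + exp (- \<Lambda>) * integral\<^sup>L P.n ?e)"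
    using P.integrable_pn(2)[OF exp_int(1)] by (simp add: m_def)
  also have "\<dots> \<le> 4 * T * ((\<Lambda> - 1) * m + exp (- \<Lambda>) * (\<rho> * 2 powr (d / 2)))"
    using T exp_n by (intro mult_left_mono add_left_mono) auto
  also have "\<dots> = 4 * T * \<Lambda> * m" unfolding e\<Lambda> by (simp add: algebra_simps)
  also have "\<dots> \<le> 4 * T * (d / 2 * L) * m"
    using \<Lambda>_le T m by (intro mult_right_mono mult_left_mono) auto
  finally have R_le: "R \<le> 2 * d * T * L * m" by (simp add: algebra_simps)
  \<comment> \<open>An upper bound for the mean of \<open>2 (X + d T)\<close> under the total variation of the difference.\<close>
  define a where "a = 8 * d * T * L"
  have a: "a > 0" using d T L by (simp add: a_def)
  have Ra: "R + d * T * m \<le> a * m / 2"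
  proof -
    have "d * T * m * 1 \<le> d * T * m * (2 * L)"
      using d T m L by (intro mult_left_mono) auto
    then show ?thesis using R_le by (simp add: a_def algebra_simps)
  qed
  define g where "g v = a powr s * (1 - s) + s * a powr (s - 1) * (2 * (X v + d * T))" for v
  have wg: "P.weight v \<le> g v" for v
    unfolding P.weight_def g_def X_def s_def[symmetric] using \<rho>0 s a d T by (auto intro!: powr_le_tangent)
  have g0: "0 \<le> g v" for v using wg[of v] P.weight_nonneg[of v] by linarith
  have Jpart: "(\<integral>\<^sup>+v. ennreal (P.weight v) \<partial>N) \<le> ennreal (a powr s * m)"
    if N: "finite_measure N" "integrable N X" "integral\<^sup>L N X = R" "measure N UNIV = m" "space N = UNIV" for N
  proof -
    interpret N: finite_measure N by fact
    have g: "has_bochner_integral N g (a powr s * (1 - s) * m + s * a powr (s - 1) * (2 * (R + d * T * m)))"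
    proof -
      have c: "has_bochner_integral N (\<lambda>v. c) (c * m)" for c :: real
        using N(4,5) by (simp add: has_bochner_integral_iff mult.commute)
      have "has_bochner_integral N X R" using N(2,3) by (simp add: has_bochner_integral_iff)
      then show ?thesis unfolding g_def
        by (intro has_bochner_integral_add has_bochner_integral_mult_right c)
    qed
    have "s * a powr (s - 1) * (2 * (R + d * T * m)) \<le> s * a powr (s - 1) * (a * m)"
      using Ra s by (intro mult_left_mono) auto
    also have "\<dots> = s * (a powr s) * m" using a by (simp add: powr_mult_base[symmetric] powr_diff)
    finally have le: "a powr s * (1 - s) * m + s * a powr (s - 1) * (2 * (R + d * T * m)) \<le> a powr s * m"
      by (simp add: algebra_simps)
    have "(\<integral>\<^sup>+v. ennreal (P.weight v) \<partial>N) \<le> (\<integral>\<^sup>+v. ennreal (g v) \<partial>N)"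
      by (intro nn_integral_mono ennreal_leI wg)
    also have "\<dots> = ennreal (integral\<^sup>L N g)"
      by (rule nn_integral_eq_integral[OF integrable.intros[OF g]]) (simp add: g0)
    also have "\<dots> \<le> ennreal (a powr s * m)"
      unfolding has_bochner_integral_integral_eq[OF g] by (rule ennreal_leI[OF le])
    finally show ?thesis .
  qed
  have "P.weighted_variation \<le> ennreal (a powr s * m) + ennreal (a powr s * m)"
    unfolding P.weighted_variation_def
    by (intro add_mono Jpart P.p.finite_measure_axioms P.n.finite_measure_axioms iX R)
       (simp_all add: mp m_def R_def)
  also have "\<dots> = ennreal (a powr s * y)" using m by (simp add: y flip: ennreal_plus)
  finally have J: "P.weighted_variation \<le> ennreal (a powr s * y)" .
  let ?Q = "Qcoll b \<gamma> (of_measure \<mu>) (of_measure \<mu>)"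
  let ?QM = "Qcoll b \<gamma> (of_measure \<nu>) (of_measure \<nu>)"
  have zero: "(\<integral>w. \<integral>v. P.kern A v w \<partial>\<nu> \<partial>\<nu>) = 0" if A: "A \<in> sets borel" for A
  proof -
    have "?QM = of_measure M.gain_measure - of_measure M.loss_measure"
      by (rule M.Qcoll_eq) (use b A0 in auto)
    also have "\<dots> = 0"
      using maxwell_gain_eq_loss[OF \<rho>0 M] by (simp add: \<nu>_def)
    finally have "smeas (?QM) A = 0" by simp
    moreover have "smeas (?QM) A = (\<integral>w. \<integral>v. P.kern A v w \<partial>\<nu> \<partial>\<nu>)"
      by (rule P.smeas_Qcoll[OF A]) (use b A0 in auto)
    ultimately show ?thesis by simp
  qed
  have "mnorm 0 ?Q \<le> 2 * (2 * \<rho> * (a powr s * y))"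
  proof (rule mnorm_0_le)
    fix A :: "'a set" assume A: "A \<in> sets borel"
    have "smeas ?Q A = (\<integral>w. \<integral>v. P.kern A v w \<partial>\<mu> \<partial>\<mu>)"
      by (rule P.smeas_Qcoll[OF A]) (use b A0 in auto)
    then have "ennreal \<bar>smeas ?Q A\<bar> \<le> ennreal (2 * \<rho>) * P.weighted_variation"
      using P.kern_integral_diff_le[OF A] by (simp add: zero[OF A])
    also have "\<dots> \<le> ennreal (2 * \<rho>) * ennreal (a powr s * y)" by (intro mult_left_mono J) simp
    also have "\<dots> = ennreal (2 * \<rho> * (a powr s * y))"
      using \<rho>0 \<open>y > 0\<close> by (intro ennreal_mult[symmetric]) auto
    finally show "\<bar>smeas ?Q A\<bar> \<le> 2 * \<rho> * (a powr s * y)"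
      using \<rho>0 \<open>y > 0\<close> by (simp add: ennreal_le_iff)
  qed
  also have "a powr s = (8 * d) powr s * (T powr s * L powr s)"
    using d T L by (simp add: a_def powr_mult)
  also have "2 * (2 * \<rho> * ((8 * d) powr s * (T powr s * L powr s) * y)) = (8 * d) powr s * (4 * \<rho> * (T powr s * (L powr s * y)))"
    by (simp add: algebra_simps)
  also have "\<dots> \<le> (8 * d) * (4 * \<rho> * (T powr s * (L powr s * y)))"
  proof (rule mult_right_mono)
    show "(8 * d) powr s \<le> 8 * d" using powr_mono[of s 1 "8 * d"] s d by simp
  qed (use \<rho>0 \<open>y > 0\<close> in auto)
  also have "\<dots> \<le> (2 ^ 4 * (d + 1)\<^sup>2) * (4 * \<rho> * (T powr s * (L powr s * y)))"
    using d \<rho>0 \<open>y > 0\<close> by (intro mult_right_mono) (auto simp: power2_eq_square algebra_simps intro!: add_nonneg_nonneg)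
  also have "\<dots> = 2 ^ 6 * (d + 1)\<^sup>2 * \<rho> * T powr s * (y * L powr s)"
    by (simp add: algebra_simps)
  finally show "mnorm 0 ?Q
      \<le> 2 ^ 6 * (real DIM('a) + 1)\<^sup>2 * \<rho> * T powr (\<gamma> / 2) * (y * ln (4 * \<rho> / y) powr (\<gamma> / 2))"
    by (simp add: d_def s_def L_def)
qed

section \<open>One-sided differential inequalities\<close>

text \<open>With any slack \<open>\<epsilon>\<close>, the last time at which the bound holds must be \<open>b\<close>, since from an earlier one
  the slope condition carries the bound a little further.\<close>

lemma increment_le_of_right_slope:
  fixes g :: "real \<Rightarrow> real"
  assumes ab: "a \<le> b" and cont: "continuous_on {a..b} g"
    and slope: "\<And>t \<epsilon>. a \<le> t \<Longrightarrow> t < b \<Longrightarrow> \<epsilon> > 0 \<Longrightarrow> \<forall>\<^sub>F r in at_right t. g r - g t \<le> (c + \<epsilon>) * (r - t)"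
  shows "g b - g a \<le> c * (b - a)"
proof -
  have "g b - g a \<le> (c + \<epsilon>) * (b - a)" if \<epsilon>: "\<epsilon> > 0" for \<epsilon>
  proof -
    define h where "h t = g t - g a - (c + \<epsilon>) * (t - a)" for t
    have ch: "continuous_on {a..b} h"
      unfolding h_def by (intro continuous_intros cont)
    define S where "S = {t \<in> {a..b}. h t \<le> 0}"
    have "closed S" unfolding S_def
      by (intro continuous_on_closed_Collect_le ch continuous_on_const) simp
    moreover have "bounded S" by (rule bounded_subset[of "{a..b}"]) (auto simp: S_def)
    ultimately have "compact S" by (simp add: compact_eq_bounded_closed)
    moreover have "S \<noteq> {}" using ab by (auto simp: S_def h_def)
    ultimately obtain t where t: "t \<in> S" "\<And>s. s \<in> S \<Longrightarrow> s \<le> t"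
      using compact_attains_sup[of S] by auto
    have "t = b"
    proof (rule ccontr)
      assume "t \<noteq> b"
      then have tb: "a \<le> t" "t < b" using t(1) by (auto simp: S_def)
      have "\<forall>\<^sub>F r in at_right t. g r - g t \<le> (c + \<epsilon>) * (r - t)" by (rule slope[OF tb \<epsilon>])
      moreover have "\<forall>\<^sub>F r in at_right t. t < r \<and> r < b"
        using tb by (auto simp: eventually_at_right_field)
      ultimately have "\<forall>\<^sub>F r in at_right t. t < r \<and> r < b \<and> g r - g t \<le> (c + \<epsilon>) * (r - t)"
        by eventually_elim auto
      then obtain r where r: "t < r" "r < b" "g r - g t \<le> (c + \<epsilon>) * (r - t)"
        using eventually_happens'[OF trivial_limit_at_right_real] by blast
      have "h r \<le> h t" using r(3) by (simp add: h_def algebra_simps)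
      then have "r \<in> S" using r t(1) tb by (auto simp: S_def)
      then show False using t(2)[of r] r(1) by simp
    qed
    then show ?thesis using t(1) by (simp add: S_def h_def)
  qed
  then have "g b - g a \<le> c * (b - a) + e" if "e > 0" for e
  proof -
    have "g b - g a \<le> (c + e / (b - a + 1)) * (b - a)"
      using that ab by (intro \<open>\<And>\<epsilon>. \<epsilon> > 0 \<Longrightarrow> g b - g a \<le> (c + \<epsilon>) * (b - a)\<close>) auto
    also have "\<dots> = c * (b - a) + e * ((b - a) / (b - a + 1))" by (simp add: algebra_simps)
    also have "\<dots> \<le> c * (b - a) + e * 1"
      using that ab by (intro add_left_mono mult_left_mono) auto
    finally show ?thesis by simp
  qed
  then show ?thesis by (rule field_le_epsilon)
qed

text \<open>The chain rule, with a bound on the difference quotients of \<open>y\<close> in place of a derivative.\<close>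

lemma compose_right_slope:
  fixes y \<Psi> :: "real \<Rightarrow> real"
  assumes D: "(\<Psi> has_real_derivative D) (at (y t))" and B: "B \<ge> 0"
    and lip: "\<And>\<eta>. \<eta> > 0 \<Longrightarrow> \<forall>\<^sub>F r in at_right t. \<bar>y r - y t\<bar> \<le> (B + \<eta>) * (r - t)"
    and DB: "\<bar>D\<bar> * B \<le> c" and \<epsilon>: "\<epsilon> > 0"
  shows "\<forall>\<^sub>F r in at_right t. \<Psi> (y r) - \<Psi> (y t) \<le> (c + \<epsilon>) * (r - t)"
proof -
  have "((\<lambda>\<eta>. (\<bar>D\<bar> + \<eta>) * (B + \<eta>)) \<longlongrightarrow> (\<bar>D\<bar> + 0) * (B + 0)) (at_right 0)"
    by (intro tendsto_intros)
  then have "\<forall>\<^sub>F \<eta> in at_right 0. (\<bar>D\<bar> + \<eta>) * (B + \<eta>) < c + \<epsilon>"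
    using DB \<epsilon> by (intro order_tendstoD(2)) auto
  then have "\<forall>\<^sub>F \<eta> in at_right 0. \<eta> > 0 \<and> (\<bar>D\<bar> + \<eta>) * (B + \<eta>) < c + \<epsilon>"
    using eventually_at_right_less[of 0] by eventually_elim auto
  then obtain \<eta> where \<eta>: "\<eta> > 0" "(\<bar>D\<bar> + \<eta>) * (B + \<eta>) < c + \<epsilon>"
    using eventually_happens'[OF trivial_limit_at_right_real] by blast
  have "(\<Psi> has_derivative (\<lambda>h. D * h)) (at (y t))"
    using D by (simp add: has_field_derivative_def)
  then obtain d where d: "d > 0" "\<And>x. norm (x - y t) < d \<Longrightarrow> norm (\<Psi> x - \<Psi> (y t) - D * (x - y t)) \<le> \<eta> * norm (x - y t)"
    using \<eta>(1) unfolding has_derivative_at_alt by meson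
  \<comment> \<open>The slope bound with slack 1 makes \<open>y\<close> right-continuous at \<open>t\<close>, and the expansion of \<open>\<Psi>\<close> applies.\<close>
  have near: "\<forall>\<^sub>F r in at_right t. (B + 1) * (r - t) < d"
  proof -
    have "((\<lambda>r. (B + 1) * (r - t)) \<longlongrightarrow> (B + 1) * (t - t)) (at_right t)"
      by (intro tendsto_intros)
    then show ?thesis using d(1) by (intro order_tendstoD(2)) auto
  qed
  have "\<forall>\<^sub>F r in at_right t. t < r" by (rule eventually_at_right_less)
  with near lip[OF \<eta>(1)] lip[OF zero_less_one] show ?thesis
  proof eventually_elim
    case (elim r)
    have "norm (y r - y t) < d" using elim by simp
    from d(2)[OF this] have "\<Psi> (y r) - \<Psi> (y t) \<le> D * (y r - y t) + \<eta> * \<bar>y r - y t\<bar>"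
      by (simp add: abs_le_iff)
    also have "\<dots> \<le> \<bar>D\<bar> * \<bar>y r - y t\<bar> + \<eta> * \<bar>y r - y t\<bar>"
      using abs_ge_self[of "D * (y r - y t)"] by (simp add: abs_mult)
    also have "\<dots> = (\<bar>D\<bar> + \<eta>) * \<bar>y r - y t\<bar>" by (simp add: distrib_right)
    also have "\<dots> \<le> (\<bar>D\<bar> + \<eta>) * ((B + \<eta>) * (r - t))"
      using elim \<eta>(1) by (intro mult_left_mono) auto
    also have "\<dots> \<le> (c + \<epsilon>) * (r - t)"
      using elim \<eta>(2) by (simp add: mult.assoc[symmetric] mult_right_mono)
    finally show ?case .
  qed
qed

text \<open>The logarithm of \<open>1/y\<close> makes sense only before the first zero of \<open>y\<close>. Up to there \<open>y\<close> stays above the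
  positive decreasing barrier, and continuity then excludes the zero.\<close>

lemma lower_barrier:
  fixes y bar :: "real \<Rightarrow> real"
  assumes cont: "continuous_on {0..} y" and nonneg: "\<And>t. t \<ge> 0 \<Longrightarrow> y t \<ge> 0" and y0: "y 0 > 0"
    and bar_pos: "\<And>t. t \<ge> 0 \<Longrightarrow> bar t > 0" and bar_dec: "\<And>s t. 0 \<le> s \<Longrightarrow> s \<le> t \<Longrightarrow> bar t \<le> bar s"
    and step: "\<And>\<tau>. \<tau> \<ge> 0 \<Longrightarrow> (\<And>t. 0 \<le> t \<Longrightarrow> t \<le> \<tau> \<Longrightarrow> y t > 0) \<Longrightarrow> bar \<tau> \<le> y \<tau>"
    and \<tau>: "\<tau> \<ge> 0"
  shows "bar \<tau> \<le> y \<tau>"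
proof (rule step[OF \<tau>], rule ccontr)
  fix t1 assume t1: "0 \<le> t1" "t1 \<le> \<tau>" "\<not> y t1 > 0"
  define S where "S = {t \<in> {0..t1}. y t \<le> 0}"
  have "continuous_on {0..t1} y" using cont by (rule continuous_on_subset) auto
  then have "closed S" unfolding S_def
    by (intro continuous_on_closed_Collect_le continuous_on_const closed_atLeastAtMost)
  moreover have "bounded S" by (rule bounded_subset[of "{0..t1}"]) (auto simp: S_def)
  ultimately have "compact S" by (simp add: compact_eq_bounded_closed)
  moreover have "t1 \<in> S" using t1 by (simp add: S_def)
  ultimately obtain t where t: "t \<in> S" "\<And>s. s \<in> S \<Longrightarrow> t \<le> s"
    using compact_attains_inf[of S] by auto
  have t0: "t > 0" "y t = 0"
    using t(1) y0 nonneg[of t] by (auto simp: S_def) (metis less_eq_real_def not_less)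
  have before: "bar t \<le> y s" if s: "0 \<le> s" "s < t" for s
  proof -
    have "y r > 0" if "0 \<le> r" "r \<le> s" for r
    proof (rule ccontr)
      assume "\<not> y r > 0"
      then have "r \<in> S" using that s t(1) by (auto simp: S_def)
      then show False using t(2)[of r] that s by simp
    qed
    then have "bar s \<le> y s" using s by (intro step) auto
    then show ?thesis using bar_dec[of s t] s by simp
  qed
  have "continuous_on {0..t} y" using cont by (rule continuous_on_subset) auto
  then have "(y \<longlongrightarrow> y t) (at_left t)"
    by (rule continuous_on_Icc_at_leftD) (rule t0)
  moreover have "\<forall>\<^sub>F s in at_left t. bar t \<le> y s"
    using t0 before by (auto simp: eventually_at_left_field intro!: exI[of _ 0])
  ultimately have "bar t \<le> y t"
    by (intro tendsto_lowerbound[where F="at_left t"]) (auto simp: trivial_limit_at_left_real)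
  then show False using bar_pos[of t] t0 by simp
qed

text \<open>Convexity of \<open>x powr p\<close> with weights \<open>l\<close> and \<open>1 - l\<close> at the points \<open>a / l\<close> and \<open>b / (1 - l)\<close>.\<close>

lemma powr_sum_le:
  fixes a b l p :: real
  assumes "0 \<le> a" "0 \<le> b" "a + b > 0" "0 < l" "l < 1" "p \<ge> 1"
  shows "(a + b) powr p \<le> l powr (1 - p) * a powr p + (1 - l) powr (1 - p) * b powr p"
proof -
  define q where "q = 1 / p"
  have q: "0 < q" "q \<le> 1" "p * q = 1" using assms by (auto simp: q_def)
  define x where "x = a / l"
  define z where "z = b / (1 - l)"
  have xz: "0 \<le> x" "0 \<le> z" using assms by (auto simp: x_def z_def)
  define U where "U = l * x powr p + (1 - l) * z powr p"
  have "x > 0 \<or> z > 0" using assms by (auto simp: x_def z_def zero_less_divide_iff)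
  then have U: "U > 0"
  proof -
    have "0 \<le> l * x powr p" "0 \<le> (1 - l) * z powr p" using assms by auto
    moreover have "x > 0 \<Longrightarrow> 0 < l * x powr p" "z > 0 \<Longrightarrow> 0 < (1 - l) * z powr p" using assms by auto
    ultimately show ?thesis using \<open>x > 0 \<or> z > 0\<close> unfolding U_def by linarith
  qed
  have r: "w = (w powr p) powr q" if "w \<ge> 0" for w
    using that q by (cases "w = 0") (auto simp: powr_powr)
  have t: "w \<le> U powr q * (1 - q) + q * U powr (q - 1) * w powr p" if "w \<ge> 0" for w
    using powr_le_tangent[OF U, of "w powr p" q] q r[OF that] by simp
  have "a + b = l * x + (1 - l) * z" using assms by (simp add: x_def z_def)
  also have "\<dots> \<le> l * (U powr q * (1 - q) + q * U powr (q - 1) * x powr p)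
      + (1 - l) * (U powr q * (1 - q) + q * U powr (q - 1) * z powr p)"
    using assms xz by (intro add_mono mult_left_mono t) auto
  also have "\<dots> = U powr q * (1 - q) + q * U powr (q - 1) * U"
    by (simp add: U_def algebra_simps)
  also have "\<dots> = U powr q * (1 - q) + q * (U * U powr (q - 1))" by simp
  also have "U * U powr (q - 1) = U powr q" using U by (simp add: powr_mult_base)
  finally have "a + b \<le> U powr q" by (simp add: algebra_simps)
  then have "(a + b) powr p \<le> (U powr q) powr p" using assms by (intro powr_mono2) auto
  also have "\<dots> = U" using U q by (simp add: powr_powr mult.commute)
  also have "U = l powr (1 - p) * a powr p + (1 - l) powr (1 - p) * b powr p"
    using assms by (simp add: U_def x_def z_def powr_divide powr_diff)
  finally show ?thesis .
qed


text \<open>For \<open>z = ln (K / y)\<close> the quantity \<open>z powr (1 - s)\<close> grows at rate \<open>(1 - s) C\<close> at most. Convexity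
  with weights \<open>s\<close> and \<open>1 - s\<close> then bounds \<open>z\<close> by \<open>\<alpha> z(0) + (1 - s) (C t) powr p\<close>.\<close>

lemma comparison_power:
  fixes y :: "real \<Rightarrow> real" and s C K :: real
  assumes s: "0 < s" "s < 1" and C: "C \<ge> 0" and K: "K > 0"
    and cont: "continuous_on {0..} y" and nonneg: "\<And>t. t \<ge> 0 \<Longrightarrow> y t \<ge> 0" and le: "\<And>t. t \<ge> 0 \<Longrightarrow> y t \<le> K / 2"
    and slope: "\<And>t \<eta>. t \<ge> 0 \<Longrightarrow> y t > 0 \<Longrightarrow> \<eta> > 0 \<Longrightarrow>
      \<forall>\<^sub>F r in at_right t. \<bar>y r - y t\<bar> \<le> (C * (y t * ln (K / y t) powr s) + \<eta>) * (r - t)"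
    and t: "t \<ge> 0"
  defines "p \<equiv> 1 / (1 - s)" and "\<alpha> \<equiv> (1 / s) powr (s / (1 - s))"
  shows "K powr (1 - \<alpha>) * y 0 powr \<alpha> * exp (- ((1 - s) * C powr p) * t powr p) \<le> y t"
proof (cases "y 0 > 0")
  case False
  then have "y 0 = 0" using nonneg[of 0] by simp
  then show ?thesis using nonneg[OF t] by simp
next
  case y0: True
  define bar where "bar \<tau> = K powr (1 - \<alpha>) * y 0 powr \<alpha> * exp (- ((1 - s) * C powr p) * \<tau> powr p)" for \<tau>
  have p: "p \<ge> 1" "(1 - s) * p = 1" using s by (auto simp: p_def)
  have "bar t \<le> y t"
  proof (rule lower_barrier[OF cont nonneg y0 _ _ _ t])
    show "bar \<tau> > 0" for \<tau> using K y0 by (simp add: bar_def)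
    show "bar \<tau>' \<le> bar \<tau>" if "0 \<le> \<tau>" "\<tau> \<le> \<tau>'" for \<tau> \<tau>'
    proof -
      have "\<tau> powr p \<le> \<tau>' powr p" using that p by (intro powr_mono2) auto
      then show ?thesis unfolding bar_def using s by (intro mult_left_mono) (auto intro: mult_left_mono)
    qed
    fix \<tau> :: real assume \<tau>: "\<tau> \<ge> 0" and pos: "\<And>t. 0 \<le> t \<Longrightarrow> t \<le> \<tau> \<Longrightarrow> y t > 0"
    define z where "z t = ln (K / y t)" for t
    have z: "z t > 0" if "0 \<le> t" "t \<le> \<tau>" for t
    proof -
      have "K / y t \<ge> 2" using le[of t] pos[OF that] that by (simp add: pos_le_divide_eq)
      then show ?thesis unfolding z_def by (intro ln_gt_zero) simp
    qed
    have "z \<tau> powr (1 - s) - z 0 powr (1 - s) \<le> (1 - s) * C * (\<tau> - 0)"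
    proof (rule increment_le_of_right_slope[OF \<tau>])
      have "continuous_on {0..\<tau>} y" using cont by (rule continuous_on_subset) auto
      then show "continuous_on {0..\<tau>} (\<lambda>t. z t powr (1 - s))"
        unfolding z_def using pos z K by (intro continuous_intros) (fastforce simp: z_def)+
      fix t \<epsilon> :: real assume t: "0 \<le> t" "t < \<tau>" and \<epsilon>: "\<epsilon> > 0"
      have yt: "y t > 0" and zt: "z t > 0" using pos z t by auto
      show "\<forall>\<^sub>F r in at_right t. z r powr (1 - s) - z t powr (1 - s) \<le> ((1 - s) * C + \<epsilon>) * (r - t)"
        unfolding z_def
      proof (rule compose_right_slope[where \<Psi>="\<lambda>x. ln (K / x) powr (1 - s)" and y=y, OF _ _ slope[OF t(1) yt] _ \<epsilon>])
        show "((\<lambda>x. ln (K / x) powr (1 - s)) has_real_derivative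
            (- ((1 - s) * ln (K / y t) powr (- s) * (1 / y t)))) (at (y t))"
        proof -
          have "((\<lambda>x. ln (K / x)) has_real_derivative - (1 / y t)) (at (y t))"
            using yt K by (auto intro!: derivative_eq_intros simp: power2_eq_square field_simps)
          from DERIV_fun_powr[OF this, of "1 - s"] show ?thesis
            using zt by (simp add: z_def)
        qed
        show "0 \<le> C * (y t * ln (K / y t) powr s)" using C yt by simp
        have "ln (K / y t) powr (- s) * ln (K / y t) powr s = 1"
          using zt by (simp add: z_def flip: powr_add)
        then show "\<bar>- ((1 - s) * ln (K / y t) powr (- s) * (1 / y t))\<bar> * (C * (y t * ln (K / y t) powr s)) \<le> (1 - s) * C"
          using yt s by (simp add: abs_mult) (simp add: mult_ac)
      qed
    qed
    then have "z \<tau> powr (1 - s) \<le> z 0 powr (1 - s) + (1 - s) * C * \<tau>" by simp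
    then have "(z \<tau> powr (1 - s)) powr p \<le> (z 0 powr (1 - s) + (1 - s) * C * \<tau>) powr p"
      using p by (intro powr_mono2) auto
    also have "\<dots> \<le> s powr (1 - p) * (z 0 powr (1 - s)) powr p + (1 - s) powr (1 - p) * ((1 - s) * C * \<tau>) powr p"
      using s C \<tau> p z[of 0] by (intro powr_sum_le add_pos_nonneg) auto
    also have "(z 0 powr (1 - s)) powr p = z 0" using z[of 0] \<tau> p by (simp add: powr_powr)
    also have "(z \<tau> powr (1 - s)) powr p = z \<tau>" using z[of \<tau>] \<tau> p by (simp add: powr_powr)
    also have "s powr (1 - p) = \<alpha>"
    proof -
      have "1 - p = - (s / (1 - s))" using s by (simp add: p_def field_simps)
      then show ?thesis using s by (simp add: \<alpha>_def powr_minus powr_divide inverse_eq_divide)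
    qed
    also have "(1 - s) powr (1 - p) * ((1 - s) * C * \<tau>) powr p = (1 - s) * C powr p * \<tau> powr p"
      using s C \<tau> by (simp add: powr_mult powr_diff)
    finally have z\<tau>: "z \<tau> \<le> \<alpha> * z 0 + (1 - s) * C powr p * \<tau> powr p" .
    have "bar \<tau> = K * exp (- (\<alpha> * z 0 + (1 - s) * C powr p * \<tau> powr p))"
    proof -
      have "exp (- (\<alpha> * z 0)) = (y 0 / K) powr \<alpha>"
        using y0 K by (simp add: z_def powr_def ln_div algebra_simps)
      moreover have "K * (y 0 / K) powr \<alpha> = K powr (1 - \<alpha>) * y 0 powr \<alpha>"
        using y0 K by (simp add: powr_divide powr_diff)
      ultimately show ?thesis by (simp add: bar_def exp_add[symmetric] exp_diff exp_minus divide_inverse flip: mult.assoc)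
    qed
    also have "\<dots> \<le> K * exp (- z \<tau>)" using z\<tau> K by simp
    also have "\<dots> = y \<tau>" using pos[OF \<tau>] K by (simp add: z_def exp_minus)
    finally show "bar \<tau> \<le> y \<tau>" .
  qed
  then show ?thesis by (simp add: bar_def)
qed

text \<open>The borderline power \<open>s = 1\<close>: now \<open>ln z\<close> grows at rate \<open>C\<close> at most.\<close>

lemma comparison_exponential:
  fixes y :: "real \<Rightarrow> real" and C K :: real
  assumes C: "C \<ge> 0" and K: "K > 0"
    and cont: "continuous_on {0..} y" and nonneg: "\<And>t. t \<ge> 0 \<Longrightarrow> y t \<ge> 0" and le: "\<And>t. t \<ge> 0 \<Longrightarrow> y t \<le> K / 2"
    and slope: "\<And>t \<eta>. t \<ge> 0 \<Longrightarrow> y t > 0 \<Longrightarrow> \<eta> > 0 \<Longrightarrow>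
      \<forall>\<^sub>F r in at_right t. \<bar>y r - y t\<bar> \<le> (C * (y t * ln (K / y t)) + \<eta>) * (r - t)"
    and t: "t \<ge> 0"
  shows "K * (y 0 / K) powr exp (C * t) \<le> y t"
proof (cases "y 0 > 0")
  case False
  then have "y 0 = 0" using nonneg[of 0] by simp
  then show ?thesis using nonneg[OF t] by simp
next
  case y0: True
  define bar where "bar \<tau> = K * (y 0 / K) powr exp (C * \<tau>)" for \<tau>
  have "bar t \<le> y t"
  proof (rule lower_barrier[OF cont nonneg y0 _ _ _ t])
    show "bar \<tau> > 0" for \<tau> using K y0 by (simp add: bar_def)
    show "bar \<tau>' \<le> bar \<tau>" if "0 \<le> \<tau>" "\<tau> \<le> \<tau>'" for \<tau> \<tau>'
      unfolding bar_def using that C K y0 le[of 0]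
      by (intro mult_left_mono powr_mono') (auto intro: mult_left_mono)
    fix \<tau> :: real assume \<tau>: "\<tau> \<ge> 0" and pos: "\<And>t. 0 \<le> t \<Longrightarrow> t \<le> \<tau> \<Longrightarrow> y t > 0"
    define z where "z t = ln (K / y t)" for t
    have z: "z t > 0" if "0 \<le> t" "t \<le> \<tau>" for t
    proof -
      have "K / y t \<ge> 2" using le[of t] pos[OF that] that by (simp add: pos_le_divide_eq)
      then show ?thesis unfolding z_def by (intro ln_gt_zero) simp
    qed
    have "ln (z \<tau>) - ln (z 0) \<le> C * (\<tau> - 0)"
    proof (rule increment_le_of_right_slope[OF \<tau>])
      have "continuous_on {0..\<tau>} y" using cont by (rule continuous_on_subset) auto
      then show "continuous_on {0..\<tau>} (\<lambda>t. ln (z t))"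
        unfolding z_def using pos z K by (intro continuous_intros) (fastforce simp: z_def)+
      fix t \<epsilon> :: real assume t: "0 \<le> t" "t < \<tau>" and \<epsilon>: "\<epsilon> > 0"
      have yt: "y t > 0" and zt: "z t > 0" using pos z t by auto
      show "\<forall>\<^sub>F r in at_right t. ln (z r) - ln (z t) \<le> (C + \<epsilon>) * (r - t)"
        unfolding z_def
      proof (rule compose_right_slope[where \<Psi>="\<lambda>x. ln (ln (K / x))" and y=y, OF _ _ slope[OF t(1) yt] _ \<epsilon>])
        show "((\<lambda>x. ln (ln (K / x))) has_real_derivative (- (1 / ln (K / y t) * (1 / y t)))) (at (y t))"
          using yt zt K unfolding z_def
          by (auto intro!: derivative_eq_intros simp: field_simps)
        show "0 \<le> C * (y t * ln (K / y t))" using C yt zt by (simp add: z_def)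
        show "\<bar>- (1 / ln (K / y t) * (1 / y t))\<bar> * (C * (y t * ln (K / y t))) \<le> C"
          using yt zt by (simp add: z_def abs_mult)
      qed
    qed
    then have "ln (z \<tau>) \<le> ln (z 0 * exp (C * \<tau>))"
      using z[of 0] \<tau> by (simp add: ln_mult_pos)
    then have z\<tau>: "z \<tau> \<le> z 0 * exp (C * \<tau>)"
      using z[of 0] z[of \<tau>] \<tau> by (simp add: ln_le_cancel_iff)
    have "bar \<tau> = K * exp (- (z 0 * exp (C * \<tau>)))"
      using y0 K by (simp add: bar_def z_def powr_def ln_div algebra_simps)
    also have "\<dots> \<le> K * exp (- z \<tau>)" using z\<tau> K by simp
    also have "\<dots> = y \<tau>" using pos[OF \<tau>] K by (simp add: z_def exp_minus)
    finally show "bar \<tau> \<le> y \<tau>" .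
  qed
  then show ?thesis by (simp add: bar_def)
qed

section \<open>The lower bound\<close>

lemma mnorm_0_minus_commute: "mnorm 0 (F - G) = mnorm 0 (G - F)"
  using mnorm_0_uminus[of "F - G"] by simp

lemma mnorm_0_reverse_triangle: "\<bar>mnorm 0 F - mnorm 0 G\<bar> \<le> mnorm 0 (F - G)"
  using mnorm_0_triangle[of "F - G" G] mnorm_0_triangle[of "G - F" F] mnorm_0_minus_commute[of F G]
  by simp

text \<open>The norm is 1-Lipschitz, so the difference quotients of the distance are bounded by those of \<open>F\<close>,
  which converge in norm.\<close>

lemma distance_slope:
  assumes F: "Bs_has_derivative 0 F D" and t: "t \<ge> 0" and \<eta>: "\<eta> > 0"
  shows "\<forall>\<^sub>F r in at t within {0..}. \<bar>mnorm 0 (F r - M) - mnorm 0 (F t - M)\<bar> \<le> (mnorm 0 (D t) + \<eta>) * \<bar>r - t\<bar>"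
proof -
  let ?e = "\<lambda>r. (1 / (r - t)) *\<^sub>R (F r - F t) - D t"
  have "((\<lambda>r. mnorm 0 (?e r)) \<longlongrightarrow> 0) (at t within {0..})"
    using F t by (simp add: Bs_has_derivative_def)
  then have "\<forall>\<^sub>F r in at t within {0..}. mnorm 0 (?e r) < \<eta>"
    using \<eta> by (rule order_tendstoD)
  moreover have "\<forall>\<^sub>F r in at t within {0..}. r \<noteq> t"
    by (simp add: eventually_at_filter)
  ultimately show ?thesis
  proof eventually_elim
    case (elim r)
    have "F r - F t = (r - t) *\<^sub>R (?e r + D t)" using elim by simp
    then have "mnorm 0 (F r - F t) \<le> \<bar>r - t\<bar> * mnorm 0 (?e r + D t)"
      using mnorm_0_scaleR by metis
    also have "\<dots> \<le> \<bar>r - t\<bar> * (\<eta> + mnorm 0 (D t))"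
      using mnorm_0_triangle[of "?e r" "D t"] elim by (intro mult_left_mono) auto
    finally show ?case
      using mnorm_0_reverse_triangle[of "F r - M" "F t - M"] by (simp add: mult.commute add.commute)
  qed
qed

lemma continuous_on_distance:
  assumes F: "Bs_has_derivative 0 F D"
  shows "continuous_on {0..} (\<lambda>t. mnorm 0 (F t - M))"
  unfolding continuous_on_def
proof
  fix t :: real assume "t \<in> {0..}"
  then have t: "t \<ge> 0" by simp
  have "((\<lambda>r. (mnorm 0 (D t) + 1) * \<bar>r - t\<bar>) \<longlongrightarrow> (mnorm 0 (D t) + 1) * \<bar>t - t\<bar>) (at t within {0..})"
    by (intro tendsto_intros)
  then have lim: "((\<lambda>r. (mnorm 0 (D t) + 1) * \<bar>r - t\<bar>) \<longlongrightarrow> 0) (at t within {0..})" by simp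
  have "\<forall>\<^sub>F r in at t within {0..}. norm (mnorm 0 (F r - M) - mnorm 0 (F t - M)) \<le> (mnorm 0 (D t) + 1) * \<bar>r - t\<bar>"
    unfolding real_norm_def by (rule distance_slope[OF F t zero_less_one])
  from Lim_null_comparison[OF this lim]
  have "((\<lambda>r. mnorm 0 (F r - M) - mnorm 0 (F t - M)) \<longlongrightarrow> 0) (at t within {0..})" .
  then show "((\<lambda>t. mnorm 0 (F t - M)) \<longlongrightarrow> mnorm 0 (F t - M)) (at t within {0..})"
    by (simp add: LIM_zero_iff)
qed

text \<open>Extension by 0 makes the angular function Borel on the line. An integral with non-zero value is
  an integral of an integrable function, and the zonal formula moves it to the sphere.\<close>

lemma angular_extension:
  assumes N: "DIM('a::euclidean_space) \<ge> 2"
    and b: "b \<in> borel_measurable (restrict_space borel {-1..1})" "\<forall>x\<in>{-1..1}. 0 \<le> b x"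
    and A0: "A0 DIM('a) b = 1"
  obtains \<beta> :: "real \<Rightarrow> real" where "\<beta> \<in> borel_measurable borel" "\<And>x. 0 \<le> \<beta> x"
    "\<And>x. x \<in> {-1..1} \<Longrightarrow> b x = \<beta> x"
    "\<And>e::'a. norm e = 1 \<Longrightarrow> (\<integral>\<^sup>+\<sigma>. ennreal (\<beta> (e \<bullet> \<sigma>)) \<partial>usphere) = 1"
proof
  define \<beta> where "\<beta> x = indicator {-1..1} x * b x" for x :: real
  show \<beta> [measurable]: "\<beta> \<in> borel_measurable borel"
    unfolding \<beta>_def using b(1) by (subst (asm) borel_measurable_restrict_space_iff) auto
  show \<beta>0: "0 \<le> \<beta> x" for x using b(2) by (auto simp: \<beta>_def indicator_def)
  show eq: "b x = \<beta> x" if "x \<in> {-1..1}" for x using that by (simp add: \<beta>_def)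
  fix e :: 'a assume e: "norm e = 1"
  define f where "f \<theta> = indicator {0..pi} \<theta> * (\<beta> (cos \<theta>) * sin \<theta> ^ (DIM('a) - 2))" for \<theta> :: real
  have f0: "0 \<le> f \<theta>" for \<theta> using \<beta>0 by (auto simp: f_def indicator_def intro!: mult_nonneg_nonneg zero_le_power sin_ge_zero)
  have "b (cos \<theta>) = \<beta> (cos \<theta>)" for \<theta> by (rule eq) simp
  then have A: "sphere_area (DIM('a) - 2) * integral\<^sup>L lborel f = 1"
    using A0 by (simp add: A0_def set_lebesgue_integral_def f_def[abs_def])
  then have "integral\<^sup>L lborel f \<noteq> 0" by auto
  then have int: "integrable lborel f" using not_integrable_integral_eq by blast
  have area: "0 \<le> sphere_area (DIM('a) - 2)" by (simp add: sphere_area_def)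
  have "(\<integral>\<^sup>+\<sigma>. ennreal (\<beta> (e \<bullet> \<sigma>)) \<partial>usphere) = ennreal (sphere_area (DIM('a) - 2)) *
    (\<integral>\<^sup>+\<theta>. indicator {0..pi} \<theta> * (ennreal (\<beta> (cos \<theta>)) * ennreal (sin \<theta> ^ (DIM('a) - 2))) \<partial>lborel)"
    by (rule nn_integral_zonal[OF N e]) simp
  also have "(\<integral>\<^sup>+\<theta>. indicator {0..pi} \<theta> * (ennreal (\<beta> (cos \<theta>)) * ennreal (sin \<theta> ^ (DIM('a) - 2))) \<partial>lborel)
      = (\<integral>\<^sup>+\<theta>. ennreal (f \<theta>) \<partial>lborel)"
    by (rule nn_integral_cong) (auto simp: f_def indicator_def sin_ge_zero \<beta>0 ennreal_mult)
  also have "\<dots> = ennreal (integral\<^sup>L lborel f)"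
    by (rule nn_integral_eq_integral[OF int]) (simp add: f0)
  also have "ennreal (sphere_area (DIM('a) - 2)) * \<dots> = 1"
    using A area f0 by (subst ennreal_mult[symmetric]) (auto intro!: Bochner_Integration.integral_nonneg)
  finally show "(\<integral>\<^sup>+\<sigma>. ennreal (\<beta> (e \<bullet> \<sigma>)) \<partial>usphere) = 1" .
qed

lemma distance_slope_le:
  fixes b :: "real \<Rightarrow> real" and \<gamma> \<rho> T :: real and u :: "'a::euclidean_space"
    and F :: "real \<Rightarrow> 'a signed_measure"
  assumes N: "DIM('a) \<ge> 2" and \<gamma>: "0 < \<gamma>" "\<gamma> \<le> 2"
    and b: "b \<in> borel_measurable (restrict_space borel {-1..1})" "\<forall>x\<in>{-1..1}. 0 \<le> b x"
    and A0: "A0 DIM('a) b = 1" and \<rho>: "\<rho> > 0" and T: "T > 0"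
    and sol: "measure_strong_solution b \<gamma> F" and cons: "conservative F" and F0: "F 0 \<in> B_moments \<rho> u T"
  defines "y \<equiv> \<lambda>t. mnorm 0 (F t - maxwellian \<rho> u T)"
  shows "continuous_on {0..} y"
    and "t \<ge> 0 \<Longrightarrow> y t \<le> 4 * \<rho> / 2"
    and "t \<ge> 0 \<Longrightarrow> y t > 0 \<Longrightarrow> \<eta> > 0 \<Longrightarrow> \<forall>\<^sub>F r in at_right t. \<bar>y r - y t\<bar> \<le>
      (2 ^ 6 * (real DIM('a) + 1)\<^sup>2 * \<rho> * T powr (\<gamma> / 2) * (y t * ln (4 * \<rho> / y t) powr (\<gamma> / 2)) + \<eta>) * (r - t)"
proof -
  obtain D where D: "Bs_has_derivative 0 F D" "\<And>t. t \<ge> 0 \<Longrightarrow> D t = Qcoll b \<gamma> (F t) (F t)"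
    and pos: "\<And>t. t \<ge> 0 \<Longrightarrow> F t \<in> Bs_pos 2"
    using sol unfolding measure_strong_solution_def by blast
  show "continuous_on {0..} y" unfolding y_def by (rule continuous_on_distance[OF D(1)])
  obtain \<beta> where \<beta>: "\<beta> \<in> borel_measurable borel" "\<And>x. 0 \<le> \<beta> x"
    "\<And>x. x \<in> {-1..1} \<Longrightarrow> b x = \<beta> x"
    "\<And>e::'a. norm e = 1 \<Longrightarrow> (\<integral>\<^sup>+\<sigma>. ennreal (\<beta> (e \<bullet> \<sigma>)) \<partial>usphere) = 1"
    using angular_extension[OF N b A0] by blast
  let ?E = "real DIM('a) * \<rho> * T"
  have coll: "collision \<mu> u \<rho> ?E \<beta> \<gamma>" if "velocity_measure \<mu> u \<rho> ?E" for \<mu>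
    using that \<beta> \<gamma> by (simp add: collision_def collision_axioms_def)
  note M = coll[OF maxwell_velocity_measure[OF \<rho> T]]
  {
    fix t :: real assume t: "t \<ge> 0"
    note F = coll[OF conservative_velocity_measure[OF pos cons F0 \<rho> t]]
    have Ft: "of_measure (pos_variation (F t)) = F t"
      by (rule Bs_pos_2_moments(1)[OF pos[OF t]])
    note bound = collision_norm_bound[OF N T \<rho> F M \<beta>(3) A0, unfolded Ft, folded y_def]
    show "y t \<le> 4 * \<rho> / 2" using bound(1) by (simp add: y_def)
    assume yt: "y t > 0" and \<eta>: "\<eta> > 0"
    have D_le: "mnorm 0 (D t) \<le> 2 ^ 6 * (real DIM('a) + 1)\<^sup>2 * \<rho> * T powr (\<gamma> / 2) * (y t * ln (4 * \<rho> / y t) powr (\<gamma> / 2))"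
      using bound(2) yt by (simp add: D(2)[OF t] y_def)
    have "at_right t \<le> at t within {0..}" using t by (intro at_le) auto
    from filter_leD[OF this distance_slope[OF D(1) t \<eta>, of "maxwellian \<rho> u T"]]
    have "\<forall>\<^sub>F r in at_right t. \<bar>y r - y t\<bar> \<le> (mnorm 0 (D t) + \<eta>) * \<bar>r - t\<bar>" by (simp add: y_def)
    moreover have "\<forall>\<^sub>F r in at_right t. t < r" by (rule eventually_at_right_less)
    ultimately show "\<forall>\<^sub>F r in at_right t. \<bar>y r - y t\<bar> \<le>
      (2 ^ 6 * (real DIM('a) + 1)\<^sup>2 * \<rho> * T powr (\<gamma> / 2) * (y t * ln (4 * \<rho> / y t) powr (\<gamma> / 2)) + \<eta>) * (r - t)"
    proof eventually_elim
      case (elim r)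
      have "(mnorm 0 (D t) + \<eta>) * \<bar>r - t\<bar> \<le>
        (2 ^ 6 * (real DIM('a) + 1)\<^sup>2 * \<rho> * T powr (\<gamma> / 2) * (y t * ln (4 * \<rho> / y t) powr (\<gamma> / 2)) + \<eta>) * (r - t)"
        using elim D_le by (simp add: mult_right_mono)
      with elim(1) show ?case by (rule order_trans)
    qed
  }
qed

theorem theorem1p7:
  fixes b :: "real \<Rightarrow> real" and \<gamma> \<rho> T :: real and u :: "'a::euclidean_space"
    and F :: "real \<Rightarrow> 'a signed_measure"
  assumes "DIM('a) \<ge> 2" and "0 < \<gamma>" and "\<gamma> \<le> 2"
    and "b \<in> borel_measurable (restrict_space borel {-1..1})"
    and "\<forall>x\<in>{-1..1}. 0 \<le> b x"
    and "A0 DIM('a) b = 1"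
    and "\<rho> > 0" and "T > 0"
    and "measure_strong_solution b \<gamma> F" and "conservative F"
    and "F 0 \<in> B_moments \<rho> u T"
  shows "let N = real DIM('a); M = maxwellian \<rho> u T in
         (\<gamma> < 2 \<longrightarrow>
           (let \<alpha> = (2 / \<gamma>) powr (\<gamma> / (2 - \<gamma>));
                \<beta> = (1 - \<gamma> / 2) * (2 ^ 6 * (N + 1)\<^sup>2 * \<rho> * T powr (\<gamma> / 2)) powr (2 / (2 - \<gamma>))
            in \<forall>t\<ge>0. mnorm 0 (F t - M)
                 \<ge> (4 * \<rho>) powr (1 - \<alpha>) * mnorm 0 (F 0 - M) powr \<alpha>
                    * exp (- \<beta> * t powr (2 / (2 - \<gamma>)))))
       \<and> (\<gamma> = 2 \<longrightarrow>
           (let \<kappa> = 2 ^ 6 * (N + 1)\<^sup>2 * \<rho> * T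
            in \<forall>t\<ge>0. mnorm 0 (F t - M)
                 \<ge> 4 * \<rho> * (mnorm 0 (F 0 - M) / (4 * \<rho>)) powr exp (\<kappa> * t)))"
proof -
  define y where "y t = mnorm 0 (F t - maxwellian \<rho> u T)" for t
  define C where "C = 2 ^ 6 * (real DIM('a) + 1)\<^sup>2 * \<rho> * T powr (\<gamma> / 2)"
  note slope = distance_slope_le[OF assms, folded y_def C_def]
  have C: "C \<ge> 0" and K: "4 * \<rho> > 0" using assms by (auto simp: C_def)
  have nonneg: "y t \<ge> 0" for t by (simp add: y_def)
  have 1: "(4 * \<rho>) powr (1 - (2 / \<gamma>) powr (\<gamma> / (2 - \<gamma>))) * y 0 powr ((2 / \<gamma>) powr (\<gamma> / (2 - \<gamma>)))
      * exp (- ((1 - \<gamma> / 2) * C powr (2 / (2 - \<gamma>))) * t powr (2 / (2 - \<gamma>))) \<le> y t"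
    if t: "t \<ge> 0" and \<gamma>: "\<gamma> < 2" for t
  proof -
    have e: "1 / (1 - \<gamma> / 2) = 2 / (2 - \<gamma>)" "1 / (\<gamma> / 2) = 2 / \<gamma>" "\<gamma> / 2 / (1 - \<gamma> / 2) = \<gamma> / (2 - \<gamma>)"
      using \<gamma> assms(2) by (auto simp: field_simps)
    have s: "0 < \<gamma> / 2" "\<gamma> / 2 < 1" using \<gamma> assms(2) by auto
    show ?thesis
      using comparison_power[OF s C K slope(1) nonneg slope(2) slope(3) t] unfolding e by simp
  qed
  have 2: "4 * \<rho> * (y 0 / (4 * \<rho>)) powr exp (C * t) \<le> y t" if t: "t \<ge> 0" and \<gamma>: "\<gamma> = 2" for t
  proof (rule comparison_exponential[OF C K slope(1) nonneg slope(2) _ t])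
    fix t \<eta> :: real assume t: "t \<ge> 0" and yt: "y t > 0" and \<eta>: "\<eta> > 0"
    have "4 * \<rho> / y t \<ge> 1" using slope(2)[OF t] yt assms(7) by (simp add: pos_le_divide_eq)
    then have "ln (4 * \<rho> / y t) powr (\<gamma> / 2) = ln (4 * \<rho> / y t)" by (simp add: \<gamma>)
    then show "\<forall>\<^sub>F r in at_right t. \<bar>y r - y t\<bar> \<le> (C * (y t * ln (4 * \<rho> / y t)) + \<eta>) * (r - t)"
      using slope(3)[OF t yt \<eta>] by simp
  qed
  show ?thesis
    unfolding Let_def using 1 2 assms(8) by (simp add: y_def C_def)
qed

end
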